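(* Let $(M,g)=(\mathbb{S}^d,\mathrm{can})$ be the $d$-dimensional sphere equipped with its canonical metric, and let $V\in C^\infty(\mathbb{S}^d;\mathbb{R})$. Let $\omega\subseteq\mathbb{S}^d$ be an open set such that $\mathbb{S}^d\setminus\overline{\omega}$ contains a geodesic. Then, for every $\alpha>0$: (i) For no $T>0$ does there exist a constant $C>0$ such that $$\|u^0\|_{L^2(\mathbb{S}^d)}^2\leq C\int_0^T\int_\omega |e^{-it((-\Delta)^{\alpha/2}+V)}u^0(x)|^2\,dx\,dt\qquad\text{for all }u^0\in L^2(\mathbb{S}^d).$$ (ii) If in addition $V=0$, then there is no constant $C>0$ such that $\|\varphi\|_{L^2(\mathbb{S}^d)}\leq C\|\varphi\|_{L^2(\omega)}$ holds for every $L^2$-eigenfunction $\varphi$ of $(-\Delta)^{\alpha/2}$ (with $C$ uniform with respect to the eigenvalue).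
   Context: $\Delta$ is the Laplace-Beltrami operator of $(\mathbb{S}^d,\mathrm{can})$; $(-\Delta)^{\alpha/2}$ is defined by the spectral theorem. $e^{-it((-\Delta)^{\alpha/2}+V)}$ is the unitary group on $L^2(\mathbb{S}^d)$ generated by the self-adjoint operator $(-\Delta)^{\alpha/2}+V$. The geodesics of $\mathbb{S}^d$ are the great circles. *)

theory Defs
  imports "HOL-Analysis.Analysis"
begin

text \<open>
  The sphere \<open>S\<^sup>d\<close> is \<open>sphere (0::'a) 1\<close> for a Euclidean space \<open>'a\<close> with \<open>DIM('a) = d + 1\<close>.
  A function on the sphere is represented by a function on \<open>'a\<close> of which only the values on the
  sphere matter; \<open>\<lambda>y. f (sgn y)\<close>, where \<open>sgn y = y /\<^sub>R norm y\<close>, is its radially constant extension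
  to \<open>'a - {0}\<close>.
\<close>

subsection \<open>The round sphere\<close>

text \<open>
  The Riemannian volume of \<open>S\<^sup>d\<close> by integration in polar coordinates: the volume of \<open>B\<close> is \<open>d + 1\<close>
  times the Lebesgue measure of the cone \<open>{r x | 0 < r \<le> 1, x \<in> B}\<close>.
\<close>

definition sphere_measure :: "'a::euclidean_space measure" where
  "sphere_measure =
     scale_measure (of_nat DIM('a))
       (distr (restrict_space lborel (cball 0 1 - {0})) (restrict_space borel (sphere 0 1)) sgn)"

definition great_circle :: "'a::euclidean_space set \<Rightarrow> bool" where
  "great_circle \<gamma> \<longleftrightarrow>
     (\<exists>p q. norm p = 1 \<and> norm q = 1 \<and> p \<bullet> q = 0 \<and>
            \<gamma> = range (\<lambda>t. cos t *\<^sub>R p + sin t *\<^sub>R q))"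

primrec Ck_on :: "nat \<Rightarrow> 'a::euclidean_space set \<Rightarrow> ('a \<Rightarrow> 'b::real_normed_vector) \<Rightarrow> bool" where
  "Ck_on 0 S f \<longleftrightarrow> continuous_on S f"
| "Ck_on (Suc k) S f \<longleftrightarrow>
     f differentiable_on S \<and> (\<forall>b\<in>Basis. Ck_on k S (\<lambda>x. frechet_derivative f (at x) b))"

definition sphere_smooth :: "('a::euclidean_space \<Rightarrow> 'b::real_normed_vector) \<Rightarrow> bool" where
  "sphere_smooth f \<longleftrightarrow> (\<forall>k. Ck_on k (- {0}) (\<lambda>y. f (sgn y)))"

text \<open>
  At \<open>x\<close> on the sphere, \<open>y \<mapsto> sgn y\<close> has as derivative the orthogonal projection \<open>\<Pi>\<^sub>x\<close> onto the tangent
  space, so \<open>sphere_deriv b f x\<close> is \<open>df\<^sub>x (\<Pi>\<^sub>x b)\<close>, the \<open>b\<close>-component of the Riemannian gradient.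
  Likewise the Riemannian divergence of a tangent field \<open>X\<close>, the trace of \<open>v \<mapsto> \<Pi>\<^sub>x (dX\<^sub>x v)\<close> on the
  tangent space, is the sum over \<open>b \<in> Basis\<close> of \<open>sphere_deriv b (X \<bullet> b) x\<close>. Hence
  \<open>sphere_laplacian\<close> is div grad, for complex functions by complex linearity.
\<close>

definition sphere_deriv :: "'a::euclidean_space \<Rightarrow> ('a \<Rightarrow> complex) \<Rightarrow> 'a \<Rightarrow> complex" where
  "sphere_deriv b f x = frechet_derivative (\<lambda>y. f (sgn y)) (at x) b"

definition sphere_laplacian :: "('a::euclidean_space \<Rightarrow> complex) \<Rightarrow> 'a \<Rightarrow> complex" where
  "sphere_laplacian f x = (\<Sum>b\<in>Basis. sphere_deriv b (sphere_deriv b f) x)"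

subsection \<open>Operators on \<open>L\<^sup>2\<close>\<close>

text \<open>
  Elements of \<open>L\<^sup>2\<close> are represented by square-integrable functions. Unbounded operators are given by
  their graphs, which are sets of pairs of such functions closed under almost-everywhere equality.
\<close>

definition L2 :: "'a measure \<Rightarrow> ('a \<Rightarrow> complex) set" where
  "L2 M = {f. f \<in> borel_measurable M \<and> integrable M (\<lambda>x. (cmod (f x))\<^sup>2)}"

definition L2_inner :: "'a measure \<Rightarrow> ('a \<Rightarrow> complex) \<Rightarrow> ('a \<Rightarrow> complex) \<Rightarrow> complex" where
  "L2_inner M f g = (LINT x|M. f x * cnj (g x))"

definition L2_norm :: "'a measure \<Rightarrow> ('a \<Rightarrow> complex) \<Rightarrow> real" where
  "L2_norm M f = sqrt (LINT x|M. (cmod (f x))\<^sup>2)"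

definition projection_valued_measure ::
    "'a measure \<Rightarrow> (real set \<Rightarrow> ('a \<Rightarrow> complex) \<Rightarrow> ('a \<Rightarrow> complex)) \<Rightarrow> bool" where
  "projection_valued_measure M E \<longleftrightarrow>
     (\<forall>B\<in>sets borel. \<forall>f\<in>L2 M. E B f \<in> L2 M) \<and>
     (\<forall>B\<in>sets borel. \<forall>f\<in>L2 M. \<forall>g\<in>L2 M. \<forall>a b.
        AE x in M. E B (\<lambda>y. a * f y + b * g y) x = a * E B f x + b * E B g x) \<and>
     (\<forall>B\<in>sets borel. \<forall>f\<in>L2 M. \<forall>g\<in>L2 M. L2_inner M (E B f) g = L2_inner M f (E B g)) \<and>
     (\<forall>A\<in>sets borel. \<forall>B\<in>sets borel. \<forall>f\<in>L2 M. AE x in M. E (A \<inter> B) f x = E A (E B f) x) \<and>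
     (\<forall>f\<in>L2 M. AE x in M. E UNIV f x = f x) \<and>
     (\<forall>A :: nat \<Rightarrow> real set. range A \<subseteq> sets borel \<longrightarrow> disjoint_family A \<longrightarrow> (\<forall>f\<in>L2 M.
        (\<lambda>n. L2_norm M (\<lambda>x. (\<Sum>i<n. E (A i) f x) - E (\<Union>i. A i) f x)) \<longlonglongrightarrow> 0))"

text \<open>The Borel measure \<open>B \<mapsto> \<langle>E(B) f, f\<rangle> = \<parallel>E(B) f\<parallel>\<^sup>2\<close> on the real line.\<close>

definition scalar_spectral_measure ::
    "'a measure \<Rightarrow> (real set \<Rightarrow> ('a \<Rightarrow> complex) \<Rightarrow> ('a \<Rightarrow> complex)) \<Rightarrow> ('a \<Rightarrow> complex) \<Rightarrow> real measure" where
  "scalar_spectral_measure M E f =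
     measure_of UNIV (sets borel) (\<lambda>B. ennreal ((L2_norm M (E B f))\<^sup>2))"

text \<open>
  \<open>spectral_integral M E F\<close> is the operator \<open>\<integral> F dE\<close>, with domain the \<open>f\<close> such that \<open>F\<close> is square
  integrable for the scalar spectral measure \<open>\<mu>\<close> of \<open>f\<close>: on simple functions the integral is a
  finite sum, and \<open>s \<mapsto> (\<integral> s dE) f\<close> is extended by isometry from simple functions to \<open>L\<^sup>2(\<mu>)\<close>.
\<close>

definition spectral_integral ::
    "'a measure \<Rightarrow> (real set \<Rightarrow> ('a \<Rightarrow> complex) \<Rightarrow> ('a \<Rightarrow> complex)) \<Rightarrow> (real \<Rightarrow> complex) \<Rightarrow>
     (('a \<Rightarrow> complex) \<times> ('a \<Rightarrow> complex)) set" where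
  "spectral_integral M E F =
     {(f, g). f \<in> L2 M \<and> g \<in> L2 M \<and>
        (\<exists>s :: nat \<Rightarrow> real \<Rightarrow> complex. (\<forall>n. simple_function borel (s n)) \<and>
           (\<lambda>n. \<integral>\<^sup>+ r. ennreal ((cmod (s n r - F r))\<^sup>2) \<partial>scalar_spectral_measure M E f) \<longlonglongrightarrow> 0 \<and>
           (\<lambda>n. L2_norm M (\<lambda>x. (\<Sum>z\<in>range (s n). z * E (s n -` {z}) f x) - g x)) \<longlonglongrightarrow> 0)}"

definition spectral_resolution ::
    "'a measure \<Rightarrow> (('a \<Rightarrow> complex) \<times> ('a \<Rightarrow> complex)) set \<Rightarrow>
     (real set \<Rightarrow> ('a \<Rightarrow> complex) \<Rightarrow> ('a \<Rightarrow> complex)) \<Rightarrow> bool" where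
  "spectral_resolution M A E \<longleftrightarrow>
     projection_valued_measure M E \<and> A = spectral_integral M E complex_of_real"

definition eigenfunction ::
    "'a measure \<Rightarrow> (('a \<Rightarrow> complex) \<times> ('a \<Rightarrow> complex)) set \<Rightarrow> ('a \<Rightarrow> complex) \<Rightarrow> bool" where
  "eigenfunction M A \<phi> \<longleftrightarrow>
     \<phi> \<in> L2 M \<and> \<not> (AE x in M. \<phi> x = 0) \<and> (\<exists>\<mu>::complex. (\<phi>, \<lambda>x. \<mu> * \<phi> x) \<in> A)"

definition strongly_continuous_unitary_group ::
    "'a measure \<Rightarrow> (real \<Rightarrow> ('a \<Rightarrow> complex) \<Rightarrow> ('a \<Rightarrow> complex)) \<Rightarrow> bool" where
  "strongly_continuous_unitary_group M U \<longleftrightarrow>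
     (\<forall>t. \<forall>f\<in>L2 M. U t f \<in> L2 M) \<and>
     (\<forall>t. \<forall>f\<in>L2 M. \<forall>g\<in>L2 M. \<forall>a b.
        AE x in M. U t (\<lambda>y. a * f y + b * g y) x = a * U t f x + b * U t g x) \<and>
     (\<forall>t. \<forall>f\<in>L2 M. L2_norm M (U t f) = L2_norm M f) \<and>
     (\<forall>f\<in>L2 M. AE x in M. U 0 f x = f x) \<and>
     (\<forall>s t. \<forall>f\<in>L2 M. AE x in M. U (s + t) f x = U s (U t f) x) \<and>
     (\<forall>f\<in>L2 M. ((\<lambda>t. L2_norm M (\<lambda>x. U t f x - f x)) \<longlongrightarrow> 0) (at 0))"

text \<open>
  \<open>U t = e\<^bsup>-itA\<^esup>\<close> in the sense of Stone's theorem: \<open>f\<close> is in the domain of \<open>A\<close> iff \<open>t \<mapsto> U t f\<close> is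
  differentiable at \<open>0\<close>, and the derivative is then \<open>-iAf\<close>.
\<close>

definition generates_unitary_group ::
    "'a measure \<Rightarrow> (('a \<Rightarrow> complex) \<times> ('a \<Rightarrow> complex)) set \<Rightarrow>
     (real \<Rightarrow> ('a \<Rightarrow> complex) \<Rightarrow> ('a \<Rightarrow> complex)) \<Rightarrow> bool" where
  "generates_unitary_group M A U \<longleftrightarrow>
     strongly_continuous_unitary_group M U \<and>
     A = {(f, g). f \<in> L2 M \<and> g \<in> L2 M \<and>
            ((\<lambda>t. L2_norm M (\<lambda>x. (U t f x - f x) / of_real t + \<i> * g x)) \<longlongrightarrow> 0) (at 0)}"

subsection \<open>The operators on the sphere\<close>

text \<open>
  The self-adjoint operator \<open>-\<Delta>\<close>: the \<open>L\<^sup>2\<close>-closure of \<open>-\<Delta>\<close> on smooth functions, on which it is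
  essentially self-adjoint because the sphere is compact.
\<close>

definition neg_laplacian :: "(('a::euclidean_space \<Rightarrow> complex) \<times> ('a \<Rightarrow> complex)) set" where
  "neg_laplacian =
     {(f, g). f \<in> L2 sphere_measure \<and> g \<in> L2 sphere_measure \<and>
        (\<exists>\<phi> :: nat \<Rightarrow> 'a \<Rightarrow> complex. (\<forall>n. sphere_smooth (\<phi> n)) \<and>
           (\<lambda>n. L2_norm sphere_measure (\<lambda>x. \<phi> n x - f x)) \<longlonglongrightarrow> 0 \<and>
           (\<lambda>n. L2_norm sphere_measure (\<lambda>x. - sphere_laplacian (\<phi> n) x - g x)) \<longlonglongrightarrow> 0)}"

text \<open>For the spectral resolution \<open>E\<close> of \<open>-\<Delta>\<close>, this is \<open>(-\<Delta>)\<^bsup>s\<^esup>\<close>.\<close>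

definition laplacian_power ::
    "(real set \<Rightarrow> ('a::euclidean_space \<Rightarrow> complex) \<Rightarrow> ('a \<Rightarrow> complex)) \<Rightarrow> real \<Rightarrow>
     (('a \<Rightarrow> complex) \<times> ('a \<Rightarrow> complex)) set" where
  "laplacian_power E s = spectral_integral sphere_measure E (\<lambda>r. complex_of_real (r powr s))"

definition add_potential ::
    "(('a \<Rightarrow> complex) \<times> ('a \<Rightarrow> complex)) set \<Rightarrow> ('a \<Rightarrow> real) \<Rightarrow>
     (('a \<Rightarrow> complex) \<times> ('a \<Rightarrow> complex)) set" where
  "add_potential A V = {(f, \<lambda>x. g x + of_real (V x) * f x) | f g. (f, g) \<in> A}"

end

theory Submission
  imports Defs
begin

text \<open>
  Let \<open>p, q\<close> be orthonormal and span the plane of the avoided great circle. The functions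
  \<open>u\<^sub>n(x) = (x \<bullet> p + \<i> (x \<bullet> q))\<^sup>n\<close> are eigenfunctions of \<open>- \<Delta>\<close>, hence of every
  power of it. Write \<open>H = (- \<Delta>)\<^bsup>\<alpha>/2\<^esup> + V\<close>, and let \<open>L\<^bsub>ab\<^esub>\<close> (below: \<open>Lrot a b\<close>) be the
  generator of the rotations in the plane spanned by an orthonormal pair \<open>a, b\<close>.

  Rotations commute with functions of \<open>- \<Delta>\<close>, and moving \<open>V\<close> by a rotation of angle \<open>s\<close> changes
  it by \<open>O(s)\<close>; therefore \<open>e\<^bsup>-itH\<^esup>\<close> commutes with a rotation of angle \<open>s\<close> up to
  \<open>O(s t)\<close>, and, for \<open>s \<rightarrow> 0\<close>, with each \<open>L\<^bsub>ab\<^esub>\<close> up to a bounded operator, in the weak sense. As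
  \<open>L\<^bsub>pq\<^esub> u\<^sub>n = \<i> n u\<^sub>n\<close>, and \<open>\<parallel>L\<^bsub>pw\<^esub> u\<^sub>n\<parallel> = O(\<surd>n) \<parallel>u\<^sub>n\<parallel>\<close> and
  \<open>\<parallel>L\<^bsub>qw\<^esub> u\<^sub>n\<parallel> = O(\<surd>n) \<parallel>u\<^sub>n\<parallel>\<close> for \<open>w\<close> orthogonal to \<open>p, q\<close>, the same holds for
  \<open>f = e\<^bsup>-itH\<^esup> u\<^sub>n\<close> up to \<open>O(1) \<parallel>u\<^sub>n\<parallel>\<close>. The identity
  \<open>(x \<bullet> w) L\<^bsub>pq\<^esub> + (x \<bullet> p) L\<^bsub>qw\<^esub> + (x \<bullet> q) L\<^bsub>wp\<^esub> = 0\<close> then gives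
  \<open>n \<parallel>(x \<bullet> w) f\<parallel> = O(\<surd>n) \<parallel>u\<^sub>n\<parallel>\<close>, so that the mass of \<open>f\<close> away from the great circle is
  \<open>O(1/n) \<parallel>u\<^sub>n\<parallel>\<^sup>2\<close>, uniformly for bounded \<open>t\<close>. This disproves both estimates.
\<close>

section \<open>Rotation invariance of the measure on the sphere\<close>

text \<open>Two obstacles shape the argument. The evolved state is only known to lie in
  \<open>L2\<close>, so it cannot be differentiated: every rotation generator acts either on
  \<open>u_n\<close> or, by skew symmetry, on a polynomial test function, and
  \<open>norm_le_spoly\<close> turns the resulting weak bounds into norm bounds. Moreover the
  spectral resolution is given only by its axioms. That it commutes with rotations is read off on
  polynomials, which restrict to sums of eigenpolynomials, and is carried over by density. The
  exponent then enters only through the number \<open>l powr (\<alpha> / 2)\<close> at an eigenvalue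
  \<open>l\<close>, and no commutator with a fractional power has to be computed. The rate sqrt n
  comes from L_wp L_pw + L_wq L_qw = n on u_n: by skew symmetry the squared norms of L_pw u_n and
  L_qw u_n add up to n times that of u_n. In the constant \<open>2 + 3 * M\<close> the 2 counts
  these two generators and the 3 counts the commutator errors, one for each plane in the identity
  between the generators.\<close>

text \<open>Fubini for the integral of 1_A(x) 1_B(x + y) over \<open>M\<close> times Lebesgue
  measure. Integrating in y first uses translation invariance of Lebesgue measure; integrating in x
  first uses that of \<open>M\<close>, and then the reflection y to x - y, which preserves Lebesgue
  measure.\<close>

lemma translation_invariant_measure_unique:
  fixes M :: "'a::euclidean_space measure"
  assumes sets [measurable_cong]: "sets M = sets borel" and sf: "sigma_finite_measure M"
    and inv: "\<And>c. distr M borel ((+) c) = M"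
    and A [measurable]: "A \<in> sets borel" and B [measurable]: "B \<in> sets borel"
  shows "emeasure M A * emeasure lborel B = emeasure lborel A * emeasure M B"
proof -
  interpret M: sigma_finite_measure M by fact
  interpret P: pair_sigma_finite M lborel ..
  interpret Q: pair_sigma_finite lborel M ..
  let ?i = "indicator :: 'a set \<Rightarrow> 'a \<Rightarrow> ennreal"
  have 1: "(\<integral>\<^sup>+y. ?i B (x + y) \<partial>lborel) = emeasure lborel B" for x
  proof -
    have "emeasure lborel B = (\<integral>\<^sup>+y. ?i B y \<partial>distr lborel borel ((+) x))"
      by (simp add: lborel_distr_plus)
    also have "\<dots> = (\<integral>\<^sup>+y. ?i B (x + y) \<partial>lborel)"
      by (rule nn_integral_distr) auto
    finally show ?thesis by simp
  qed
  have 2: "(\<integral>\<^sup>+x. ?i A x * ?i B (x + y) \<partial>M) = (\<integral>\<^sup>+x. ?i A (x - y) * ?i B x \<partial>M)" for y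
  proof -
    have "(\<integral>\<^sup>+x. ?i A (x - y) * ?i B x \<partial>M) = (\<integral>\<^sup>+x. ?i A (x - y) * ?i B x \<partial>distr M borel ((+) y))"
      by (simp add: inv)
    also have "\<dots> = (\<integral>\<^sup>+x. ?i A (y + x - y) * ?i B (y + x) \<partial>M)"
      by (rule nn_integral_distr) auto
    finally show ?thesis by (simp add: add.commute)
  qed
  have 3: "(\<integral>\<^sup>+y. ?i A (x - y) \<partial>lborel) = emeasure lborel A" for x
  proof -
    have "emeasure lborel A = (\<integral>\<^sup>+y. ?i A y \<partial>density (distr lborel borel (\<lambda>y. x + (-1) *\<^sub>R y)) (\<lambda>_. ennreal (\<bar>-1::real\<bar> ^ DIM('a))))"
      by (subst lborel_affine[symmetric]) auto
    also have "\<dots> = (\<integral>\<^sup>+y. ?i A y \<partial>distr lborel borel (\<lambda>y. x + (-1) *\<^sub>R y))"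
      by (simp add: density_1)
    also have "\<dots> = (\<integral>\<^sup>+y. ?i A (x + (-1) *\<^sub>R y) \<partial>lborel)"
      by (rule nn_integral_distr) auto
    finally show ?thesis by simp
  qed
  have "emeasure M A * emeasure lborel B = (\<integral>\<^sup>+x. ?i A x * emeasure lborel B \<partial>M)"
    by (simp add: nn_integral_multc sets)
  also have "\<dots> = (\<integral>\<^sup>+x. \<integral>\<^sup>+y. ?i A x * ?i B (x + y) \<partial>lborel \<partial>M)"
    by (subst nn_integral_cmult) (auto simp: 1)
  also have "\<dots> = (\<integral>\<^sup>+y. \<integral>\<^sup>+x. ?i A x * ?i B (x + y) \<partial>M \<partial>lborel)"
    by (subst P.Fubini') auto
  also have "\<dots> = (\<integral>\<^sup>+y. \<integral>\<^sup>+x. ?i A (x - y) * ?i B x \<partial>M \<partial>lborel)"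
    by (simp add: 2)
  also have "\<dots> = (\<integral>\<^sup>+x. \<integral>\<^sup>+y. ?i A (x - y) * ?i B x \<partial>lborel \<partial>M)"
    by (subst Q.Fubini') auto
  also have "\<dots> = (\<integral>\<^sup>+x. emeasure lborel A * ?i B x \<partial>M)"
    by (subst nn_integral_multc) (auto simp: 3)
  also have "\<dots> = emeasure lborel A * emeasure M B"
    by (simp add: nn_integral_cmult sets)
  finally show ?thesis .
qed

lemma orthogonal_transformation_measurable:
  assumes "orthogonal_transformation (T::'a::euclidean_space \<Rightarrow> 'a)"
  shows "T \<in> borel_measurable borel"
  by (intro borel_measurable_continuous_onI linear_continuous_on linear_linear[THEN iffD2]
        orthogonal_transformation_linear assms)

text \<open>As \<open>T\<close> is linear and onto, translating the image measure by
  \<open>T d\<close> is the same as translating by \<open>d\<close> before applying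
  \<open>T\<close>; hence the image measure is translation invariant and proportional to Lebesgue
  measure. The factor is 1 because \<open>T\<close> preserves the unit ball.\<close>

lemma lborel_distr_orthogonal_transformation:
  fixes T :: "'a::euclidean_space \<Rightarrow> 'a"
  assumes T: "orthogonal_transformation T"
  shows "distr lborel borel T = lborel"
proof -
  have [measurable]: "T \<in> borel_measurable borel"
    by (rule orthogonal_transformation_measurable[OF T])
  have lin: "linear T" by (rule orthogonal_transformation_linear[OF T])
  have normT: "norm (T x) = norm x" for x by (rule orthogonal_transformation_norm[OF T])
  let ?M = "distr lborel borel T"
  have ball: "emeasure ?M (ball 0 r) = emeasure lborel (ball (0::'a) r)" for r
  proof -
    have "emeasure ?M (ball 0 r) = emeasure lborel (T -` ball 0 r \<inter> space lborel)"
      by (rule emeasure_distr) auto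
    also have "T -` ball 0 r \<inter> space lborel = ball 0 r" by (auto simp: normT)
    finally show ?thesis .
  qed
  have sf: "sigma_finite_measure ?M"
  proof
    show "\<exists>A. countable A \<and> A \<subseteq> sets ?M \<and> \<Union> A = space ?M \<and> (\<forall>a\<in>A. emeasure ?M a \<noteq> \<infinity>)"
    proof (intro exI[of _ "range (\<lambda>n::nat. ball 0 (real n))"] conjI)
      show "\<Union> (range (\<lambda>n::nat. ball 0 (real n))) = space ?M"
        by (auto simp: reals_Archimedean2)
    qed (use emeasure_lborel_ball_finite[of "0::'a"] in \<open>auto simp: ball less_top\<close>)
  qed
  have inv: "distr ?M borel ((+) c) = ?M" for c
  proof -
    from orthogonal_transformation_surj[OF T] obtain d where d: "T d = c" by (metis surjD)
    have "distr ?M borel ((+) c) = distr lborel borel ((+) c \<circ> T)"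
      by (rule distr_distr) auto
    also have "(+) c \<circ> T = T \<circ> (+) d" by (auto simp: fun_eq_iff linear_add[OF lin] d)
    also have "distr lborel borel (T \<circ> (+) d) = distr (distr lborel borel ((+) d)) borel T"
      by (rule distr_distr[symmetric]) auto
    finally show ?thesis by (simp add: lborel_distr_plus)
  qed
  show ?thesis
  proof (rule measure_eqI)
    fix B assume "B \<in> sets ?M"
    then have B: "B \<in> sets borel" by simp
    have "emeasure ?M (ball 0 1) * emeasure lborel B = emeasure lborel (ball (0::'a) 1) * emeasure ?M B"
      using translation_invariant_measure_unique[OF _ sf inv _ B, of "ball 0 1"] by simp
    moreover have "emeasure lborel (ball (0::'a) 1) \<noteq> 0"
      using content_ball_pos[of 1 "0::'a"] by (auto simp: measure_def)
    moreover have "emeasure lborel (ball (0::'a) 1) \<noteq> top"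
      using emeasure_lborel_ball_finite[of "0::'a" 1] by (simp add: less_top)
    ultimately show "emeasure ?M B = emeasure lborel B"
      unfolding ball by (simp add: ennreal_mult_cancel_left)
  qed simp
qed

section \<open>The cone measure on the sphere\<close>

lemma space_sphere_measure [simp]: "space (sphere_measure::'a::euclidean_space measure) = sphere 0 1"
  by (simp add: sphere_measure_def space_scale_measure space_restrict_space)

lemma sets_sphere_measure [measurable_cong]:
  "sets (sphere_measure::'a::euclidean_space measure) = sets (restrict_space borel (sphere 0 1))"
  by (simp add: sphere_measure_def)

lemma sgn_measurable_sphere:
  "(sgn::'a::euclidean_space \<Rightarrow> 'a) \<in> restrict_space lborel (cball 0 1 - {0}) \<rightarrow>\<^sub>M restrict_space borel (sphere 0 1)"
  by (rule measurable_restrict_space2)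
     (auto simp: space_restrict_space norm_sgn sgn_div_norm
        intro!: measurable_restrict_space1)

lemma emeasure_sphere_measure:
  fixes B :: "'a::euclidean_space set"
  assumes B: "B \<in> sets borel" "B \<subseteq> sphere 0 1"
  shows "emeasure sphere_measure B = of_nat DIM('a) * emeasure lborel {x \<in> cball 0 1 - {0}. sgn x \<in> B}"
proof -
  have B': "B \<in> sets (restrict_space borel (sphere 0 1))"
    using B by (simp add: sets_restrict_space_iff Int_absorb2)
  have "emeasure sphere_measure B = of_nat DIM('a) * emeasure (restrict_space lborel (cball 0 1 - {0}))
       (sgn -` B \<inter> space (restrict_space lborel (cball 0 1 - {0})))"
    unfolding sphere_measure_def
    by (simp add: emeasure_distr[OF sgn_measurable_sphere B'])
  also have "sgn -` B \<inter> space (restrict_space lborel (cball 0 1 - {0})) = {x \<in> cball 0 1 - {0}. sgn x \<in> B}"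
    by (auto simp: space_restrict_space)
  finally show ?thesis by (simp add: emeasure_restrict_space subset_iff)
qed

lemma finite_measure_sphere_measure: "finite_measure (sphere_measure::'a::euclidean_space measure)"
proof
  have "emeasure (sphere_measure::'a measure) (sphere 0 1) \<le> of_nat DIM('a) * emeasure lborel (cball (0::'a) 1)"
    by (subst emeasure_sphere_measure) (auto intro!: mult_left_mono emeasure_mono)
  also have "\<dots> < \<infinity>"
    using emeasure_lborel_cball_finite[of "0::'a" 1] by (simp add: ennreal_mult_less_top of_nat_less_top)
  finally show "emeasure (sphere_measure::'a measure) (space sphere_measure) \<noteq> \<infinity>" by simp
qed

interpretation sphere_measure: finite_measure sphere_measure
  by (rule finite_measure_sphere_measure)

lemma sgn_orthogonal_transformation:
  assumes "orthogonal_transformation (T::'a::euclidean_space \<Rightarrow> 'a)"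
  shows "sgn (T x) = T (sgn x)"
  using assms by (simp add: sgn_div_norm orthogonal_transformation_norm orthogonal_transformation_scaleR)

lemma orthogonal_transformation_measurable_sphere:
  assumes "orthogonal_transformation (T::'a::euclidean_space \<Rightarrow> 'a)"
  shows "T \<in> sphere_measure \<rightarrow>\<^sub>M sphere_measure"
proof -
  have "T \<in> restrict_space borel (sphere 0 1) \<rightarrow>\<^sub>M restrict_space borel (sphere 0 1)"
    by (rule measurable_restrict_space2)
       (auto simp: space_restrict_space orthogonal_transformation_norm[OF assms]
         intro!: measurable_restrict_space1 orthogonal_transformation_measurable assms)
  then show ?thesis
    by (simp cong: measurable_cong_sets add: sets_sphere_measure)
qed

text \<open>\<open>sgn\<close> commutes with \<open>T\<close>, so the cone over the preimage of
  \<open>B\<close> is the preimage of the cone over \<open>B\<close>, and invariance of Lebesgue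
  measure applies.\<close>

lemma sphere_measure_distr_orthogonal_transformation:
  fixes T :: "'a::euclidean_space \<Rightarrow> 'a"
  assumes T: "orthogonal_transformation T"
  shows "distr sphere_measure sphere_measure T = sphere_measure"
proof (rule measure_eqI)
  have Tm: "T \<in> borel_measurable borel" by (rule orthogonal_transformation_measurable[OF T])
  have normT: "norm (T x) = norm x" for x by (rule orthogonal_transformation_norm[OF T])
  have T0: "T x = 0 \<longleftrightarrow> x = 0" for x by (metis normT norm_eq_zero)
  fix B assume "B \<in> sets (distr sphere_measure sphere_measure T)"
  then have B: "B \<in> sets borel" "B \<subseteq> sphere 0 1" and B': "B \<in> sets sphere_measure"
    by (auto simp: sets_sphere_measure sets_restrict_space_iff)
  let ?K = "{x \<in> cball 0 1 - {0}. sgn x \<in> B}"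
  have TB: "T -` B \<in> sets borel" using measurable_sets[OF Tm B(1)] by simp
  have KB: "?K \<in> sets borel"
  proof -
    have "(sgn::'a\<Rightarrow>'a) \<in> borel_measurable borel" unfolding sgn_div_norm by measurable
    from measurable_sets[OF this B(1)] have "(sgn::'a\<Rightarrow>'a) -` B \<in> sets borel" by simp
    moreover have "?K = (cball 0 1 - {0}) \<inter> sgn -` B" by auto
    ultimately show ?thesis by simp
  qed
  have "emeasure (distr sphere_measure sphere_measure T) B = emeasure sphere_measure (T -` B \<inter> space sphere_measure)"
    by (rule emeasure_distr[OF orthogonal_transformation_measurable_sphere[OF T] B'])
  also have "T -` B \<inter> space sphere_measure = T -` B" using B(2) by (auto simp: normT)
  also have "emeasure sphere_measure (T -` B) = of_nat DIM('a) * emeasure lborel {x \<in> cball 0 1 - {0}. sgn x \<in> T -` B}"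
    by (rule emeasure_sphere_measure) (use TB B(2) in \<open>auto simp: normT\<close>)
  also have "{x \<in> cball 0 1 - {0}. sgn x \<in> T -` B} = T -` ?K \<inter> space lborel"
    by (auto simp: sgn_orthogonal_transformation[OF T] normT T0)
  also have "emeasure lborel \<dots> = emeasure (distr lborel borel T) ?K"
    by (rule emeasure_distr[symmetric]) (use Tm KB in auto)
  also have "\<dots> = emeasure lborel ?K" by (simp add: lborel_distr_orthogonal_transformation[OF T])
  also have "of_nat DIM('a) * \<dots> = emeasure sphere_measure B"
    by (rule emeasure_sphere_measure[symmetric]) fact+
  finally show "emeasure (distr sphere_measure sphere_measure T) B = emeasure sphere_measure B" .
qed simp

lemma emeasure_sphere_measure_open_pos:
  fixes S :: "'a::euclidean_space set"
  assumes S: "open S" and x: "x \<in> S" "norm x = 1"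
  shows "emeasure sphere_measure (S \<inter> sphere 0 1) > 0"
proof -
  let ?K = "(sgn -` S \<inter> - {0}) \<inter> ball 0 1"
  have "continuous_on (- {0}) (sgn :: 'a \<Rightarrow> 'a)" by (intro continuous_intros) auto
  then have "open (sgn -` S \<inter> - {0::'a})"
    using continuous_on_open_vimage[of "- {0}" "sgn::'a\<Rightarrow>'a"] S by (metis open_Compl closed_singleton)
  then have op: "open ?K" by (rule open_Int) simp
  \<comment> \<open>The point \<open>x\<close> lies on the boundary of the ball; halfway to the
    origin the cone contains a full neighbourhood.\<close>
  have sx: "sgn ((1/2) *\<^sub>R x) = x" using x by (simp add: sgn_div_norm)
  then have "(1/2) *\<^sub>R x \<in> ?K" using x by auto
  then obtain e where e: "e > 0" "ball ((1/2) *\<^sub>R x) e \<subseteq> ?K" using op openE by blast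
  have "0 < emeasure lborel (ball ((1/2) *\<^sub>R x) e)"
    using content_ball_pos[OF e(1), of "(1/2) *\<^sub>R x"] by (auto simp: measure_def zero_less_iff_neq_zero)
  also have "\<dots> \<le> emeasure lborel ?K" by (rule emeasure_mono) (use e(2) op in auto)
  finally have "emeasure lborel ?K > 0" .
  then have "0 < of_nat DIM('a) * emeasure lborel ?K" by (simp add: ennreal_zero_less_mult_iff)
  also have "\<dots> \<le> of_nat DIM('a) * emeasure lborel {x \<in> cball 0 1 - {0}. sgn x \<in> S \<inter> sphere 0 1}"
  proof (intro mult_left_mono emeasure_mono)
    have "{x \<in> cball 0 1 - {0}. sgn x \<in> S \<inter> sphere 0 1} = (sgn -` S \<inter> - {0}) \<inter> cball 0 1"
      by (auto simp: norm_sgn)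
    then show "{x \<in> cball 0 1 - {0}. sgn x \<in> S \<inter> sphere 0 1} \<in> sets lborel"
      using \<open>open (sgn -` S \<inter> - {0})\<close> by (simp add: sets.Int borel_open)
  qed (auto simp: norm_sgn)
  also have "\<dots> = emeasure sphere_measure (S \<inter> sphere 0 1)"
    by (rule emeasure_sphere_measure[symmetric]) (use S in \<open>auto intro: borel_closed\<close>)
  finally show ?thesis .
qed

section \<open>The Hilbert space of the sphere\<close>

lemma L2_measurable: "f \<in> L2 M \<Longrightarrow> f \<in> borel_measurable M"
  and L2_integrable: "f \<in> L2 M \<Longrightarrow> integrable M (\<lambda>x. (cmod (f x))\<^sup>2)"
  by (auto simp: L2_def)

lemma L2_0 [simp]: "(\<lambda>x. 0) \<in> L2 M"
  by (simp add: L2_def)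

lemma L2_mult_bounded:
  assumes f: "f \<in> L2 M" and m: "m \<in> borel_measurable M" and b: "\<And>x. x \<in> space M \<Longrightarrow> cmod (m x) \<le> K"
  shows "(\<lambda>x. m x * f x) \<in> L2 M"
proof -
  have "integrable M (\<lambda>x. (cmod (m x * f x))\<^sup>2)"
  proof (rule Bochner_Integration.integrable_bound)
    show "integrable M (\<lambda>x. K\<^sup>2 * (cmod (f x))\<^sup>2)" by (simp add: L2_integrable[OF f])
    show "(\<lambda>x. (cmod (m x * f x))\<^sup>2) \<in> borel_measurable M" using L2_measurable[OF f] m by simp
    show "AE x in M. norm ((cmod (m x * f x))\<^sup>2) \<le> norm (K\<^sup>2 * (cmod (f x))\<^sup>2)"
      by (rule AE_I2) (auto simp: norm_mult power_mult_distrib intro!: mult_right_mono power_mono b)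
  qed
  with L2_measurable[OF f] m show ?thesis by (simp add: L2_def)
qed

lemma L2_cmult: "f \<in> L2 M \<Longrightarrow> (\<lambda>x. c * f x) \<in> L2 M"
  by (rule L2_mult_bounded[of _ _ "\<lambda>_. c" "cmod c"]) auto

lemma L2_add:
  assumes f: "f \<in> L2 M" and g: "g \<in> L2 M"
  shows "(\<lambda>x. f x + g x) \<in> L2 M"
proof -
  have "integrable M (\<lambda>x. (cmod (f x + g x))\<^sup>2)"
  proof (rule Bochner_Integration.integrable_bound)
    show "integrable M (\<lambda>x. 2 * (cmod (f x))\<^sup>2 + 2 * (cmod (g x))\<^sup>2)"
      by (simp add: L2_integrable f g)
    show "(\<lambda>x. (cmod (f x + g x))\<^sup>2) \<in> borel_measurable M" using L2_measurable[OF f] L2_measurable[OF g] by simp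
    show "AE x in M. norm ((cmod (f x + g x))\<^sup>2) \<le> norm (2 * (cmod (f x))\<^sup>2 + 2 * (cmod (g x))\<^sup>2)"
    proof (rule AE_I2)
      fix x
      have "(cmod (f x + g x))\<^sup>2 \<le> (cmod (f x) + cmod (g x))\<^sup>2"
        by (intro power_mono norm_triangle_ineq) auto
      also have "\<dots> \<le> 2 * (cmod (f x))\<^sup>2 + 2 * (cmod (g x))\<^sup>2"
        using sum_squares_bound[of "cmod (f x)" "cmod (g x)"] by (simp add: power2_sum)
      finally show "norm ((cmod (f x + g x))\<^sup>2) \<le> norm (2 * (cmod (f x))\<^sup>2 + 2 * (cmod (g x))\<^sup>2)"
        by simp
    qed
  qed
  with L2_measurable[OF f] L2_measurable[OF g] show ?thesis by (simp add: L2_def)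
qed

lemma L2_uminus: "f \<in> L2 M \<Longrightarrow> (\<lambda>x. - f x) \<in> L2 M"
  using L2_cmult[of f M "-1"] by simp

lemma L2_diff: "f \<in> L2 M \<Longrightarrow> g \<in> L2 M \<Longrightarrow> (\<lambda>x. f x - g x) \<in> L2 M"
  using L2_add[of f M "\<lambda>x. - g x"] L2_uminus[of g M] by simp

lemma L2_sum: "(\<And>i. i \<in> I \<Longrightarrow> f i \<in> L2 M) \<Longrightarrow> (\<lambda>x. \<Sum>i\<in>I. f i x) \<in> L2 M"
  by (induction I rule: infinite_finite_induct) (auto intro: L2_add)

lemma L2_integrable_mult_cnj:
  assumes f: "f \<in> L2 M" and g: "g \<in> L2 M"
  shows "integrable M (\<lambda>x. f x * cnj (g x))"
proof (rule Bochner_Integration.integrable_bound)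
  show "integrable M (\<lambda>x. (cmod (f x))\<^sup>2 + (cmod (g x))\<^sup>2)"
    by (simp add: L2_integrable f g)
  show "(\<lambda>x. f x * cnj (g x)) \<in> borel_measurable M"
    using L2_measurable[OF f] L2_measurable[OF g] borel_measurable_continuous_onI[of cnj]
    by (auto intro!: borel_measurable_times measurable_compose[of g M borel cnj] continuous_intros)
  show "AE x in M. norm (f x * cnj (g x)) \<le> norm ((cmod (f x))\<^sup>2 + (cmod (g x))\<^sup>2)"
  proof (rule AE_I2)
    fix x
    have "2 * (cmod (f x) * cmod (g x)) \<le> (cmod (f x))\<^sup>2 + (cmod (g x))\<^sup>2"
      using sum_squares_bound[of "cmod (f x)" "cmod (g x)"] by (simp add: mult.assoc)
    moreover have "0 \<le> cmod (f x) * cmod (g x)" by simp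
    ultimately have "cmod (f x) * cmod (g x) \<le> (cmod (f x))\<^sup>2 + (cmod (g x))\<^sup>2" by linarith
    then show "norm (f x * cnj (g x)) \<le> norm ((cmod (f x))\<^sup>2 + (cmod (g x))\<^sup>2)"
      by (simp add: norm_mult)
  qed
qed

\<comment> \<open>The quotient by null functions as a real inner product space\<close>
\<comment> \<open>On the quotient, norm zero means zero, so limits, derivatives and the mean value
  inequality for normed spaces become available. The relation is partial because functions outside
  \<open>L2\<close> represent nothing. The inner product below is the real part of the Hermitian
  one; complex scalars return as multiplication operators by constants.\<close>
quotient_type (overloaded) 'a hs = "'a::euclidean_space \<Rightarrow> complex" /
  partial: "\<lambda>f g. f \<in> L2 sphere_measure \<and> g \<in> L2 sphere_measure \<and> (AE x in sphere_measure. f x = g x)"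
proof (rule part_equivpI)
  show "\<exists>f::'a \<Rightarrow> complex. f \<in> L2 sphere_measure \<and> f \<in> L2 sphere_measure \<and> (AE x in sphere_measure. f x = f x)"
    by (rule exI[of _ "\<lambda>x. 0"]) simp
qed (auto simp: symp_def transp_def eq_commute elim: eventually_elim2)

instantiation hs :: (euclidean_space) real_vector
begin

lift_definition zero_hs :: "'a hs" is "\<lambda>x. 0" by simp
lift_definition plus_hs :: "'a hs \<Rightarrow> 'a hs \<Rightarrow> 'a hs" is "\<lambda>f g x. f x + g x"
  by (auto intro: L2_add elim: eventually_elim2)
lift_definition uminus_hs :: "'a hs \<Rightarrow> 'a hs" is "\<lambda>f x. - f x"
  by (auto intro: L2_uminus elim: eventually_mono)
lift_definition minus_hs :: "'a hs \<Rightarrow> 'a hs \<Rightarrow> 'a hs" is "\<lambda>f g x. f x - g x"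
  by (auto intro: L2_diff elim: eventually_elim2)
lift_definition scaleR_hs :: "real \<Rightarrow> 'a hs \<Rightarrow> 'a hs" is "\<lambda>r f x. of_real r * f x"
  by (auto intro: L2_cmult elim: eventually_mono)
instance
proof
  fix F G H :: "'a hs" and r s :: real
  show "F + G + H = F + (G + H)" by transfer (auto intro: L2_add simp: add.assoc)
  show "F + G = G + F" by transfer (auto intro: L2_add simp: add.commute)
  show "0 + F = F" by transfer auto
  show "- F + F = 0" by transfer (auto intro: L2_add)
  show "F - G = F + - G" by transfer (auto intro: L2_diff)
  show "r *\<^sub>R (F + G) = r *\<^sub>R F + r *\<^sub>R G" by transfer (auto intro: L2_cmult L2_add simp: distrib_left)
  show "(r + s) *\<^sub>R F = r *\<^sub>R F + s *\<^sub>R F" by transfer (auto intro: L2_cmult L2_add simp: distrib_right)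
  show "r *\<^sub>R s *\<^sub>R F = (r * s) *\<^sub>R F" by transfer (auto intro: L2_cmult)
  show "1 *\<^sub>R F = F" by transfer auto
qed

end

instantiation hs :: (euclidean_space) real_inner
begin

lift_definition inner_hs :: "'a hs \<Rightarrow> 'a hs \<Rightarrow> real" is "\<lambda>f g. Re (LINT x|sphere_measure. f x * cnj (g x))"
  by (rule arg_cong[of _ _ Re], rule integral_cong_AE)
     (auto intro!: borel_measurable_integrable L2_integrable_mult_cnj elim: eventually_elim2)

definition norm_hs :: "'a hs \<Rightarrow> real" where "norm_hs F = sqrt (F \<bullet> F)"
definition sgn_hs :: "'a hs \<Rightarrow> 'a hs" where "sgn_hs F = F /\<^sub>R norm F"
definition dist_hs :: "'a hs \<Rightarrow> 'a hs \<Rightarrow> real" where "dist_hs F G = norm (F - G)"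
definition uniformity_hs :: "('a hs \<times> 'a hs) filter"
  where "uniformity_hs = (INF e\<in>{0<..}. principal {(x::'a hs, y). dist x y < e})"
definition open_hs :: "'a hs set \<Rightarrow> bool"
  where "open_hs S = (\<forall>x\<in>S. \<forall>\<^sub>F (x', y) in uniformity. x' = x \<longrightarrow> y \<in> S)"

instance
proof
  fix F G H :: "'a hs" and r :: real
  show "dist F G = norm (F - G)" by (rule dist_hs_def)
  show "sgn F = F /\<^sub>R norm F" by (rule sgn_hs_def)
  show "norm F = sqrt (F \<bullet> F)" by (rule norm_hs_def)
  show "(uniformity :: ('a hs \<times> 'a hs) filter) = (INF e\<in>{0<..}. principal {(x, y). dist x y < e})"
    by (rule uniformity_hs_def)
  show "open U = (\<forall>x\<in>U. \<forall>\<^sub>F (x', y) in uniformity. x' = x \<longrightarrow> y \<in> U)" for U :: "'a hs set"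
    by (rule open_hs_def)
  show "F \<bullet> G = G \<bullet> F"
  proof transfer
    fix f g :: "'a \<Rightarrow> complex"
    have "Re (LINT x|sphere_measure. f x * cnj (g x)) = Re (cnj (LINT x|sphere_measure. f x * cnj (g x)))" by simp
    also have "cnj (LINT x|sphere_measure. f x * cnj (g x)) = (LINT x|sphere_measure. cnj (f x * cnj (g x)))"
      by (rule Bochner_Integration.integral_cnj[symmetric])
    finally show "Re (LINT x|sphere_measure. f x * cnj (g x)) = Re (LINT x|sphere_measure. g x * cnj (f x))"
      by (simp add: mult.commute)
  qed
  show "(F + G) \<bullet> H = F \<bullet> H + G \<bullet> H"
    by transfer (auto simp: L2_integrable_mult_cnj distrib_right)
  show "r *\<^sub>R F \<bullet> G = r * (F \<bullet> G)"
    by transfer (auto simp: L2_integrable_mult_cnj mult.assoc)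
  show "0 \<le> F \<bullet> F"
  proof transfer
    fix f :: "'a \<Rightarrow> complex"
    assume "f \<in> L2 sphere_measure \<and> f \<in> L2 sphere_measure \<and> (AE x in sphere_measure. f x = f x)"
    then show "0 \<le> Re (LINT x|sphere_measure. f x * cnj (f x))"
      by (simp add: complex_norm_square[symmetric] del: of_real_power)
  qed
  show "F \<bullet> F = 0 \<longleftrightarrow> F = 0"
  proof transfer
    fix f :: "'a \<Rightarrow> complex"
    assume "f \<in> L2 sphere_measure \<and> f \<in> L2 sphere_measure \<and> (AE x in sphere_measure. f x = f x)"
    then have f: "f \<in> L2 sphere_measure" by simp
    have "(LINT x|sphere_measure. (cmod (f x))\<^sup>2) = 0 \<longleftrightarrow> (AE x in sphere_measure. (cmod (f x))\<^sup>2 = 0)"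
      by (rule integral_nonneg_eq_0_iff_AE[OF L2_integrable[OF f]]) simp
    then show "(Re (LINT x|sphere_measure. f x * cnj (f x)) = 0) =
       (f \<in> L2 sphere_measure \<and> (\<lambda>x. 0::complex) \<in> L2 sphere_measure \<and> (AE x in sphere_measure. f x = 0))"
      using f by (simp add: complex_norm_square[symmetric] del: of_real_power)
  qed
qed

end

lemma abs_hs_eq_iff:
  "f \<in> L2 sphere_measure \<Longrightarrow> g \<in> L2 sphere_measure \<Longrightarrow> abs_hs f = abs_hs g \<longleftrightarrow> (AE x in sphere_measure. f x = g x)"
  using Quotient3_rel[OF Quotient3_hs, of f g] by simp

lemma abs_hs_cong:
  assumes "f \<in> L2 sphere_measure" "g \<in> L2 sphere_measure" "\<And>x. norm x = 1 \<Longrightarrow> f x = g x"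
  shows "abs_hs f = abs_hs g"
  using assms by (subst abs_hs_eq_iff) (auto intro!: AE_I2)

lemma rep_hs_L2 [simp]: "rep_hs F \<in> L2 sphere_measure"
  using Quotient3_rep_reflp[OF Quotient3_hs, of F] by simp

lemma abs_rep_hs [simp]: "abs_hs (rep_hs F) = F"
  by (rule Quotient3_abs_rep[OF Quotient3_hs])

lemma hs_cases: obtains f where "f \<in> L2 sphere_measure" "F = abs_hs f"
  by (rule that[of "rep_hs F"]) simp_all

lemma abs_hs_zero: "abs_hs (\<lambda>x. 0) = 0"
  by (simp add: zero_hs.abs_eq)

lemma abs_hs_add:
  "f \<in> L2 sphere_measure \<Longrightarrow> g \<in> L2 sphere_measure \<Longrightarrow> abs_hs (\<lambda>x. f x + g x) = abs_hs f + abs_hs g"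
  by (simp add: plus_hs.abs_eq)

lemma abs_hs_diff:
  "f \<in> L2 sphere_measure \<Longrightarrow> g \<in> L2 sphere_measure \<Longrightarrow> abs_hs (\<lambda>x. f x - g x) = abs_hs f - abs_hs g"
  by (simp add: minus_hs.abs_eq)

lemma abs_hs_uminus: "f \<in> L2 sphere_measure \<Longrightarrow> abs_hs (\<lambda>x. - f x) = - abs_hs f"
  by (simp add: uminus_hs.abs_eq)

lemma abs_hs_scaleR: "f \<in> L2 sphere_measure \<Longrightarrow> abs_hs (\<lambda>x. of_real r * f x) = r *\<^sub>R abs_hs f"
  by (simp add: scaleR_hs.abs_eq)

lemma abs_hs_sum:
  "(\<And>i. i \<in> I \<Longrightarrow> f i \<in> L2 sphere_measure) \<Longrightarrow> abs_hs (\<lambda>x. \<Sum>i\<in>I. f i x) = (\<Sum>i\<in>I. abs_hs (f i))"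
  by (induction I rule: infinite_finite_induct) (auto simp: abs_hs_zero abs_hs_add L2_sum)

lemma inner_abs_hs:
  "f \<in> L2 sphere_measure \<Longrightarrow> g \<in> L2 sphere_measure \<Longrightarrow>
   abs_hs f \<bullet> abs_hs g = Re (LINT x|sphere_measure. f x * cnj (g x))"
  by (simp add: inner_hs.abs_eq)

lemma norm_abs_hs: "f \<in> L2 sphere_measure \<Longrightarrow> norm (abs_hs f) = L2_norm sphere_measure f"
  by (simp add: norm_eq_sqrt_inner inner_abs_hs L2_norm_def complex_norm_square[symmetric] del: of_real_power)

lemma norm_abs_hs_diff:
  "f \<in> L2 sphere_measure \<Longrightarrow> g \<in> L2 sphere_measure \<Longrightarrow>
   L2_norm sphere_measure (\<lambda>x. f x - g x) = norm (abs_hs f - abs_hs g)"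
  by (simp add: norm_abs_hs[symmetric] abs_hs_diff L2_diff)

lemma abs_hs_tendsto_dominated:
  fixes f :: "'a::euclidean_space \<Rightarrow> complex"
  assumes f: "f \<in> L2 sphere_measure" and s: "\<And>k. s k \<in> L2 sphere_measure"
    and w: "integrable sphere_measure w"
    and lim: "\<And>x. norm x = 1 \<Longrightarrow> (\<lambda>k. s k x) \<longlonglongrightarrow> f x"
    and le: "\<And>k x. norm x = 1 \<Longrightarrow> (cmod (s k x - f x))\<^sup>2 \<le> w x"
  shows "(\<lambda>k. abs_hs (s k)) \<longlonglongrightarrow> abs_hs f"
proof -
  have "(\<lambda>k. LINT x|sphere_measure. (cmod (s k x - f x))\<^sup>2) \<longlonglongrightarrow> (LINT x|(sphere_measure :: 'a measure). 0)"
  proof (rule integral_dominated_convergence[where w = w])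
    show "AE x in sphere_measure. (\<lambda>k. (cmod (s k x - f x))\<^sup>2) \<longlonglongrightarrow> 0"
    proof (rule AE_I2)
      fix x :: 'a assume "x \<in> space sphere_measure"
      then have "(\<lambda>k. (cmod (s k x - f x))\<^sup>2) \<longlonglongrightarrow> (cmod (f x - f x))\<^sup>2"
        by (intro tendsto_intros lim) simp
      then show "(\<lambda>k. (cmod (s k x - f x))\<^sup>2) \<longlonglongrightarrow> 0" by simp
    qed
  qed (use L2_measurable[OF f] L2_measurable[OF s] w le in auto)
  then have "(\<lambda>k. sqrt (LINT x|sphere_measure. (cmod (s k x - f x))\<^sup>2)) \<longlonglongrightarrow> sqrt 0"
    by (intro tendsto_real_sqrt) simp
  then have "(\<lambda>k. norm (abs_hs (s k) - abs_hs f)) \<longlonglongrightarrow> 0"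
    by (simp add: norm_abs_hs_diff[OF s f, symmetric] L2_norm_def)
  then show ?thesis by (simp add: tendsto_norm_zero_iff LIM_zero_iff)
qed

section \<open>Operators on the quotient: multiplications and pullbacks\<close>

definition hs_respects :: "(('a::euclidean_space \<Rightarrow> complex) \<Rightarrow> ('a \<Rightarrow> complex)) \<Rightarrow> bool" where
  "hs_respects \<Phi> \<longleftrightarrow> (\<forall>f\<in>L2 sphere_measure. \<Phi> f \<in> L2 sphere_measure) \<and>
     (\<forall>f\<in>L2 sphere_measure. \<forall>g\<in>L2 sphere_measure.
        (AE x in sphere_measure. f x = g x) \<longrightarrow> (AE x in sphere_measure. \<Phi> f x = \<Phi> g x))"

definition hs_op :: "(('a::euclidean_space \<Rightarrow> complex) \<Rightarrow> ('a \<Rightarrow> complex)) \<Rightarrow> 'a hs \<Rightarrow> 'a hs" where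
  "hs_op \<Phi> F = abs_hs (\<Phi> (rep_hs F))"

lemma hs_op_abs_hs:
  assumes "hs_respects \<Phi>" "f \<in> L2 sphere_measure"
  shows "hs_op \<Phi> (abs_hs f) = abs_hs (\<Phi> f)"
proof -
  have "abs_hs (rep_hs (abs_hs f)) = abs_hs f" by simp
  then have "AE x in sphere_measure. rep_hs (abs_hs f) x = f x"
    by (subst (asm) abs_hs_eq_iff) (use assms in auto)
  then show ?thesis using assms unfolding hs_op_def
    by (subst abs_hs_eq_iff) (auto simp: hs_respects_def)
qed

text \<open>Linearity up to null sets is not enough for an operator to descend to the quotient; for an
  operator bounded for the seminorm it is.\<close>

lemma hs_respectsI_bounded:
  assumes L2: "\<And>f. f \<in> L2 sphere_measure \<Longrightarrow> \<Phi> f \<in> L2 sphere_measure"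
    and lin: "\<And>f g a b. f \<in> L2 sphere_measure \<Longrightarrow> g \<in> L2 sphere_measure \<Longrightarrow>
        AE x in sphere_measure. \<Phi> (\<lambda>y. a * f y + b * g y) x = a * \<Phi> f x + b * \<Phi> g x"
    and bd: "\<And>f. f \<in> L2 sphere_measure \<Longrightarrow> L2_norm sphere_measure (\<Phi> f) \<le> L2_norm sphere_measure f"
  shows "hs_respects \<Phi>"
  unfolding hs_respects_def
proof (intro conjI ballI impI)
  fix f g :: "'a \<Rightarrow> complex" assume f: "f \<in> L2 sphere_measure" and g: "g \<in> L2 sphere_measure"
    and eq: "AE x in sphere_measure. f x = g x"
  let ?d = "\<lambda>y. 1 * f y + (-1) * g y"
  have d: "?d \<in> L2 sphere_measure" using L2_diff[OF f g] by simp
  have "abs_hs ?d = 0" using abs_hs_diff[OF f g] abs_hs_eq_iff[OF f g] eq by simp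
  then have "L2_norm sphere_measure ?d = 0" using norm_abs_hs[OF d] by simp
  then have "norm (abs_hs (\<Phi> ?d)) \<le> 0"
    using bd[OF d] norm_abs_hs[OF L2[OF d]] by simp
  moreover have "abs_hs (\<Phi> ?d) = abs_hs (\<lambda>x. \<Phi> f x - \<Phi> g x)"
    using lin[OF f g, of 1 "-1"] by (subst abs_hs_eq_iff) (auto intro: L2 L2_diff f g d)
  ultimately have "abs_hs (\<Phi> f) = abs_hs (\<Phi> g)"
    by (simp add: abs_hs_diff L2 f g)
  then show "AE x in sphere_measure. \<Phi> f x = \<Phi> g x" by (simp add: abs_hs_eq_iff L2 f g)
qed (use L2 in auto)

definition mult_hs :: "('a::euclidean_space \<Rightarrow> complex) \<Rightarrow> 'a hs \<Rightarrow> 'a hs" where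
  "mult_hs m = hs_op (\<lambda>f x. m x * f x)"

definition bounded_mult :: "('a::euclidean_space \<Rightarrow> complex) \<Rightarrow> real \<Rightarrow> bool" where
  "bounded_mult m K \<longleftrightarrow> m \<in> borel_measurable sphere_measure \<and> (\<forall>x. norm x = 1 \<longrightarrow> cmod (m x) \<le> K)"

lemma bounded_mult_const: "bounded_mult (\<lambda>x. c) (cmod c)"
  by (simp add: bounded_mult_def)

lemma L2_bounded_mult: "bounded_mult m K \<Longrightarrow> f \<in> L2 sphere_measure \<Longrightarrow> (\<lambda>x. m x * f x) \<in> L2 sphere_measure"
  by (rule L2_mult_bounded[of _ _ _ K]) (auto simp: bounded_mult_def)

lemma mult_hs_abs_hs:
  assumes m: "bounded_mult m K" and f: "f \<in> L2 sphere_measure"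
  shows "mult_hs m (abs_hs f) = abs_hs (\<lambda>x. m x * f x)"
  unfolding mult_hs_def
  by (rule hs_op_abs_hs[OF _ f]) (auto simp: hs_respects_def intro: L2_bounded_mult[OF m])

lemma mult_hs_add: "bounded_mult m K \<Longrightarrow> mult_hs m (F + G) = mult_hs m F + mult_hs m G"
  by (cases F rule: hs_cases; cases G rule: hs_cases)
     (simp add: mult_hs_abs_hs abs_hs_add[symmetric] L2_add L2_bounded_mult distrib_left)

lemma mult_hs_scaleR: "bounded_mult m K \<Longrightarrow> mult_hs m (r *\<^sub>R F) = r *\<^sub>R mult_hs m F"
  by (cases F rule: hs_cases)
     (simp add: mult_hs_abs_hs abs_hs_scaleR[symmetric] L2_cmult L2_bounded_mult mult.left_commute)

lemma L2_norm_mult_le: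
  assumes m: "bounded_mult m K" and f: "f \<in> L2 sphere_measure"
  shows "L2_norm sphere_measure (\<lambda>x. m x * f x) \<le> K * L2_norm sphere_measure f"
proof -
  \<comment> \<open>A point of the sphere shows that the bound \<open>K\<close> is nonnegative,
    which \<open>bounded_mult\<close> does not state.\<close>
  obtain z :: 'a where z: "norm z = 1" using vector_choose_size[of 1] by auto
  have K: "0 \<le> K" using m z norm_ge_zero[of "m z"] unfolding bounded_mult_def by (metis order_trans)
  have "(LINT x|sphere_measure. (cmod (m x * f x))\<^sup>2) \<le> (LINT x|sphere_measure. K\<^sup>2 * (cmod (f x))\<^sup>2)"
    by (rule integral_mono)
       (use m in \<open>auto simp: L2_integrable f L2_bounded_mult[OF m] norm_mult power_mult_distrib bounded_mult_def
         intro!: mult_right_mono power_mono L2_integrable[OF L2_bounded_mult[OF m f], unfolded norm_mult power_mult_distrib]\<close>)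
  also have "\<dots> = K\<^sup>2 * (LINT x|sphere_measure. (cmod (f x))\<^sup>2)" by simp
  finally have "L2_norm sphere_measure (\<lambda>x. m x * f x) \<le> sqrt (K\<^sup>2 * (LINT x|sphere_measure. (cmod (f x))\<^sup>2))"
    unfolding L2_norm_def by (rule real_sqrt_le_mono)
  also have "\<dots> = K * L2_norm sphere_measure f" using K by (simp add: L2_norm_def real_sqrt_mult)
  finally show ?thesis .
qed

lemma norm_mult_hs_le: "bounded_mult m K \<Longrightarrow> norm (mult_hs m F) \<le> K * norm F"
  by (cases F rule: hs_cases) (simp add: mult_hs_abs_hs norm_abs_hs L2_bounded_mult L2_norm_mult_le)

lemma bounded_linear_mult_hs: "bounded_mult m K \<Longrightarrow> bounded_linear (mult_hs m)"
  by (rule bounded_linear_intro[of _ K]) (auto simp: mult_hs_add mult_hs_scaleR norm_mult_hs_le mult.commute)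

lemma inner_mult_hs:
  assumes m: "bounded_mult m K" and m': "bounded_mult (\<lambda>x. cnj (m x)) K'"
  shows "mult_hs m F \<bullet> G = F \<bullet> mult_hs (\<lambda>x. cnj (m x)) G"
proof (cases F rule: hs_cases; cases G rule: hs_cases)
  fix f g assume f: "f \<in> L2 sphere_measure" "F = abs_hs f" and g: "g \<in> L2 sphere_measure" "G = abs_hs g"
  have "(LINT x|sphere_measure. m x * f x * cnj (g x)) = (LINT x|sphere_measure. f x * cnj (cnj (m x) * g x))"
    by (simp add: mult_ac)
  then show "mult_hs m F \<bullet> G = F \<bullet> mult_hs (\<lambda>x. cnj (m x)) G"
    unfolding f(2) g(2) mult_hs_abs_hs[OF m f(1)] mult_hs_abs_hs[OF m' g(1)]
    by (simp only: inner_abs_hs L2_bounded_mult[OF m f(1)] L2_bounded_mult[OF m' g(1)] f(1) g(1))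
qed

abbreviation scaleC_hs :: "complex \<Rightarrow> 'a::euclidean_space hs \<Rightarrow> 'a hs" where
  "scaleC_hs c \<equiv> mult_hs (\<lambda>_. c)"

lemma scaleC_abs_hs: "f \<in> L2 sphere_measure \<Longrightarrow> scaleC_hs c (abs_hs f) = abs_hs (\<lambda>x. c * f x)"
  by (rule mult_hs_abs_hs[OF bounded_mult_const])

lemma norm_scaleC_hs: "norm (scaleC_hs c F) = cmod c * norm F"
  by (cases F rule: hs_cases)
     (simp add: scaleC_abs_hs norm_abs_hs L2_cmult L2_norm_def norm_mult power_mult_distrib real_sqrt_mult)

lemma scaleC_scaleC_hs: "scaleC_hs c (scaleC_hs d F) = scaleC_hs (c * d) F"
  by (cases F rule: hs_cases) (simp add: scaleC_abs_hs L2_cmult mult.assoc)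

lemma scaleC_of_real: "scaleC_hs (of_real r) F = r *\<^sub>R F"
  by (cases F rule: hs_cases) (simp add: scaleC_abs_hs abs_hs_scaleR)

lemma scaleC_1: "scaleC_hs 1 F = F"
  using scaleC_of_real[of 1 F] by simp

lemma scaleC_0: "scaleC_hs 0 F = 0"
  using scaleC_of_real[of 0 F] by simp

text \<open>Linearity that holds only almost everywhere for representatives becomes exact linearity
  on the quotient. It is used for the spectral projections and for the unitary group.\<close>

lemma hs_op_lincomb:
  assumes \<Phi>: "hs_respects \<Phi>"
    and lin: "\<And>f g a b. f \<in> L2 sphere_measure \<Longrightarrow> g \<in> L2 sphere_measure \<Longrightarrow>
        AE x in sphere_measure. \<Phi> (\<lambda>y. a * f y + b * g y) x = a * \<Phi> f x + b * \<Phi> g x"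
  shows "hs_op \<Phi> (scaleC_hs a F + scaleC_hs b G) = scaleC_hs a (hs_op \<Phi> F) + scaleC_hs b (hs_op \<Phi> G)"
proof (cases F rule: hs_cases; cases G rule: hs_cases)
  fix f g assume f: "f \<in> L2 sphere_measure" "F = abs_hs f" and g: "g \<in> L2 sphere_measure" "G = abs_hs g"
  have \<Phi>_L2: "\<Phi> h \<in> L2 sphere_measure" if "h \<in> L2 sphere_measure" for h
    using \<Phi> that by (simp add: hs_respects_def)
  have "abs_hs (\<Phi> (\<lambda>y. a * f y + b * g y)) = abs_hs (\<lambda>x. a * \<Phi> f x + b * \<Phi> g x)"
    using lin[OF f(1) g(1)] by (subst abs_hs_eq_iff) (auto intro!: \<Phi>_L2 L2_add L2_cmult f g)
  then show ?thesis
    by (simp add: f g scaleC_abs_hs abs_hs_add[symmetric] L2_cmult L2_add hs_op_abs_hs[OF \<Phi>] \<Phi>_L2)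
qed

definition compose_hs :: "('a::euclidean_space \<Rightarrow> 'a) \<Rightarrow> 'a hs \<Rightarrow> 'a hs" where
  "compose_hs T = hs_op (\<lambda>f x. f (T x))"

lemma L2_compose:
  assumes T: "orthogonal_transformation (T :: 'a::euclidean_space \<Rightarrow> 'a)" and f: "f \<in> L2 sphere_measure"
  shows "(\<lambda>x. f (T x)) \<in> L2 sphere_measure"
proof -
  have m: "T \<in> sphere_measure \<rightarrow>\<^sub>M sphere_measure" by (rule orthogonal_transformation_measurable_sphere[OF T])
  have "integrable (distr sphere_measure sphere_measure T) (\<lambda>x. (cmod (f x))\<^sup>2)"
    by (simp add: sphere_measure_distr_orthogonal_transformation[OF T] L2_integrable[OF f])
  then have "integrable sphere_measure (\<lambda>x. (cmod (f (T x)))\<^sup>2)" by (rule integrable_distr[OF m])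
  then show ?thesis using measurable_compose[OF m L2_measurable[OF f]] by (simp add: L2_def)
qed

lemma compose_abs_hs:
  assumes T: "orthogonal_transformation (T :: 'a::euclidean_space \<Rightarrow> 'a)" and f: "f \<in> L2 sphere_measure"
  shows "compose_hs T (abs_hs f) = abs_hs (\<lambda>x. f (T x))"
  unfolding compose_hs_def
proof (rule hs_op_abs_hs[OF _ f])
  have m: "T \<in> sphere_measure \<rightarrow>\<^sub>M sphere_measure" by (rule orthogonal_transformation_measurable_sphere[OF T])
  have "AE x in sphere_measure. f (T x) = g (T x)"
    if "f \<in> L2 sphere_measure" "g \<in> L2 sphere_measure" "AE x in sphere_measure. f x = g x" for f g
  proof -
    have "AE x in distr sphere_measure sphere_measure T. f x = g x"
      unfolding sphere_measure_distr_orthogonal_transformation[OF T] by (rule that(3))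
    moreover have [measurable]: "f \<in> borel_measurable sphere_measure" "g \<in> borel_measurable sphere_measure"
      using that by (auto simp: L2_measurable)
    have "{x \<in> space sphere_measure. f x = g x} \<in> sets sphere_measure" by measurable
    ultimately show ?thesis by (simp only: AE_distr_iff[OF m])
  qed
  then show "hs_respects (\<lambda>f x. f (T x))"
    by (auto simp: hs_respects_def intro: L2_compose[OF T])
qed

lemma compose_hs_add:
  "orthogonal_transformation (T :: 'a::euclidean_space \<Rightarrow> 'a) \<Longrightarrow> compose_hs T (F + G) = compose_hs T F + compose_hs T G"
  by (cases F rule: hs_cases; cases G rule: hs_cases)
     (simp add: compose_abs_hs abs_hs_add[symmetric] L2_add L2_compose)

lemma compose_hs_scaleC:
  "orthogonal_transformation (T :: 'a::euclidean_space \<Rightarrow> 'a) \<Longrightarrow> compose_hs T (scaleC_hs c F) = scaleC_hs c (compose_hs T F)"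
  by (cases F rule: hs_cases) (simp add: compose_abs_hs scaleC_abs_hs L2_cmult L2_compose)

lemma inner_compose_hs:
  assumes T: "orthogonal_transformation (T :: 'a::euclidean_space \<Rightarrow> 'a)"
  shows "compose_hs T F \<bullet> compose_hs T G = F \<bullet> G"
proof (cases F rule: hs_cases; cases G rule: hs_cases)
  fix f g assume f: "f \<in> L2 sphere_measure" "F = abs_hs f" and g: "g \<in> L2 sphere_measure" "G = abs_hs g"
  have m: "T \<in> sphere_measure \<rightarrow>\<^sub>M sphere_measure" by (rule orthogonal_transformation_measurable_sphere[OF T])
  have "(LINT x|sphere_measure. f x * cnj (g x)) = (LINT x|distr sphere_measure sphere_measure T. f x * cnj (g x))"
    by (simp add: sphere_measure_distr_orthogonal_transformation[OF T])
  also have "\<dots> = (LINT x|sphere_measure. f (T x) * cnj (g (T x)))"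
    by (rule integral_distr[OF m]) (rule borel_measurable_integrable[OF L2_integrable_mult_cnj[OF f(1) g(1)]])
  finally show ?thesis using f g by (simp add: compose_abs_hs[OF T] inner_abs_hs L2_compose[OF T])
qed

lemma norm_compose_hs:
  "orthogonal_transformation (T :: 'a::euclidean_space \<Rightarrow> 'a) \<Longrightarrow> norm (compose_hs T F) = norm F"
  by (simp add: norm_eq_sqrt_inner inner_compose_hs)

lemma bounded_linear_compose_hs:
  assumes "orthogonal_transformation (T :: 'a::euclidean_space \<Rightarrow> 'a)" shows "bounded_linear (compose_hs T)"
  by (rule bounded_linear_intro[of _ 1])
     (use assms compose_hs_scaleC[OF assms, of "of_real r" for r] in
       \<open>auto simp: compose_hs_add norm_compose_hs scaleC_of_real\<close>)

section \<open>Polynomials on the sphere\<close>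

text \<open>Complex linear forms with arbitrary complex coefficients: \<open>b = 0\<close> gives the
  coordinates, and an orthonormal pair gives the form whose powers are the equatorial harmonics. One
  generator thus covers both.\<close>

definition lform :: "'a::euclidean_space \<Rightarrow> 'a \<Rightarrow> 'a \<Rightarrow> complex" where
  "lform a b x = Complex (a \<bullet> x) (b \<bullet> x)"

text \<open>The degree is an index because the eigenvalue produced by the Laplacian depends on it.
  The zero function belongs to every degree.\<close>

inductive hpoly :: "nat \<Rightarrow> ('a::euclidean_space \<Rightarrow> complex) \<Rightarrow> bool" where
  hpoly_const: "hpoly 0 (\<lambda>x. c)"
| hpoly_lform_mult: "hpoly k f \<Longrightarrow> hpoly (Suc k) (\<lambda>x. lform a b x * f x)"
| hpoly_add: "hpoly k f \<Longrightarrow> hpoly k g \<Longrightarrow> hpoly k (\<lambda>x. f x + g x)"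

inductive spoly :: "('a::euclidean_space \<Rightarrow> complex) \<Rightarrow> bool" where
  spoly_hpoly: "hpoly k f \<Longrightarrow> spoly f"
| spoly_add: "spoly f \<Longrightarrow> spoly g \<Longrightarrow> spoly (\<lambda>x. f x + g x)"

lemma bounded_linear_lform: "bounded_linear (lform a b)"
proof -
  have "lform a b = (\<lambda>x. of_real (a \<bullet> x) + \<i> * of_real (b \<bullet> x))"
    by (auto simp: fun_eq_iff lform_def complex_eq_iff)
  moreover have "bounded_linear (\<lambda>x. of_real (a \<bullet> x) + \<i> * of_real (b \<bullet> x) :: complex)"
    by (intro bounded_linear_add bounded_linear_const_mult
        bounded_linear_compose[OF bounded_linear_of_real] bounded_linear_inner_right)
  ultimately show ?thesis by simp
qed

lemma lform_of_real: "lform a 0 x = of_real (a \<bullet> x)"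
  by (simp add: lform_def complex_eq_iff)

lemma hpoly_cmult: "hpoly k f \<Longrightarrow> hpoly k (\<lambda>x. c * f x)"
proof (induction rule: hpoly.induct)
  case (hpoly_lform_mult k f a b)
  then show ?case using hpoly.hpoly_lform_mult[of k "\<lambda>x. c * f x" a b] by (simp add: mult.left_commute)
qed (auto intro: hpoly.intros simp: distrib_left)

lemma hpoly_zero: "hpoly k (\<lambda>x. 0)"
proof (induction k)
  case (Suc k)
  then show ?case using hpoly_lform_mult[of k "\<lambda>x. 0" 0 0] by simp
qed (rule hpoly_const)

lemma hpoly_mult: "hpoly j f \<Longrightarrow> hpoly k g \<Longrightarrow> hpoly (j + k) (\<lambda>x. f x * g x)"
proof (induction rule: hpoly.induct)
  case (hpoly_const c)
  then show ?case by (simp add: hpoly_cmult)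
next
  case (hpoly_lform_mult j f a b)
  then show ?case using hpoly.hpoly_lform_mult[of "j + k" "\<lambda>x. f x * g x" a b] by (simp add: mult.assoc)
next
  case (hpoly_add j f h)
  then show ?case using hpoly.hpoly_add[of "j + k" "\<lambda>x. f x * g x" "\<lambda>x. h x * g x"] by (simp add: distrib_right)
qed

lemma spoly_const: "spoly (\<lambda>x. c)"
  by (rule spoly_hpoly[OF hpoly_const])

lemma hpoly_lform: "hpoly 1 (lform a b)"
  using hpoly_lform_mult[OF hpoly_const[of 1], of a b] by (simp add: eta_contract_eq)

lemma spoly_lform: "spoly (\<lambda>x. lform a b x)"
  by (rule spoly_hpoly[OF hpoly_lform])

lemma spoly_mult_hpoly: "spoly g \<Longrightarrow> hpoly j f \<Longrightarrow> spoly (\<lambda>x. f x * g x)"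
proof (induction rule: spoly.induct)
  case (spoly_hpoly k g)
  then show ?case by (intro spoly.spoly_hpoly[OF hpoly_mult])
next
  case (spoly_add g h)
  then show ?case using spoly.spoly_add[of "\<lambda>x. f x * g x" "\<lambda>x. f x * h x"] by (simp add: distrib_left)
qed

lemma spoly_mult: "spoly f \<Longrightarrow> spoly g \<Longrightarrow> spoly (\<lambda>x. f x * g x)"
proof (induction rule: spoly.induct)
  case (spoly_hpoly k f)
  then show ?case by (intro spoly_mult_hpoly)
next
  case (spoly_add f h)
  then show ?case using spoly.spoly_add[of "\<lambda>x. f x * g x" "\<lambda>x. h x * g x"] by (simp add: distrib_right)
qed

lemma spoly_diff: "spoly f \<Longrightarrow> spoly g \<Longrightarrow> spoly (\<lambda>x. f x - g x)"
  using spoly_add[of f "\<lambda>x. (-1) * g x"] spoly_mult[OF spoly_const[of "-1"], of g] by simp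

lemma spoly_inner: "spoly (\<lambda>x. of_real (x \<bullet> a))"
  using spoly_lform[of a 0] by (simp add: lform_of_real inner_commute)

lemma spoly_sum: "(\<And>i. i \<in> I \<Longrightarrow> spoly (f i)) \<Longrightarrow> spoly (\<lambda>x. \<Sum>i\<in>I. f i x)"
  by (induction I rule: infinite_finite_induct) (auto intro: spoly_const spoly_add)

lemma hpoly_lform_power: "hpoly n (\<lambda>x. lform a b x ^ n)"
  by (induction n) (auto intro: hpoly.intros)

lemma spoly_lform_power: "spoly (\<lambda>x. lform a b x ^ n)"
  by (rule spoly_hpoly[OF hpoly_lform_power])

text \<open>Links the library polynomials, for which Stone-Weierstrass is available, to sums of
  homogeneous ones.\<close>

lemma real_polynomial_function_spoly:
  "real_polynomial_function f \<Longrightarrow> spoly (\<lambda>x. of_real (f x) :: complex)"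
proof (induction rule: real_polynomial_function.induct)
  case (linear f)
  define a where "a = (\<Sum>b\<in>Basis. f b *\<^sub>R b)"
  have "f x = x \<bullet> a" for x
  proof -
    have "f x = f (\<Sum>b\<in>Basis. (x \<bullet> b) *\<^sub>R b)" by (simp add: euclidean_representation)
    also have "\<dots> = (\<Sum>b\<in>Basis. (x \<bullet> b) * f b)"
      using linear by (simp add: bounded_linear.linear linear_sum linear_cmul)
    finally show ?thesis by (simp add: a_def inner_sum_right mult.commute)
  qed
  then show ?case by (simp only: spoly_inner)
qed (auto intro: spoly_const spoly_add spoly_mult)

lemma polynomial_function_spoly:
  assumes "polynomial_function (f :: 'a::euclidean_space \<Rightarrow> complex)"
  shows "spoly f"
proof -
  have "real_polynomial_function (\<lambda>x. Re (f x))" "real_polynomial_function (\<lambda>x. Im (f x))"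
    using assms bounded_linear_Re bounded_linear_Im by (auto simp: polynomial_function_def o_def)
  then have "spoly (\<lambda>x. of_real (Re (f x)) + \<i> * of_real (Im (f x)))"
    by (intro spoly_add spoly_mult spoly_const real_polynomial_function_spoly)
  then show ?thesis by (simp flip: complex_eq)
qed

lemma spoly_differentiable:
  assumes "spoly f" shows "f differentiable (at x)"
proof -
  have "f differentiable (at x)" if "hpoly k f" for k and f :: "'a \<Rightarrow> complex"
    using that by induction
      (auto intro!: differentiable_mult differentiable_add bounded_linear_imp_differentiable[OF bounded_linear_lform])
  with assms show ?thesis by induction (auto intro: differentiable_add)
qed

lemma spoly_continuous: "spoly f \<Longrightarrow> continuous_on S f"
  by (auto intro!: continuous_at_imp_continuous_on differentiable_imp_continuous_within spoly_differentiable)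

lemma L2_continuous:
  assumes "continuous_on (sphere 0 1) f"
  shows "f \<in> L2 (sphere_measure :: 'a::euclidean_space measure)"
proof -
  have "f \<in> borel_measurable (restrict_space borel (sphere 0 1))"
    by (rule borel_measurable_continuous_on_restrict[OF assms])
  then have m [measurable]: "f \<in> borel_measurable sphere_measure"
    by (simp cong: measurable_cong_sets add: sets_sphere_measure)
  have "bounded (f ` sphere 0 1)"
    by (rule compact_imp_bounded[OF compact_continuous_image[OF assms]]) simp
  then obtain B where B: "\<And>x. norm x = 1 \<Longrightarrow> cmod (f x) \<le> B" by (force simp: bounded_iff)
  have "integrable sphere_measure (\<lambda>x. (cmod (f x))\<^sup>2)"
    by (rule sphere_measure.integrable_const_bound[of _ "B\<^sup>2"]) (auto intro!: AE_I2 power_mono B)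
  with m show ?thesis by (simp add: L2_def)
qed

lemma L2_spoly: "spoly f \<Longrightarrow> f \<in> L2 sphere_measure"
  by (rule L2_continuous[OF spoly_continuous])

lemma L2_norm_le_AE:
  assumes f: "f \<in> L2 sphere_measure" and g: "integrable sphere_measure (g :: 'a::euclidean_space \<Rightarrow> real)"
    and le: "\<And>x. norm x = 1 \<Longrightarrow> (cmod (f x))\<^sup>2 \<le> g x"
  shows "norm (abs_hs f) \<le> sqrt (LINT x|sphere_measure. g x)"
  unfolding norm_abs_hs[OF f] L2_norm_def
  by (rule real_sqrt_le_mono, rule integral_mono[OF L2_integrable[OF f] g]) (use le in auto)

section \<open>Density of the polynomials\<close>

definition poly_closure :: "'a::euclidean_space hs set" where
  "poly_closure = closure {abs_hs p | p. spoly p}"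

lemma poly_closureD:
  assumes "F \<in> poly_closure" "0 < e"
  obtains p where "spoly p" "norm (F - abs_hs p) < e"
  using assms unfolding poly_closure_def closure_approachable by (auto simp: dist_norm norm_minus_commute)

lemma poly_closureI:
  assumes "\<And>e. 0 < e \<Longrightarrow> \<exists>G\<in>poly_closure. norm (F - G) < e"
  shows "F \<in> poly_closure"
proof -
  have "F \<in> closure poly_closure"
    using assms by (simp add: closure_approachable dist_norm norm_minus_commute)
  then show ?thesis by (simp add: poly_closure_def)
qed

lemma poly_closure_spoly: "spoly p \<Longrightarrow> abs_hs p \<in> poly_closure"
  unfolding poly_closure_def by (intro closure_subset[THEN subsetD]) auto

lemma poly_closure_add:
  assumes "F \<in> poly_closure" "G \<in> poly_closure" shows "F + G \<in> poly_closure"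
proof (rule poly_closureI)
  fix e :: real assume "0 < e"
  then have e2: "0 < e / 2" by simp
  obtain p where p: "spoly p" "norm (F - abs_hs p) < e/2" using poly_closureD[OF assms(1) e2] .
  obtain q where q: "spoly q" "norm (G - abs_hs q) < e/2" using poly_closureD[OF assms(2) e2] .
  have "norm (F + G - abs_hs (\<lambda>x. p x + q x)) = norm ((F - abs_hs p) + (G - abs_hs q))"
    by (simp add: abs_hs_add L2_spoly p q algebra_simps)
  also have "\<dots> < e" using norm_triangle_ineq[of "F - abs_hs p" "G - abs_hs q"] p q by linarith
  finally show "\<exists>G'\<in>poly_closure. norm (F + G - G') < e"
    using poly_closure_spoly[OF spoly_add[OF p(1) q(1)]] by blast
qed

lemma poly_closure_scaleC:
  assumes "F \<in> poly_closure" shows "scaleC_hs c F \<in> poly_closure"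
proof (rule poly_closureI)
  fix e :: real assume "0 < e"
  then have "0 < e / (cmod c + 1)" by (intro divide_pos_pos) (auto intro: add_nonneg_pos)
  then obtain p where p: "spoly p" "norm (F - abs_hs p) < e / (cmod c + 1)"
    using poly_closureD[OF assms] by blast
  have "norm (scaleC_hs c F - abs_hs (\<lambda>x. c * p x)) = norm (scaleC_hs c (F - abs_hs p))"
    by (simp add: scaleC_abs_hs[symmetric] L2_spoly p bounded_linear.linear linear_diff
        bounded_linear_mult_hs[OF bounded_mult_const])
  also have "\<dots> = cmod c * norm (F - abs_hs p)" by (rule norm_scaleC_hs)
  also have "\<dots> \<le> (cmod c + 1) * norm (F - abs_hs p)" by (intro mult_right_mono) auto
  also have "\<dots> < e" using p(2) by (simp add: pos_less_divide_eq add_nonneg_pos mult.commute)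
  finally show "\<exists>G'\<in>poly_closure. norm (scaleC_hs c F - G') < e"
    using poly_closure_spoly[OF spoly_mult[OF spoly_const p(1)]] by blast
qed

lemma poly_closure_sum: "(\<And>i. i \<in> I \<Longrightarrow> F i \<in> poly_closure) \<Longrightarrow> (\<Sum>i\<in>I. F i) \<in> poly_closure"
  using poly_closure_spoly[OF spoly_const[of 0]]
  by (induction I rule: infinite_finite_induct) (auto intro: poly_closure_add simp: abs_hs_zero)

lemma poly_closure_continuous:
  fixes f :: "'a::euclidean_space \<Rightarrow> complex"
  assumes f: "continuous_on (sphere 0 1) f"
  shows "abs_hs f \<in> poly_closure"
proof (rule poly_closureI)
  fix e :: real assume e: "0 < e"
  let ?m = "measure (sphere_measure::'a measure) (sphere 0 1)"
  \<comment> \<open>A uniform error \<open>d\<close> costs at most \<open>d * sqrt ?m\<close> in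
    norm; the added 1 makes the bound strict and the quotient well defined.\<close>
  define d where "d = e / (sqrt ?m + 1)"
  have d: "d > 0" using e by (simp add: d_def add_nonneg_pos)
  obtain g where g: "polynomial_function g" "\<And>x. x \<in> sphere 0 1 \<Longrightarrow> norm (f x - g x) < d"
    using Stone_Weierstrass_polynomial_function[OF compact_sphere f d] by blast
  have sg: "spoly g" by (rule polynomial_function_spoly[OF g(1)])
  have "norm (abs_hs (\<lambda>x. f x - g x)) \<le> sqrt (LINT x|(sphere_measure :: 'a measure). d\<^sup>2)"
  proof (rule L2_norm_le_AE)
    show "(\<lambda>x. f x - g x) \<in> L2 sphere_measure" by (rule L2_diff[OF L2_continuous[OF f] L2_spoly[OF sg]])
    show "(cmod (f x - g x))\<^sup>2 \<le> d\<^sup>2" if "norm x = 1" for x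
      using g(2)[of x] that by (intro power_mono) auto
  qed simp
  also have "\<dots> = d * sqrt ?m" using d by (simp add: real_sqrt_mult)
  also have "\<dots> < d * (sqrt ?m + 1)" using d by simp
  also have "\<dots> = e" by (simp add: d_def add_nonneg_pos[THEN less_imp_neq, symmetric])
  finally have "norm (abs_hs f - abs_hs g) < e"
    by (simp add: abs_hs_diff L2_continuous f L2_spoly sg)
  then show "\<exists>G\<in>poly_closure. norm (abs_hs f - G) < e" using poly_closure_spoly[OF sg] by blast
qed

lemma L2_indicator:
  assumes "B \<in> sets sphere_measure" shows "(\<lambda>x. indicator B x) \<in> L2 (sphere_measure :: 'a::euclidean_space measure)"
proof -
  have "(cmod (indicator B x))\<^sup>2 = indicator B x" for x :: 'a by (simp add: indicator_def)
  moreover have "B \<inter> sphere 0 1 = B" using sets.sets_into_space[OF assms] by auto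
  ultimately show ?thesis using assms
    by (simp add: L2_def sphere_measure.emeasure_eq_measure integrable_indicator_iff)
qed

text \<open>By regularity, \<open>B\<close> lies between a compact \<open>K\<close> and an open
  \<open>U\<close> with \<open>U - K\<close> small. A Urysohn function that is 1 on \<open>K\<close>
  and 0 off \<open>U\<close> is continuous and differs from the indicator only on
  \<open>U - K\<close>, by at most 1.\<close>

lemma poly_closure_indicator:
  fixes B :: "'a::euclidean_space set"
  assumes B: "B \<in> sets sphere_measure"
  shows "abs_hs (\<lambda>x. indicator B x) \<in> poly_closure"
proof (rule poly_closureI)
  fix e :: real assume e: "0 < e"
  \<comment> \<open>The regularity theorems concern Borel measures on the whole space, so the sphere
    measure is pushed forward along the inclusion.\<close>
  let ?M = "distr (sphere_measure :: 'a measure) borel (\<lambda>x. x)"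
  have idm: "(\<lambda>x. x) \<in> (sphere_measure :: 'a measure) \<rightarrow>\<^sub>M borel"
    by (simp cong: measurable_cong_sets add: sets_sphere_measure measurable_restrict_space1)
  interpret M: finite_measure ?M by (rule sphere_measure.finite_measure_distr[OF idm])
  have Bb: "B \<in> sets borel" "B \<subseteq> sphere 0 1"
    using B by (auto simp: sets_sphere_measure sets_restrict_space_iff)
  have fin: "emeasure ?M (space ?M) \<noteq> \<infinity>" using M.emeasure_finite by simp
  have MB: "emeasure ?M B < top" using M.emeasure_finite[of B] by (simp add: less_top[symmetric])
  \<comment> \<open>The inner and the outer approximation each lose a third of
    \<open>e\<^sup>2\<close>, and the norm is the square root of the total.\<close>
  let ?e = "ennreal (e\<^sup>2 / 3)"
  have e3: "0 < e\<^sup>2 / 3" using e by simp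
  have MB': "emeasure ?M B \<noteq> \<infinity>" using MB by simp
  have "{K. K \<subseteq> B \<and> compact K} \<noteq> {}" using compact_empty by blast
  from SUP_approx_ennreal[OF e3 this inner_regular[OF sets_distr fin Bb(1)] MB']
  obtain K where K: "K \<subseteq> B" "compact K" "emeasure ?M B < emeasure ?M K + ?e" by blast
  from INF_approx_ennreal[OF e3 outer_regular[OF sets_distr fin Bb(1)] MB']
  obtain U where U: "B \<subseteq> U" "open U" "emeasure ?M U < emeasure ?M B + ?e" by blast
  obtain h :: "'a \<Rightarrow> real" where h: "continuous_on UNIV h" "\<And>x. h x \<in> closed_segment 1 0"
    "\<And>x. x \<in> K \<Longrightarrow> h x = 1" "\<And>x. x \<in> - U \<Longrightarrow> h x = 0"
    using Urysohn[of K "- U" 1 "0::real"] K U by (auto simp: compact_imp_closed)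
  have h01: "0 \<le> h x" "h x \<le> 1" for x using h(2)[of x] by (auto simp: closed_segment_eq_real_ivl)
  have hL: "(\<lambda>x. of_real (h x) :: complex) \<in> L2 sphere_measure"
    by (intro L2_continuous continuous_intros continuous_on_subset[OF h(1)]) auto
  have iL: "(\<lambda>x. indicator B x :: complex) \<in> L2 sphere_measure" by (rule L2_indicator[OF B])
  have UK: "U - K \<in> sets borel" using U K by (auto intro: borel_compact)
  have UKs: "(U - K) \<inter> sphere 0 1 \<in> sets sphere_measure"
    using UK by (auto simp: sets_sphere_measure sets_restrict_space_iff)
  have "norm (abs_hs (\<lambda>x. indicator B x - of_real (h x))) \<le> sqrt (LINT x|sphere_measure. indicator ((U - K) \<inter> sphere 0 1) x)"
  proof (rule L2_norm_le_AE)
    fix x :: 'a assume "norm x = 1"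
    then show "(cmod (indicator B x - of_real (h x)))\<^sup>2 \<le> indicator ((U - K) \<inter> sphere 0 1) x"
      using h01[of x] h(3)[of x] h(4)[of x] K(1) U(1)
      by (auto simp: indicator_def cmod_def power_le_one)
  next
    show "(\<lambda>x. indicator B x - of_real (h x)) \<in> L2 sphere_measure" by (rule L2_diff[OF iL hL])
    show "integrable sphere_measure (\<lambda>x. indicator ((U - K) \<inter> sphere 0 1) x :: real)"
      using UKs by (simp add: sphere_measure.emeasure_eq_measure integrable_indicator_iff Int_assoc)
  qed
  also have "(LINT x|sphere_measure. indicator ((U - K) \<inter> sphere 0 1) x :: real) = measure sphere_measure ((U - K) \<inter> sphere 0 1)"
    using UKs by (simp add: Int_assoc)
  also have "\<dots> = measure ?M (U - K)" using UK by (simp add: measure_distr[OF idm])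
  also have "\<dots> = measure ?M U - measure ?M K"
    by (rule M.finite_measure_Diff) (use U K in \<open>auto intro: borel_compact\<close>)
  also have "sqrt \<dots> < e"
  proof -
    have "measure ?M B < measure ?M K + e\<^sup>2 / 3"
      using K(3) by (simp add: M.emeasure_eq_measure ennreal_less_iff flip: ennreal_plus)
    moreover have "measure ?M U < measure ?M B + e\<^sup>2 / 3"
      using U(3) by (simp add: M.emeasure_eq_measure ennreal_less_iff flip: ennreal_plus)
    moreover have "e\<^sup>2 > 0" using e by simp
    ultimately have "measure ?M U - measure ?M K < e\<^sup>2" by linarith
    then have "sqrt (measure ?M U - measure ?M K) < sqrt (e\<^sup>2)" by (rule real_sqrt_less_mono)
    then show ?thesis using e by simp
  qed
  finally have "norm (abs_hs (\<lambda>x. indicator B x) - abs_hs (\<lambda>x. of_real (h x))) < e"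
    using iL hL by (simp add: abs_hs_diff)
  moreover have "abs_hs (\<lambda>x. of_real (h x)) \<in> poly_closure"
    by (intro poly_closure_continuous continuous_intros continuous_on_subset[OF h(1)]) auto
  ultimately show "\<exists>G\<in>poly_closure. norm (abs_hs (\<lambda>x. indicator B x) - G) < e" by blast
qed

lemma poly_closure_UNIV: "F \<in> poly_closure"
proof (cases F rule: hs_cases)
  fix f assume f: "f \<in> L2 sphere_measure" "F = abs_hs f"
  have fm: "f \<in> borel_measurable sphere_measure" by (rule L2_measurable[OF f(1)])
  obtain s where s: "\<And>i. simple_function sphere_measure (s i)"
    "\<And>x. x \<in> space sphere_measure \<Longrightarrow> (\<lambda>i. s i x) \<longlonglongrightarrow> f x"
    "\<And>i x. x \<in> space sphere_measure \<Longrightarrow> dist (s i x) 0 \<le> 2 * dist (f x) 0"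
    using borel_measurable_implies_sequence_metric[OF fm, of 0] by metis
  have sm [measurable]: "s i \<in> borel_measurable sphere_measure" for i
    using s(1) by (rule borel_measurable_simple_function)
  have sL: "s i \<in> L2 sphere_measure" for i
  proof -
    have "integrable sphere_measure (\<lambda>x. (cmod (s i x))\<^sup>2)"
    proof (rule Bochner_Integration.integrable_bound)
      show "integrable sphere_measure (\<lambda>x. 4 * (cmod (f x))\<^sup>2)" by (simp add: L2_integrable f)
      show "AE x in sphere_measure. norm ((cmod (s i x))\<^sup>2) \<le> norm (4 * (cmod (f x))\<^sup>2)"
      proof (rule AE_I2)
        fix x :: 'a assume "x \<in> space sphere_measure"
        then have "(cmod (s i x))\<^sup>2 \<le> (2 * cmod (f x))\<^sup>2" using s(3)[of x i] by (intro power_mono) auto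
        then show "norm ((cmod (s i x))\<^sup>2) \<le> norm (4 * (cmod (f x))\<^sup>2)" by (simp add: power_mult_distrib)
      qed
    qed simp
    then show ?thesis by (simp add: L2_def)
  qed
  have sP: "abs_hs (s i) \<in> poly_closure" for i
  proof -
    let ?A = "\<lambda>y. s i -` {y} \<inter> space sphere_measure"
    have A: "?A y \<in> sets sphere_measure" for y by (rule simple_functionD(2)[OF s(1)])
    have iL: "(\<lambda>x. indicator (?A y) x :: complex) \<in> L2 sphere_measure" for y by (rule L2_indicator[OF A])
    have fin: "finite (s i ` space sphere_measure)" using s(1)[of i] by (simp add: simple_function_def)
    have "abs_hs (s i) = abs_hs (\<lambda>x. \<Sum>y\<in>s i ` space sphere_measure. y * indicator (?A y) x)"
    proof (rule abs_hs_cong)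
      fix x :: 'a assume x: "norm x = 1"
      have "(\<Sum>y\<in>s i ` space sphere_measure. y * indicator (?A y) x) = (\<Sum>y\<in>{s i x}. y * indicator (?A y) x)"
        by (rule sum.mono_neutral_right[OF fin]) (use x in auto)
      then show "s i x = (\<Sum>y\<in>s i ` space sphere_measure. y * indicator (?A y) x)" using x by simp
    qed (rule sL, intro L2_sum L2_cmult iL)
    also have "\<dots> = (\<Sum>y\<in>s i ` space sphere_measure. scaleC_hs y (abs_hs (\<lambda>x. indicator (?A y) x)))"
      unfolding scaleC_abs_hs[OF iL] by (rule abs_hs_sum) (rule L2_cmult[OF iL])
    also have "\<dots> \<in> poly_closure"
      by (intro poly_closure_sum poly_closure_scaleC poly_closure_indicator A)
    finally show ?thesis .
  qed
  have lim: "(\<lambda>i. abs_hs (s i)) \<longlonglongrightarrow> F"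
    unfolding f(2)
  proof (rule abs_hs_tendsto_dominated[OF f(1) sL])
    \<comment> \<open>The approximants satisfy \<open>cmod (s i x) \<le> 2 * cmod (f x)\<close>, so
      the difference is at most three times \<open>cmod (f x)\<close>; 9 is the square.\<close>
    show "integrable sphere_measure (\<lambda>x. 9 * (cmod (f x))\<^sup>2)" by (simp add: L2_integrable f)
    fix x :: 'a assume x: "norm x = 1"
    show "(\<lambda>i. s i x) \<longlonglongrightarrow> f x" using x by (intro s(2)) simp
    show "(cmod (s i x - f x))\<^sup>2 \<le> 9 * (cmod (f x))\<^sup>2" for i
    proof -
      have "cmod (s i x - f x) \<le> 3 * cmod (f x)"
        using x s(3)[of x i] norm_triangle_ineq4[of "s i x" "f x"] by simp
      then have "(cmod (s i x - f x))\<^sup>2 \<le> (3 * cmod (f x))\<^sup>2" by (intro power_mono) auto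
      then show ?thesis by (simp add: power_mult_distrib)
    qed
  qed
  show ?thesis
  proof (rule poly_closureI)
    fix e :: real assume "0 < e"
    with lim have "eventually (\<lambda>i. dist (abs_hs (s i)) F < e) sequentially" by (rule tendstoD)
    then have "eventually (\<lambda>i. norm (F - abs_hs (s i)) < e) sequentially"
      by (simp add: dist_norm norm_minus_commute)
    then show "\<exists>G\<in>poly_closure. norm (F - G) < e" using sP by (auto simp: eventually_sequentially)
  qed
qed

lemma hs_eqI_spoly:
  assumes "\<And>p. spoly p \<Longrightarrow> abs_hs p \<bullet> F = abs_hs p \<bullet> G"
  shows "F = G"
proof -
  have *: "abs_hs p \<bullet> (F - G) = 0" if "spoly p" for p using assms[OF that] by (simp add: inner_diff_right)
  have "norm (F - G) \<le> 0 + e" if "0 < e" for e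
  proof -
    obtain p where p: "spoly p" "norm ((F - G) - abs_hs p) < e" using poly_closureD[OF poly_closure_UNIV \<open>0 < e\<close>] .
    have "norm (F - G) * norm (F - G) = ((F - G) - abs_hs p) \<bullet> (F - G)"
      using *[OF p(1)] by (simp add: inner_diff_left[of "F - G"] power2_norm_eq_inner[symmetric] power2_eq_square)
    also have "\<dots> \<le> norm ((F - G) - abs_hs p) * norm (F - G)" by (rule norm_cauchy_schwarz)
    finally have "norm (F - G) \<le> norm ((F - G) - abs_hs p)"
      by (cases "norm (F - G) = 0") (auto simp: mult_le_cancel_right)
    with p show ?thesis by simp
  qed
  then have "norm (F - G) \<le> 0" by (rule field_le_epsilon)
  then show ?thesis by simp
qed

text \<open>Passes from weak estimates to a norm estimate. Only polynomials serve as test functions,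
  since the rotation generators have to be applied to them.\<close>

lemma norm_le_spoly:
  assumes "\<And>p. spoly p \<Longrightarrow> F \<bullet> abs_hs p \<le> K * norm (abs_hs p)"
  shows "norm F \<le> K"
proof -
  have K: "0 \<le> K"
  proof -
    \<comment> \<open>The sign of \<open>K\<close> is not assumed; adding the estimates for the test
      functions 1 and -1 gives it, because the constant 1 has positive norm.\<close>
    have "(F \<bullet> abs_hs (\<lambda>x. 1)) \<le> K * norm (abs_hs (\<lambda>x. 1) :: 'a hs)"
      "(F \<bullet> abs_hs (\<lambda>x. -1)) \<le> K * norm (abs_hs (\<lambda>x. -1) :: 'a hs)"
      by (auto intro!: assms spoly_const)
    moreover have "abs_hs (\<lambda>x. -1) = - (abs_hs (\<lambda>x. 1) :: 'a hs)"
      by (simp add: abs_hs_uminus[symmetric] L2_spoly spoly_const)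
    ultimately have 1: "0 \<le> K * norm (abs_hs (\<lambda>x. 1) :: 'a hs)" by simp
    obtain z :: 'a where z: "norm z = 1" using vector_choose_size[of 1] by auto
    have "emeasure (sphere_measure :: 'a measure) (UNIV \<inter> sphere 0 1) > 0"
      by (rule emeasure_sphere_measure_open_pos[OF open_UNIV UNIV_I z])
    then have "measure (sphere_measure :: 'a measure) (sphere 0 1) > 0"
      by (simp add: sphere_measure.emeasure_eq_measure)
    then have "norm (abs_hs (\<lambda>x. 1) :: 'a hs) > 0"
      by (simp add: norm_abs_hs L2_spoly spoly_const L2_norm_def)
    with 1 show ?thesis by (simp add: zero_le_mult_iff)
  qed
  have "norm F \<le> K + e" if e: "0 < e" for e
  proof (rule ccontr)
    assume n: "\<not> norm F \<le> K + e"
    \<comment> \<open>Replacing \<open>F\<close> by a polynomial within \<open>d\<close> costs at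
      most \<open>(K + norm F) * d\<close>, which this choice keeps below
      \<open>e * norm F\<close>.\<close>
    define d where "d = e * norm F / (norm F + K + 1)"
    have F: "norm F > 0" using n K e by linarith
    then have "d > 0" unfolding d_def using e K by (intro divide_pos_pos mult_pos_pos) linarith+
    then obtain p where p: "spoly p" "norm (F - abs_hs p) < d" using poly_closureD[OF poly_closure_UNIV] by blast
    have "norm F * norm F = F \<bullet> abs_hs p + F \<bullet> (F - abs_hs p)"
      by (simp add: inner_diff_right power2_norm_eq_inner[symmetric] power2_eq_square)
    moreover have "F \<bullet> abs_hs p \<le> K * norm (abs_hs p)" by (rule assms[OF p(1)])
    moreover have "norm (abs_hs p) \<le> norm F + d"
      using p(2) norm_triangle_ineq4[of F "F - abs_hs p"] by simp
    then have "K * norm (abs_hs p) \<le> K * (norm F + d)" using K by (rule mult_left_mono)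
    moreover have "F \<bullet> (F - abs_hs p) \<le> norm F * norm (F - abs_hs p)" by (rule norm_cauchy_schwarz)
    moreover have "norm F * norm (F - abs_hs p) \<le> norm F * d" using p(2) F by (intro mult_left_mono) auto
    ultimately have "norm F * norm F \<le> K * norm F + (K + norm F) * d" by (simp add: algebra_simps)
    moreover have "(K + norm F) * d \<le> (norm F + K + 1) * d" using \<open>d > 0\<close> by (intro mult_right_mono) auto
    moreover have "(norm F + K + 1) * d = e * norm F"
    proof -
      have "norm F + K + 1 \<noteq> 0" using F K by linarith
      then show ?thesis by (simp add: d_def)
    qed
    ultimately have "norm F * norm F \<le> (K + e) * norm F" by (simp add: algebra_simps)
    with F n show False by (simp add: mult_le_cancel_right)
  qed
  then show ?thesis by (rule field_le_epsilon)
qed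

section \<open>The Laplacian on polynomials\<close>

lemma has_derivative_cong_open:
  assumes "open S" "x \<in> S" "\<And>y. y \<in> S \<Longrightarrow> f y = g y"
  shows "(f has_derivative D) (at x) \<longleftrightarrow> (g has_derivative D) (at x)"
  using has_derivative_transform_within_open[OF _ assms(1,2), of f D UNIV g]
    has_derivative_transform_within_open[OF _ assms(1,2), of g D UNIV f] assms(3) by auto

lemma frechet_derivative_cong_open:
  assumes "open S" "x \<in> S" "\<And>y. y \<in> S \<Longrightarrow> f y = g y"
  shows "frechet_derivative f (at x) = frechet_derivative g (at x)"
  by (simp add: frechet_derivative_def has_derivative_cong_open[OF assms])

lemma Ck_on_cong:
  assumes "open S"
  shows "(\<And>x. x \<in> S \<Longrightarrow> f x = g x) \<Longrightarrow> Ck_on k S f \<longleftrightarrow> Ck_on k S g"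
proof (induction k arbitrary: f g)
  case 0
  then show ?case by (auto intro!: continuous_on_cong)
next
  case (Suc k)
  have fd: "frechet_derivative f (at x) = frechet_derivative g (at x)" if "x \<in> S" for x
    by (rule frechet_derivative_cong_open[OF assms that Suc.prems])
  have "f differentiable_on S \<longleftrightarrow> g differentiable_on S"
    unfolding differentiable_on_eq_differentiable_at[OF assms] differentiable_def
    by (intro ball_cong refl ex_cong1 has_derivative_cong_open[OF assms]) (auto simp: Suc.prems)
  moreover have "Ck_on k S (\<lambda>x. frechet_derivative f (at x) b) \<longleftrightarrow> Ck_on k S (\<lambda>x. frechet_derivative g (at x) b)" for b
    by (rule Suc.IH) (simp add: fd)
  ultimately show ?case by simp
qed

text \<open>An algebra closed under directional differentiation away from the origin and containing
  the radially constant extensions of polynomials. Closure under one derivative then gives all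
  orders by induction.\<close>

inductive smooth_away :: "('a::euclidean_space \<Rightarrow> complex) \<Rightarrow> bool" where
  smooth_away_const: "smooth_away (\<lambda>x. c)"
| smooth_away_inner: "smooth_away (\<lambda>x. of_real (x \<bullet> a))"
| smooth_away_inverse_norm: "smooth_away (\<lambda>x. of_real (inverse (norm x)))"
| smooth_away_add: "smooth_away f \<Longrightarrow> smooth_away g \<Longrightarrow> smooth_away (\<lambda>x. f x + g x)"
| smooth_away_mult: "smooth_away f \<Longrightarrow> smooth_away g \<Longrightarrow> smooth_away (\<lambda>x. f x * g x)"

lemma smooth_away_derivative:
  "smooth_away f \<Longrightarrow> \<exists>f'. (\<forall>b. smooth_away (\<lambda>x. f' x b)) \<and> (\<forall>x. x \<noteq> 0 \<longrightarrow> (f has_derivative f' x) (at x))"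
proof (induction rule: smooth_away.induct)
  case (smooth_away_const c)
  show ?case by (rule exI[of _ "\<lambda>x h. 0"]) (auto intro: smooth_away.intros)
next
  case (smooth_away_inner a)
  show ?case
    by (rule exI[of _ "\<lambda>x h. of_real (h \<bullet> a)"]) (auto intro!: smooth_away.smooth_away_const derivative_eq_intros)
next
  case smooth_away_inverse_norm
  let ?i = "\<lambda>x::'a. of_real (inverse (norm x)) :: complex"
  \<comment> \<open>The derivative - (x . h) / |x|^3, written as a product of generators so that it
    visibly stays in the class.\<close>
  let ?f' = "\<lambda>x h. of_real (x \<bullet> h) * (- 1 * (?i x * (?i x * ?i x)))"
  show ?case
  proof (intro exI[of _ ?f'] conjI allI impI)
    fix b :: 'a
    show "smooth_away (\<lambda>x. ?f' x b)"
      by (intro smooth_away.smooth_away_mult smooth_away.smooth_away_const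
          smooth_away.smooth_away_inner smooth_away.smooth_away_inverse_norm)
  next
    fix x :: 'a assume x: "x \<noteq> 0"
    have "((\<lambda>x. inverse (norm x)) has_derivative (\<lambda>h. - (inverse (norm x) * (h \<bullet> sgn x) * inverse (norm x)))) (at x)"
      using Deriv.has_derivative_inverse[OF _ has_derivative_norm[OF x]] x by simp
    then have "(?i has_derivative (\<lambda>h. of_real (- (inverse (norm x) * (h \<bullet> sgn x) * inverse (norm x))))) (at x)"
      by (rule has_derivative_of_real)
    moreover have "(\<lambda>h. of_real (- (inverse (norm x) * (h \<bullet> sgn x) * inverse (norm x)))) = ?f' x"
      by (auto simp: fun_eq_iff sgn_div_norm field_simps inner_commute)
    ultimately show "(?i has_derivative ?f' x) (at x)" by simp
  qed
next
  case (smooth_away_add f g)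
  then obtain f' g' where f': "\<And>b. smooth_away (\<lambda>x. f' x b)" "\<And>x. x \<noteq> 0 \<Longrightarrow> (f has_derivative f' x) (at x)"
    and g': "\<And>b. smooth_away (\<lambda>x. g' x b)" "\<And>x. x \<noteq> 0 \<Longrightarrow> (g has_derivative g' x) (at x)" by metis
  show ?case
    by (rule exI[of _ "\<lambda>x h. f' x h + g' x h"])
       (use f' g' in \<open>auto intro: smooth_away.smooth_away_add has_derivative_add\<close>)
next
  case (smooth_away_mult f g)
  then obtain f' g' where f': "\<And>b. smooth_away (\<lambda>x. f' x b)" "\<And>x. x \<noteq> 0 \<Longrightarrow> (f has_derivative f' x) (at x)"
    and g': "\<And>b. smooth_away (\<lambda>x. g' x b)" "\<And>x. x \<noteq> 0 \<Longrightarrow> (g has_derivative g' x) (at x)" by metis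
  have "\<forall>b. smooth_away (\<lambda>x. f x * g' x b + f' x b * g x)"
    using smooth_away_mult.hyps f'(1) g'(1)
    by (intro allI smooth_away.smooth_away_add smooth_away.smooth_away_mult)
  moreover have "\<forall>x. x \<noteq> 0 \<longrightarrow> ((\<lambda>x. f x * g x) has_derivative (\<lambda>h. f x * g' x h + f' x h * g x)) (at x)"
    using f'(2) g'(2) by (auto intro: has_derivative_mult)
  ultimately show ?case by (intro exI[of _ "\<lambda>x h. f x * g' x h + f' x h * g x"]) simp
qed

lemma smooth_away_Ck_on: "smooth_away f \<Longrightarrow> Ck_on k (- {0}) f"
proof (induction k arbitrary: f)
  case 0
  obtain f' where f': "\<And>x. x \<noteq> 0 \<Longrightarrow> (f has_derivative f' x) (at x)" using smooth_away_derivative[OF 0] by blast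
  then show ?case by (auto intro!: continuous_at_imp_continuous_on intro: has_derivative_continuous)
next
  case (Suc k)
  obtain f' where f': "\<And>b. smooth_away (\<lambda>x. f' x b)" "\<And>x. x \<noteq> 0 \<Longrightarrow> (f has_derivative f' x) (at x)"
    using smooth_away_derivative[OF Suc.prems] by blast
  have "f differentiable_on - {0}"
    using f'(2) by (auto simp: differentiable_on_def differentiable_def intro: has_derivative_at_withinI)
  moreover have "Ck_on k (- {0}) (\<lambda>x. frechet_derivative f (at x) b)" for b
  proof -
    have "Ck_on k (- {0}) (\<lambda>x. frechet_derivative f (at x) b) \<longleftrightarrow> Ck_on k (- {0}) (\<lambda>x. f' x b)"
      by (rule Ck_on_cong) (auto simp: frechet_derivative_at[OF f'(2), symmetric])
    then show ?thesis using Suc.IH[OF f'(1)] by simp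
  qed
  ultimately show ?case by simp
qed

lemma sphere_smooth_spoly: "spoly f \<Longrightarrow> sphere_smooth f"
proof -
  have lf: "smooth_away (\<lambda>y. lform a b (sgn y))" for a b :: 'a
  proof -
    have "smooth_away (\<lambda>y. of_real (inverse (norm y)) * (of_real (y \<bullet> a) + \<i> * of_real (y \<bullet> b)))"
      by (intro smooth_away.intros)
    moreover have "(\<lambda>y. of_real (inverse (norm y)) * (of_real (y \<bullet> a) + \<i> * of_real (y \<bullet> b))) = (\<lambda>y. lform a b (sgn y))"
      by (auto simp: lform_def fun_eq_iff complex_eq_iff sgn_div_norm inner_commute simp del: of_real_inverse)
    ultimately show ?thesis by simp
  qed
  have hp: "smooth_away (\<lambda>y. f (sgn y))" if "hpoly k f" for k and f :: "'a \<Rightarrow> complex"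
    using that by induction (auto intro: lf smooth_away_const smooth_away_add smooth_away_mult)
  have "smooth_away (\<lambda>y. f (sgn y))" if "spoly f" for f :: "'a \<Rightarrow> complex"
    using that by induction (auto intro: smooth_away_add hp)
  then show "spoly f \<Longrightarrow> sphere_smooth f" by (simp add: sphere_smooth_def smooth_away_Ck_on)
qed

section \<open>Ambient derivatives and the ambient Laplacian of polynomials\<close>

definition ddir :: "'a::euclidean_space \<Rightarrow> ('a \<Rightarrow> complex) \<Rightarrow> 'a \<Rightarrow> complex" where
  "ddir v f x = frechet_derivative f (at x) v"

lemma spoly_has_derivative: "spoly f \<Longrightarrow> (f has_derivative (\<lambda>v. ddir v f x)) (at x)"
  using spoly_differentiable[of f x] by (simp add: ddir_def frechet_derivative_works eta_contract_eq)

lemma ddirI: "(f has_derivative D) (at x) \<Longrightarrow> ddir v f x = D v"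
  by (simp add: ddir_def frechet_derivative_at[symmetric])

lemma ddir_const: "ddir v (\<lambda>x. c) x = 0"
  by (rule ddirI[of _ "\<lambda>_. 0", simplified]) simp

lemma ddir_add: "spoly f \<Longrightarrow> spoly g \<Longrightarrow> ddir v (\<lambda>x. f x + g x) x = ddir v f x + ddir v g x"
  by (rule ddirI[of _ "\<lambda>v. ddir v f x + ddir v g x"]) (intro has_derivative_add spoly_has_derivative)

lemma ddir_mult: "spoly f \<Longrightarrow> spoly g \<Longrightarrow> ddir v (\<lambda>x. f x * g x) x = f x * ddir v g x + ddir v f x * g x"
  by (rule ddirI[of _ "\<lambda>v. f x * ddir v g x + ddir v f x * g x"]) (intro has_derivative_mult spoly_has_derivative)

lemma ddir_cmult: "spoly f \<Longrightarrow> ddir v (\<lambda>x. c * f x) x = c * ddir v f x"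
  using ddir_mult[OF spoly_const[of c], of f v x] by (simp add: ddir_const)

lemma ddir_diff: "spoly f \<Longrightarrow> spoly g \<Longrightarrow> ddir v (\<lambda>x. f x - g x) x = ddir v f x - ddir v g x"
  by (rule ddirI[of _ "\<lambda>v. ddir v f x - ddir v g x"]) (intro has_derivative_diff spoly_has_derivative)

lemma ddir_lform: "ddir v (\<lambda>x. lform a b x) x = lform a b v"
  by (rule ddirI) (rule bounded_linear_imp_has_derivative[OF bounded_linear_lform])

lemma ddir_inner: "ddir v (\<lambda>x. of_real (x \<bullet> a)) x = of_real (v \<bullet> a)"
  using ddir_lform[of v a 0 x] by (simp add: lform_of_real inner_commute)

lemma ddir_lform_mult:
  "spoly f \<Longrightarrow> ddir v (\<lambda>x. lform a b x * f x) x = lform a b x * ddir v f x + lform a b v * f x"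
  by (simp add: ddir_mult spoly_lform ddir_lform)

lemma linear_ddir: "spoly f \<Longrightarrow> linear (\<lambda>v. ddir v f x)"
  by (rule has_derivative_linear[OF spoly_has_derivative])

lemma ddir_expand: "spoly f \<Longrightarrow> ddir v f x = (\<Sum>b\<in>Basis. of_real (v \<bullet> b) * ddir b f x)"
proof -
  assume f: "spoly f"
  have "ddir v f x = ddir (\<Sum>b\<in>Basis. (v \<bullet> b) *\<^sub>R b) f x" by (simp add: euclidean_representation)
  also have "\<dots> = (\<Sum>b\<in>Basis. (v \<bullet> b) *\<^sub>R ddir b f x)"
    by (simp only: linear_sum[OF linear_ddir[OF f]] linear_cmul[OF linear_ddir[OF f]])
  finally show ?thesis by (simp add: scaleR_conv_of_real)
qed

lemma hpoly_0: "hpoly k f \<Longrightarrow> k = 0 \<Longrightarrow> \<exists>c. f = (\<lambda>x. c)"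
  by (induction rule: hpoly.induct) auto

lemma hpoly_ddir: "hpoly k f \<Longrightarrow> hpoly (k - 1) (\<lambda>x. ddir v f x)"
proof (induction rule: hpoly.induct)
  case (hpoly_const c)
  then show ?case by (simp add: ddir_const hpoly_zero)
next
  case (hpoly_add k f g)
  then show ?case by (simp add: ddir_add spoly_hpoly hpoly.hpoly_add)
next
  case (hpoly_lform_mult k f a b)
  have sf: "spoly f" by (rule spoly_hpoly) fact
  have "hpoly k (\<lambda>x. lform a b x * ddir v f x + lform a b v * f x)"
  \<comment> \<open>Subtraction is truncated: for \<open>k = 0\<close> the induction hypothesis
    gives degree 0 and the first product would have degree 1, but the derivative of a constant
    vanishes.\<close>
  proof (cases k)
    case 0
    then obtain c where "f = (\<lambda>x. c)" using hpoly_0[OF hpoly_lform_mult.hyps] by blast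
    then show ?thesis using 0 by (simp add: ddir_const hpoly.hpoly_const)
  next
    case (Suc m)
    then have "hpoly k (\<lambda>x. lform a b x * ddir v f x)"
      using hpoly.hpoly_lform_mult[OF hpoly_lform_mult.IH, of a b] by simp
    then show ?thesis by (rule hpoly.hpoly_add) (rule hpoly_cmult[OF hpoly_lform_mult.hyps])
  qed
  then show ?case by (simp add: ddir_lform_mult[OF sf])
qed

lemma spoly_ddir: "spoly f \<Longrightarrow> spoly (\<lambda>x. ddir v f x)"
proof (induction rule: spoly.induct)
  case (spoly_hpoly k f)
  then show ?case by (intro spoly.spoly_hpoly[OF hpoly_ddir])
next
  case (spoly_add f g)
  then show ?case by (simp add: ddir_add spoly.spoly_add)
qed

text \<open>Euler's identity. It evaluates the radial derivatives that separate the ambient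
  Laplacian from the spherical one.\<close>

lemma hpoly_euler: "hpoly k f \<Longrightarrow> ddir x f x = of_nat k * f x"
proof (induction rule: hpoly.induct)
  case (hpoly_const c)
  then show ?case by (simp add: ddir_const)
next
  case (hpoly_add k f g)
  then show ?case by (simp add: ddir_add spoly_hpoly distrib_left)
next
  case (hpoly_lform_mult k f a b)
  have "ddir x (\<lambda>x. lform a b x * f x) x = lform a b x * ddir x f x + lform a b x * f x"
    by (rule ddir_lform_mult[OF spoly_hpoly]) fact
  then show ?case unfolding hpoly_lform_mult.IH by (simp add: algebra_simps)
qed

definition lapl :: "('a::euclidean_space \<Rightarrow> complex) \<Rightarrow> 'a \<Rightarrow> complex" where
  "lapl f x = (\<Sum>b\<in>Basis. ddir b (\<lambda>y. ddir b f y) x)"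

lemma hpoly_sum: "(\<And>i. i \<in> I \<Longrightarrow> hpoly k (f i)) \<Longrightarrow> hpoly k (\<lambda>x. \<Sum>i\<in>I. f i x)"
  by (induction I rule: infinite_finite_induct) (simp_all add: hpoly_zero hpoly_add)

lemma hpoly_lapl: "hpoly k f \<Longrightarrow> hpoly (k - 1 - 1) (\<lambda>x. lapl f x)"
  unfolding lapl_def by (intro hpoly_sum hpoly_ddir)

lemma lapl_const: "lapl (\<lambda>x. c) x = 0"
  by (simp add: lapl_def ddir_const)

lemma lapl_add: "spoly f \<Longrightarrow> spoly g \<Longrightarrow> lapl (\<lambda>x. f x + g x) x = lapl f x + lapl g x"
  by (simp add: lapl_def ddir_add spoly_ddir sum.distrib)

lemma lform_expand: "lform a b x = of_real (a \<bullet> x) + \<i> * of_real (b \<bullet> x)"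
  by (simp add: lform_def complex_eq_iff)

text \<open>Leibniz rule: a linear form has no second derivatives, so only the cross term, twice the
  product of the gradients, is new. Inductions along the construction of polynomials use this
  recursion.\<close>

lemma lapl_lform_mult:
  assumes f: "spoly f"
  shows "lapl (\<lambda>x. lform a b x * f x) x = 2 * (ddir a f x + \<i> * ddir b f x) + lform a b x * lapl f x"
proof -
  have "ddir e (\<lambda>y. ddir e (\<lambda>x. lform a b x * f x) y) x
      = 2 * (lform a b e * ddir e f x) + lform a b x * ddir e (\<lambda>y. ddir e f y) x" for e
    by (simp add: ddir_lform_mult f ddir_add spoly_mult spoly_lform spoly_ddir spoly_const ddir_cmult)
  then have "lapl (\<lambda>x. lform a b x * f x) x
      = 2 * (\<Sum>e\<in>Basis. lform a b e * ddir e f x) + lform a b x * lapl f x"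
    by (simp add: lapl_def sum.distrib sum_distrib_left)
  also have "(\<Sum>e\<in>Basis. lform a b e * ddir e f x) = ddir a f x + \<i> * ddir b f x"
    by (simp add: ddir_expand[OF f, of a] ddir_expand[OF f, of b] lform_expand distrib_right sum.distrib
        sum_distrib_left mult.assoc)
  finally show ?thesis .
qed

lemma lform_orthogonal_transformation:
  assumes "orthogonal_transformation (T :: 'a::euclidean_space \<Rightarrow> 'a)"
  shows "lform a b (T x) = lform (adjoint T a) (adjoint T b) x"
  using orthogonal_transformation_linear[OF assms]
  by (simp add: lform_def adjoint_works inner_commute adjoint_clauses)

lemma orthogonal_transformation_adjoint:
  assumes "orthogonal_transformation (T :: 'a::euclidean_space \<Rightarrow> 'a)"
  shows "T (adjoint T a) = a"
proof -
  have lin: "linear T" by (rule orthogonal_transformation_linear[OF assms])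
  obtain c where c: "T c = a" using orthogonal_transformation_surj[OF assms] by (metis surjD)
  have "y \<bullet> adjoint T (T c) = y \<bullet> c" for y
    using assms lin by (simp add: adjoint_works orthogonal_transformation_def)
  then have "adjoint T a = c" using c by (metis vector_eq_ldot)
  then show ?thesis using c by simp
qed

lemma hpoly_compose:
  assumes T: "orthogonal_transformation (T :: 'a::euclidean_space \<Rightarrow> 'a)"
  shows "hpoly k f \<Longrightarrow> hpoly k (\<lambda>x. f (T x))"
proof (induction rule: hpoly.induct)
  case (hpoly_lform_mult k f a b)
  then show ?case by (simp add: lform_orthogonal_transformation[OF T] hpoly.hpoly_lform_mult)
qed (auto intro: hpoly.hpoly_const hpoly.hpoly_add)

lemma spoly_compose:
  assumes T: "orthogonal_transformation (T :: 'a::euclidean_space \<Rightarrow> 'a)"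
  shows "spoly f \<Longrightarrow> spoly (\<lambda>x. f (T x))"
proof (induction rule: spoly.induct)
  case (spoly_hpoly k f)
  then show ?case by (intro spoly.spoly_hpoly[OF hpoly_compose[OF T]])
next
  case (spoly_add f g)
  then show ?case by (intro spoly.spoly_add)
qed

lemma ddir_compose:
  assumes T: "orthogonal_transformation (T :: 'a::euclidean_space \<Rightarrow> 'a)" and f: "spoly f"
  shows "ddir v (\<lambda>x. f (T x)) x = ddir (T v) f (T x)"
proof (rule ddirI)
  have "(T has_derivative T) (at x)"
    using orthogonal_transformation_linear[OF T] by (simp add: linear_imp_has_derivative)
  then show "((\<lambda>x. f (T x)) has_derivative (\<lambda>v. ddir (T v) f (T x))) (at x)"
    using spoly_has_derivative[OF f] by (rule has_derivative_compose)
qed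

text \<open>In the recursion for a linear factor, composition with \<open>T\<close> replaces the
  coefficient vectors by their images under the adjoint, while the chain rule applies
  \<open>T\<close> to the directions of differentiation. The two cancel.\<close>

lemma lapl_compose:
  assumes T: "orthogonal_transformation (T :: 'a::euclidean_space \<Rightarrow> 'a)"
  shows "hpoly k f \<Longrightarrow> lapl (\<lambda>x. f (T x)) x = lapl f (T x)"
proof (induction arbitrary: x rule: hpoly.induct)
  case (hpoly_const c)
  then show ?case by (simp add: lapl_const)
next
  case (hpoly_add k f g)
  then show ?case by (simp add: lapl_add spoly_hpoly spoly_compose[OF T])
next
  case (hpoly_lform_mult k f a b)
  have f: "spoly f" by (rule spoly_hpoly) fact
  show ?case
    by (simp add: lapl_lform_mult f spoly_compose[OF T f] lform_orthogonal_transformation[OF T]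
        ddir_compose[OF T f] orthogonal_transformation_adjoint[OF T] hpoly_lform_mult.IH)
qed

section \<open>The spherical Laplacian in ambient terms\<close>

text \<open>Chain rule with the derivative of \<open>sgn\<close> at a unit vector, which removes the
  radial component. Agreement of \<open>g\<close> with the polynomial on the sphere alone is what
  allows iteration: a first spherical derivative equals a polynomial there and only there.\<close>

lemma sphere_deriv_eq:
  assumes f: "spoly f" and g: "\<And>y. norm y = 1 \<Longrightarrow> g y = f y" and x: "norm x = 1"
  shows "sphere_deriv v g x = ddir v f x - of_real (x \<bullet> v) * ddir x f x"
proof -
  have x0: "x \<noteq> 0" using x by auto
  have sx: "sgn x = x" using x by (simp add: sgn_div_norm)
  have "sphere_deriv v g x = frechet_derivative (\<lambda>y. f (sgn y)) (at x) v"
    unfolding sphere_deriv_def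
    by (rule arg_cong[of _ _ "\<lambda>D. D v"], rule frechet_derivative_cong_open[of "- {0}"])
       (auto simp: x0 g norm_sgn)
  also have "\<dots> = ddir v f x - of_real (x \<bullet> v) * ddir x f x"
  proof -
    have "((\<lambda>y. inverse (norm y) *\<^sub>R y) has_derivative
        (\<lambda>h. inverse (norm x) *\<^sub>R h + (- (inverse (norm x) * (h \<bullet> sgn x) * inverse (norm x))) *\<^sub>R x)) (at x)"
      using x0 by (intro has_derivative_scaleR Deriv.has_derivative_inverse has_derivative_norm has_derivative_ident) auto
    then have "(sgn has_derivative (\<lambda>h. h - (x \<bullet> h) *\<^sub>R x)) (at x)"
      by (simp add: sgn_div_norm[abs_def] x sx inner_commute)
    then have "((\<lambda>y. f (sgn y)) has_derivative (\<lambda>h. ddir (h - (x \<bullet> h) *\<^sub>R x) f (sgn x))) (at x)"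
      using spoly_has_derivative[OF f] by (rule has_derivative_compose)
    then have "frechet_derivative (\<lambda>y. f (sgn y)) (at x) v = ddir (v - (x \<bullet> v) *\<^sub>R x) f x"
      by (simp add: frechet_derivative_at[symmetric] sx)
    also have "\<dots> = ddir v f x - (x \<bullet> v) *\<^sub>R ddir x f x"
      by (simp add: linear_diff[OF linear_ddir[OF f]] linear_cmul[OF linear_ddir[OF f]])
    finally show ?thesis by (simp add: scaleR_conv_of_real)
  qed
  finally show ?thesis .
qed

text \<open>The spherical derivative as a polynomial in \<open>x\<close>. The radial derivative is
  expanded over the basis because, with \<open>x\<close> itself as direction, it would not visibly
  be a polynomial.\<close>

definition tderiv :: "'a::euclidean_space \<Rightarrow> ('a \<Rightarrow> complex) \<Rightarrow> 'a \<Rightarrow> complex" where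
  "tderiv v f x = ddir v f x - of_real (x \<bullet> v) * (\<Sum>b\<in>Basis. of_real (x \<bullet> b) * ddir b f x)"

lemma spoly_tderiv: "spoly f \<Longrightarrow> spoly (tderiv v f)"
  unfolding tderiv_def by (intro spoly_diff spoly_mult spoly_sum spoly_ddir spoly_inner)

lemma sphere_deriv_tderiv:
  "spoly f \<Longrightarrow> (\<And>y. norm y = 1 \<Longrightarrow> g y = f y) \<Longrightarrow> norm x = 1 \<Longrightarrow> sphere_deriv v g x = tderiv v f x"
  by (simp add: sphere_deriv_eq tderiv_def ddir_expand[of f x])

lemma sphere_laplacian_tderiv:
  assumes f: "spoly f" and g: "\<And>y. norm y = 1 \<Longrightarrow> g y = f y" and x: "norm x = 1"
  shows "sphere_laplacian g x = (\<Sum>b\<in>Basis. tderiv b (tderiv b f) x)"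
  unfolding sphere_laplacian_def
  by (intro sum.cong refl sphere_deriv_tderiv spoly_tderiv f g x)

lemma tderiv_add: "spoly f \<Longrightarrow> spoly g \<Longrightarrow> tderiv v (\<lambda>x. f x + g x) = (\<lambda>x. tderiv v f x + tderiv v g x)"
  by (auto simp: tderiv_def ddir_add distrib_left sum.distrib fun_eq_iff algebra_simps)

lemma tderiv_cmult: "spoly f \<Longrightarrow> tderiv v (\<lambda>x. c * f x) = (\<lambda>x. c * tderiv v f x)"
  by (auto simp: tderiv_def ddir_cmult sum_distrib_left fun_eq_iff algebra_simps)

lemma sphere_laplacian_add:
  "spoly f \<Longrightarrow> spoly g \<Longrightarrow> norm x = 1 \<Longrightarrow>
   sphere_laplacian (\<lambda>x. f x + g x) x = sphere_laplacian f x + sphere_laplacian g x"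
  using sphere_laplacian_tderiv[of f f x] sphere_laplacian_tderiv[of g g x]
    sphere_laplacian_tderiv[OF spoly_add[of f g] refl, of x]
  by (simp add: tderiv_add spoly_tderiv sum.distrib)

lemma sphere_laplacian_cmult:
  "spoly f \<Longrightarrow> norm x = 1 \<Longrightarrow> sphere_laplacian (\<lambda>x. c * f x) x = c * sphere_laplacian f x"
  using sphere_laplacian_tderiv[of f f x] sphere_laplacian_tderiv[OF spoly_mult[OF spoly_const[of c], of f] refl, of x]
  by (simp add: tderiv_cmult spoly_tderiv sum_distrib_left)

text \<open>Two tangential derivatives, with every radial derivative replaced by a degree through
  Euler's identity. Summing over the basis uses \<open>norm x = 1\<close>; the terms without second
  derivatives combine to k (k + N - 2) with N the ambient dimension.\<close>

lemma sphere_laplacian_hpoly: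
  fixes f :: "'a::euclidean_space \<Rightarrow> complex"
  assumes f: "hpoly k f" and x: "norm x = 1"
  shows "sphere_laplacian f x = lapl f x - of_real (real k * (real k + real DIM('a) - 2)) * f x"
proof -
  have sf: "spoly f" by (rule spoly_hpoly[OF f])
  have 1: "sphere_deriv b f y = ddir b f y - of_nat k * (of_real (y \<bullet> b) * f y)" if "norm y = 1" for b y
    using sphere_deriv_eq[OF sf refl that, of b] by (simp add: hpoly_euler[OF f] mult.left_commute)
  have sg: "spoly (\<lambda>y. ddir b f y - of_nat k * (of_real (y \<bullet> b) * f y))" for b
    by (intro spoly_diff spoly_ddir spoly_mult spoly_const spoly_inner sf)
  \<comment> \<open>The first derivative has the truncated degree \<open>k - 1\<close>; for
    \<open>k = 0\<close> it vanishes, so the ordinary difference may be used.\<close>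
  have km: "of_nat (k - 1) * ddir b f x = (of_nat k - 1) * ddir b f x" for b
  proof (cases k)
    case 0
    then obtain c where "f = (\<lambda>x. c)" using hpoly_0[OF f] by blast
    then show ?thesis by (simp add: ddir_const)
  qed simp
  have 2: "sphere_deriv b (sphere_deriv b f) x =
      ddir b (\<lambda>y. ddir b f y) x - of_nat k * (f x + of_real (x \<bullet> b) * ddir b f x)
      - of_real (x \<bullet> b) * ((of_nat k - 1) * ddir b f x - of_nat k * (of_real (x \<bullet> b) * (of_nat k + 1) * f x))"
    if b: "b \<in> Basis" for b
  proof -
    have "sphere_deriv b (sphere_deriv b f) x =
       ddir b (\<lambda>y. ddir b f y - of_nat k * (of_real (y \<bullet> b) * f y)) x
       - of_real (x \<bullet> b) * ddir x (\<lambda>y. ddir b f y - of_nat k * (of_real (y \<bullet> b) * f y)) x"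
      by (rule sphere_deriv_eq[OF sg 1 x])
    also have "ddir b (\<lambda>y. ddir b f y - of_nat k * (of_real (y \<bullet> b) * f y)) x
       = ddir b (\<lambda>y. ddir b f y) x - of_nat k * (f x + of_real (x \<bullet> b) * ddir b f x)"
      using b by (simp add: ddir_diff ddir_cmult ddir_mult spoly_ddir spoly_mult spoly_const spoly_inner sf ddir_inner add.commute)
    also have "ddir x (\<lambda>y. ddir b f y - of_nat k * (of_real (y \<bullet> b) * f y)) x
       = (of_nat k - 1) * ddir b f x - of_nat k * (of_real (x \<bullet> b) * (of_nat k + 1) * f x)"
      using hpoly_euler[OF hpoly_ddir[OF f, of b], of x] km[of b]
      by (simp add: ddir_diff ddir_cmult ddir_mult spoly_ddir spoly_mult spoly_const spoly_inner sf ddir_inner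
          hpoly_euler[OF f] algebra_simps)
    finally show ?thesis .
  qed
  have xx: "(\<Sum>b\<in>Basis. of_real (x \<bullet> b) * of_real (x \<bullet> b) :: complex) = 1"
  proof -
    have "(\<Sum>b\<in>Basis. (x \<bullet> b) * (x \<bullet> b)) = 1"
      using x euclidean_inner[of x x] by (simp add: norm_eq_1)
    then have "of_real (\<Sum>b\<in>Basis. (x \<bullet> b) * (x \<bullet> b)) = (1::complex)" by (simp only: of_real_1)
    then show ?thesis by (simp only: of_real_sum of_real_mult)
  qed
  have xd: "(\<Sum>b\<in>Basis. of_real (x \<bullet> b) * ddir b f x) = of_nat k * f x"
    using ddir_expand[OF sf, of x x] by (simp add: hpoly_euler[OF f])
  have "sphere_laplacian f x = (\<Sum>b\<in>Basis. ddir b (\<lambda>y. ddir b f y) x - of_nat k * f x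
      - (2 * of_nat k - 1) * (of_real (x \<bullet> b) * ddir b f x)
      + of_nat k * (of_nat k + 1) * f x * (of_real (x \<bullet> b) * of_real (x \<bullet> b)))"
    unfolding sphere_laplacian_def by (intro sum.cong refl, subst 2) (auto simp: algebra_simps)
  also have "\<dots> = lapl f x - of_nat DIM('a) * (of_nat k * f x) - (2 * of_nat k - 1) * (of_nat k * f x)
     + of_nat k * (of_nat k + 1) * f x"
    unfolding sum.distrib sum_subtractf sum_distrib_left[symmetric] xx xd lapl_def by simp
  also have "\<dots> = lapl f x - of_real (real k * (real k + real DIM('a) - 2)) * f x"
    by (simp add: algebra_simps)
  finally show ?thesis .
qed

section \<open>Polynomials that are eigenfunctions on the sphere\<close>

definition eigenpoly :: "real \<Rightarrow> ('a::euclidean_space \<Rightarrow> complex) \<Rightarrow> bool" where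
  "eigenpoly l f \<longleftrightarrow> spoly f \<and> (\<forall>x. norm x = 1 \<longrightarrow> - sphere_laplacian f x = of_real l * f x)"

text \<open>With \<open>N = d + 1\<close> this is the usual k (k + d - 1) of the d-dimensional
  sphere.\<close>

definition sphere_eigenvalue :: "nat \<Rightarrow> nat \<Rightarrow> real" where
  "sphere_eigenvalue N k = real k * (real k + real N - 2)"

lemma eigenpoly_cmult: "eigenpoly l f \<Longrightarrow> eigenpoly l (\<lambda>x. c * f x)"
  unfolding eigenpoly_def
  by (auto simp: sphere_laplacian_cmult mult.left_commute intro: spoly_mult spoly_const simp flip: mult_minus_right)

lemma sphere_laplacian_sum:
  "finite I \<Longrightarrow> (\<And>i. i \<in> I \<Longrightarrow> spoly (f i)) \<Longrightarrow> norm x = 1 \<Longrightarrow>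
   sphere_laplacian (\<lambda>x. \<Sum>i\<in>I. f i x) x = (\<Sum>i\<in>I. sphere_laplacian (f i) x)"
proof (induction I rule: finite_induct)
  case empty
  then show ?case using sphere_laplacian_cmult[OF spoly_const[of 0], of x 0] by simp
next
  case (insert i I)
  then show ?case by (simp add: sphere_laplacian_add spoly_sum)
qed

text \<open>On the sphere the Laplacian acts on homogeneous polynomials of degree \<open>k\<close> as
  multiplication by minus the \<open>k\<close>-th eigenvalue, up to a term of degree \<open>k - 2\<close>; the eigenvalues being
  distinct, that term can be removed.\<close>

lemma hpoly_eigenpoly_decomposition:
  fixes f :: "'a::euclidean_space \<Rightarrow> complex"
  assumes N: "2 \<le> DIM('a)"
  shows "hpoly k f \<Longrightarrow> \<exists>\<phi>. (\<forall>j\<le>k. eigenpoly (sphere_eigenvalue DIM('a) j) (\<phi> j)) \<and>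
     (\<forall>x. norm x = 1 \<longrightarrow> f x = (\<Sum>j\<le>k. \<phi> j x))"
proof (induction k arbitrary: f rule: less_induct)
  case (less k f)
  let ?l = "sphere_eigenvalue DIM('a)"
  have sf: "spoly f" by (rule spoly_hpoly) fact
  have lap: "sphere_laplacian f x = lapl f x - of_real (?l k) * f x" if "norm x = 1" for x
    using sphere_laplacian_hpoly[OF less.prems that] by (simp add: sphere_eigenvalue_def)
  show ?case
  proof (cases k)
    case 0
    then obtain c where "f = (\<lambda>x. c)" using hpoly_0[OF less.prems] by blast
    then have "eigenpoly (?l 0) f" using lap sf 0 by (simp add: eigenpoly_def lapl_const)
    then show ?thesis using 0 by (intro exI[of _ "\<lambda>_. f"]) simp
  next
    case (Suc m)
    have "hpoly (k - 1 - 1) (\<lambda>x. lapl f x)" by (rule hpoly_lapl[OF less.prems])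
    \<comment> \<open>For \<open>k = 1\<close> truncation gives degree 0, which is still
      smaller.\<close>
    moreover have "k - 1 - 1 < k" using Suc by simp
    ultimately obtain r where r: "\<And>j. j \<le> k - 1 - 1 \<Longrightarrow> eigenpoly (?l j) (r j)"
      and rs: "\<And>x. norm x = 1 \<Longrightarrow> lapl f x = (\<Sum>j\<le>k-1-1. r j x)"
      using less.IH by blast
    \<comment> \<open>The eigenvalues increase strictly: the second factor for \<open>k\<close> is
      positive because \<open>k\<close> is positive and the ambient dimension is at least 2.\<close>
    have ne: "?l k - ?l j \<noteq> 0" if "j \<le> k - 1 - 1" for j
    proof -
      have jk: "real j < real k" using that Suc by simp
      have "?l j \<le> real j * (real k + real DIM('a) - 2)"
        unfolding sphere_eigenvalue_def by (intro mult_left_mono) (use jk in auto)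
      also have "\<dots> < real k * (real k + real DIM('a) - 2)"
        by (intro mult_strict_right_mono) (use jk N in auto)
      finally show ?thesis by (simp add: sphere_eigenvalue_def)
    qed
    \<comment> \<open>As - Laplacian \<open>f\<close> = \<open>l_k f\<close> minus the sum of the
      \<open>r j\<close>, subtracting \<open>c j * r j\<close> leaves an eigenfunction for
      \<open>l_k\<close> exactly when \<open>1 + c j * l_j = l_k * c j\<close>.\<close>
    define c :: "nat \<Rightarrow> complex" where "c j = of_real (1 / (?l k - ?l j))" for j
    define g where "g x = f x - (\<Sum>j\<le>k-1-1. c j * r j x)" for x
    define \<phi> where "\<phi> j = (if j = k then g else if j \<le> k - 1 - 1 then (\<lambda>x. c j * r j x) else (\<lambda>x. 0))" for j
    have sr: "spoly (r j)" if "j \<le> k - 1 - 1" for j using r[OF that] by (simp add: eigenpoly_def)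
    have scr: "spoly (\<lambda>x. - c j * r j x)" if "j \<le> k - 1 - 1" for j by (intro spoly_mult spoly_const sr that)
    have geq: "g = (\<lambda>x. f x + (\<Sum>j\<le>k-1-1. - c j * r j x))"
      by (auto simp: g_def fun_eq_iff sum_negf)
    have gs: "spoly g" unfolding geq by (intro spoly_add sf spoly_sum scr) simp
    have "- sphere_laplacian g x = of_real (?l k) * g x" if x: "norm x = 1" for x
    proof -
      have rl: "sphere_laplacian (r j) x = - of_real (?l j) * r j x" if "j \<le> k - 1 - 1" for j
      proof -
        have "- sphere_laplacian (r j) x = of_real (?l j) * r j x" using r[OF that] x by (simp add: eigenpoly_def)
        then show ?thesis by (metis minus_minus mult_minus_left)
      qed
      have "sphere_laplacian g x = sphere_laplacian f x + sphere_laplacian (\<lambda>x. \<Sum>j\<le>k-1-1. - c j * r j x) x"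
        unfolding geq by (rule sphere_laplacian_add[OF sf _ x], rule spoly_sum, rule scr) simp
      also have "sphere_laplacian (\<lambda>x. \<Sum>j\<le>k-1-1. - c j * r j x) x = (\<Sum>j\<le>k-1-1. sphere_laplacian (\<lambda>x. - c j * r j x) x)"
        by (rule sphere_laplacian_sum[OF _ _ x]) (simp, rule scr, simp)
      also have "(\<Sum>j\<le>k-1-1. sphere_laplacian (\<lambda>x. - c j * r j x) x) = (\<Sum>j\<le>k-1-1. c j * of_real (?l j) * r j x)"
      proof (rule sum.cong)
        fix j assume "j \<in> {..k - 1 - 1}"
        then show "sphere_laplacian (\<lambda>x. - c j * r j x) x = c j * of_real (?l j) * r j x"
          using sphere_laplacian_cmult[OF sr x, of j "- c j"] rl[of j] by simp
      qed simp
      finally have lg: "- sphere_laplacian g x = of_real (?l k) * f x - (\<Sum>j\<le>k-1-1. r j x + c j * of_real (?l j) * r j x)"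
        using lap[OF x] rs[OF x] by (simp add: sum.distrib)
      have "r j x + c j * of_real (?l j) * r j x = of_real (?l k) * (c j * r j x)" if "j \<le> k - 1 - 1" for j
      proof -
        have "c j * of_real (?l k - ?l j) = 1" using ne[OF that] unfolding c_def of_real_mult[symmetric] by simp
        then have "c j * of_real (?l k) = 1 + c j * of_real (?l j)" by (simp add: algebra_simps)
        then have "c j * of_real (?l k) * r j x = (1 + c j * of_real (?l j)) * r j x" by simp
        then show ?thesis by (simp add: algebra_simps)
      qed
      then have "(\<Sum>j\<le>k-1-1. r j x + c j * of_real (?l j) * r j x) = (\<Sum>j\<le>k-1-1. of_real (?l k) * (c j * r j x))"
        by (intro sum.cong) auto
      then show ?thesis unfolding lg by (simp add: g_def right_diff_distrib sum_distrib_left)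
    qed
    then have eg: "eigenpoly (?l k) g" using gs by (simp add: eigenpoly_def)
    have ez: "eigenpoly l (\<lambda>x::'a. 0)" for l
    proof -
      have "sphere_laplacian (\<lambda>x. 0 * (0::complex)) x = 0 * sphere_laplacian (\<lambda>x. 0) x" if "norm x = 1" for x :: 'a
        by (rule sphere_laplacian_cmult[OF spoly_const that])
      then show ?thesis by (simp add: eigenpoly_def spoly_const)
    qed
    have "\<forall>j\<le>k. eigenpoly (?l j) (\<phi> j)"
      using eg ez r by (auto simp: \<phi>_def intro: eigenpoly_cmult)
    moreover have "f x = (\<Sum>j\<le>k. \<phi> j x)" for x
    proof -
      have "(\<Sum>j\<le>k. \<phi> j x) = \<phi> k x + (\<Sum>j<k. \<phi> j x)"
        by (simp add: lessThan_Suc_atMost[symmetric])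
      also have "(\<Sum>j<k. \<phi> j x) = (\<Sum>j\<le>k-1-1. \<phi> j x)"
        using Suc by (intro sum.mono_neutral_right) (auto simp: \<phi>_def)
      also have "\<dots> = (\<Sum>j\<le>k-1-1. c j * r j x)" using Suc by (intro sum.cong) (auto simp: \<phi>_def)
      finally show ?thesis by (simp add: \<phi>_def g_def)
    qed
    ultimately show ?thesis by blast
  qed
qed

lemma eigenpoly_compose:
  fixes f :: "'a::euclidean_space \<Rightarrow> complex"
  assumes T: "orthogonal_transformation (T :: 'a \<Rightarrow> 'a)" and f: "eigenpoly l f"
  shows "eigenpoly l (\<lambda>x. f (T x))"
proof -
  have "sphere_laplacian (\<lambda>x. f (T x)) x = sphere_laplacian f (T x)" if f: "spoly f" and x: "norm x = 1" for f x
    using f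
  proof (induction rule: spoly.induct)
    case (spoly_hpoly k f)
    then show ?case
      using sphere_laplacian_hpoly[OF hpoly_compose[OF T spoly_hpoly] x] sphere_laplacian_hpoly[of k f "T x"] x
      by (simp add: lapl_compose[OF T] orthogonal_transformation_norm[OF T])
  next
    case (spoly_add f g)
    then show ?case using x
      by (simp add: sphere_laplacian_add spoly_compose[OF T] orthogonal_transformation_norm[OF T])
  qed
  then show ?thesis
    using f by (auto simp: eigenpoly_def spoly_compose[OF T] orthogonal_transformation_norm[OF T])
qed

lemma ddir_lform_power:
  "ddir v (\<lambda>x. lform p q x ^ n) x = of_nat n * lform p q v * lform p q x ^ (n - 1)"
proof (induction n)
  case 0
  then show ?case by (simp add: ddir_const)
next
  case (Suc n)
  have "ddir v (\<lambda>x. lform p q x * lform p q x ^ n) x = lform p q x * ddir v (\<lambda>x. lform p q x ^ n) x + lform p q v * lform p q x ^ n"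
    by (rule ddir_lform_mult[OF spoly_lform_power])
  then have "ddir v (\<lambda>x. lform p q x ^ Suc n) x
      = lform p q x * (of_nat n * lform p q v * lform p q x ^ (n - 1)) + lform p q v * lform p q x ^ n"
    by (simp only: power_Suc Suc.IH)
  also have "\<dots> = of_nat (Suc n) * lform p q v * lform p q x ^ (Suc n - 1)"
    by (cases n) (simp_all add: algebra_simps)
  finally show ?case .
qed

text \<open>The gradient of the power points along p + i q, which is isotropic: its bilinear square
  is 1 + i^2 = 0. Hence the cross term in the Leibniz recursion vanishes and the power is harmonic
  in the ambient space.\<close>

lemma eigenpoly_lform_power:
  fixes p q :: "'a::euclidean_space"
  assumes pq: "norm p = 1" "norm q = 1" "p \<bullet> q = 0"
  shows "eigenpoly (sphere_eigenvalue DIM('a) n) (\<lambda>x. lform p q x ^ n)"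
proof -
  have lpq: "lform p q p = 1" "lform p q q = \<i>"
    using pq by (simp_all add: lform_def complex_eq_iff norm_eq_1 inner_commute)
  have "lapl (\<lambda>x. lform p q x ^ n) x = 0" for x
  proof (induction n)
    case 0
    then show ?case by (simp add: lapl_const)
  next
    case (Suc n)
    have "ddir p (\<lambda>x. lform p q x ^ n) x + \<i> * ddir q (\<lambda>x. lform p q x ^ n) x = 0"
      by (simp add: ddir_lform_power lpq algebra_simps)
    then show ?case using Suc by (simp add: lapl_lform_mult spoly_lform_power)
  qed
  then show ?thesis
    using sphere_laplacian_hpoly[OF hpoly_lform_power[of n p q]]
    by (simp add: eigenpoly_def spoly_lform_power sphere_eigenvalue_def)
qed

text \<open>The constant sequence \<open>f\<close> witnesses membership in the closure.\<close>

lemma neg_laplacian_eigenpoly: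
  assumes f: "eigenpoly l f"
  shows "(f, \<lambda>x. of_real l * f x) \<in> neg_laplacian"
proof -
  have sf: "spoly f" using f by (simp add: eigenpoly_def)
  have "L2_norm sphere_measure (\<lambda>x. - sphere_laplacian f x - of_real l * f x) = 0"
  proof -
    have "(LINT x|sphere_measure. (cmod (- sphere_laplacian f x - of_real l * f x))\<^sup>2) = (LINT x|(sphere_measure :: 'a measure). 0)"
      by (rule Bochner_Integration.integral_cong) (use f in \<open>auto simp: eigenpoly_def\<close>)
    then show ?thesis by (simp add: L2_norm_def)
  qed
  then show ?thesis using L2_spoly[OF sf] sphere_smooth_spoly[OF sf]
    by (auto simp: neg_laplacian_def L2_norm_def[of _ "\<lambda>x. 0"] intro!: L2_cmult exI[of _ "\<lambda>n. f"])
qed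

section \<open>Groups of isometries and operators almost commuting with the generator\<close>

text \<open>Generators are defined by difference quotients, whereas the mean value inequality needs
  a derivative.\<close>

lemma has_derivative_iff_difference_quotient:
  fixes f :: "real \<Rightarrow> 'b::real_normed_vector"
  shows "(f has_derivative (\<lambda>h. h *\<^sub>R v)) (at x) \<longleftrightarrow> ((\<lambda>h. (f (x + h) - f x) /\<^sub>R h) \<longlongrightarrow> v) (at 0)"
proof -
  have "norm (f (x + h) - f x - h *\<^sub>R v) / norm h = norm ((f (x + h) - f x) /\<^sub>R h - v)" if "h \<noteq> 0" for h
  proof -
    have "(f (x + h) - f x) /\<^sub>R h - v = (f (x + h) - f x - h *\<^sub>R v) /\<^sub>R h"
      using that by (simp add: scaleR_diff_right)
    then show ?thesis by (simp add: divide_inverse mult.commute)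
  qed
  then have "\<forall>\<^sub>F h in at 0. norm (f (x + h) - f x - h *\<^sub>R v) / norm h = norm ((f (x + h) - f x) /\<^sub>R h - v)"
    by (auto simp: eventually_at_filter)
  then have "(f has_derivative (\<lambda>h. h *\<^sub>R v)) (at x) \<longleftrightarrow> ((\<lambda>h. norm ((f (x + h) - f x) /\<^sub>R h - v)) \<longlongrightarrow> 0) (at 0)"
    unfolding has_derivative_at by (simp add: bounded_linear_scaleR_left tendsto_cong)
  then show ?thesis by (simp add: tendsto_norm_zero_iff LIM_zero_iff)
qed

definition generates :: "(real \<Rightarrow> 'b \<Rightarrow> 'b) \<Rightarrow> 'b::real_normed_vector \<Rightarrow> 'b \<Rightarrow> bool" where
  "generates W x y \<longleftrightarrow> ((\<lambda>h. (W h x - x) /\<^sub>R h) \<longlongrightarrow> y) (at 0)"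

text \<open>The curve \<open>s \<mapsto> W (-s) (R (W s x))\<close> has velocity \<open>W (-s) (R y\<^sub>s - z\<^sub>s)\<close>, where
  \<open>y\<^sub>s\<close> and \<open>z\<^sub>s\<close> are the values of the generator at \<open>W s x\<close> and \<open>R (W s x)\<close>.\<close>

lemma isometric_group_commutator_bound:
  fixes W :: "real \<Rightarrow> 'b::real_normed_vector \<Rightarrow> 'b"
  assumes lin: "\<And>t. linear (W t)" and iso: "\<And>t x. norm (W t x) = norm x"
    and W0: "\<And>x. W 0 x = x" and Wadd: "\<And>s t x. W (s + t) x = W s (W t x)"
    and cont: "\<And>x. ((\<lambda>t. W t x) \<longlongrightarrow> x) (at 0)"
    and R: "bounded_linear R"
    and comm: "\<And>x y. generates W x y \<Longrightarrow> \<exists>z. generates W (R x) z \<and> norm (z - R y) \<le> M * norm x"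
    and x: "generates W x y"
  shows "norm (R (W t x) - W t (R x)) \<le> M * norm x * \<bar>t\<bar>"
proof -
  interpret R: bounded_linear R by (rule R)
  have bl: "bounded_linear (W t)" for t
    by (rule bounded_linear_intro[of _ 1]) (auto simp: linear_add[OF lin] linear_cmul[OF lin] iso)
  have diff: "W t (a - b) = W t a - W t b" for t a b by (rule linear_diff[OF lin])
  have scale: "W t (r *\<^sub>R a) = r *\<^sub>R W t a" for t r a by (rule linear_cmul[OF lin])
  have lim: "((\<lambda>h. (W (s + h) x - W s x) /\<^sub>R h) \<longlongrightarrow> W s y) (at 0)" for s
  proof -
    have "((\<lambda>h. W s ((W h x - x) /\<^sub>R h)) \<longlongrightarrow> W s y) (at 0)"
      by (rule bounded_linear.tendsto[OF bl x[unfolded generates_def]])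
    then show ?thesis by (simp add: diff scale Wadd)
  qed
  have gen: "generates W (W s x) (W s y)" for s
    unfolding generates_def using lim[of s] by (simp only: Wadd[symmetric] add.commute)
  have neg: "filterlim uminus (at 0) (at (0::real))"
    by (rule filterlim_atI) (auto intro!: tendsto_eq_intros simp: eventually_at_filter)
  define c where "c s = W (- s) (R (W s x))" for s
  have der: "\<exists>v. (c has_derivative (\<lambda>h. h *\<^sub>R v)) (at s) \<and> norm v \<le> M * norm x" for s
  proof -
    obtain z where z: "generates W (R (W s x)) z" "norm (z - R (W s y)) \<le> M * norm (W s x)"
      using comm[OF gen] by blast
    let ?a = "\<lambda>h. R ((W (s + h) x - W s x) /\<^sub>R h)"
    have a: "(?a \<longlongrightarrow> R (W s y)) (at 0)" by (rule R.tendsto[OF lim])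
    \<comment> \<open>Product rule for a group that is only strongly continuous: isometry controls
      the change of the argument, and continuity at the fixed limit vector does the rest.\<close>
    have "((\<lambda>h. W (- h) (?a h) - R (W s y)) \<longlongrightarrow> 0) (at 0)"
    proof (rule Lim_null_comparison)
      show "\<forall>\<^sub>F h in at 0. norm (W (- h) (?a h) - R (W s y))
          \<le> norm (?a h - R (W s y)) + norm (W (- h) (R (W s y)) - R (W s y))"
      proof (rule always_eventually, rule allI)
        fix h
        have "W (- h) (?a h) - R (W s y) = W (- h) (?a h - R (W s y)) + (W (- h) (R (W s y)) - R (W s y))"
          by (simp add: diff)
        then show "norm (W (- h) (?a h) - R (W s y))
          \<le> norm (?a h - R (W s y)) + norm (W (- h) (R (W s y)) - R (W s y))"
          by (metis iso norm_triangle_ineq)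
      qed
      have "((\<lambda>h. W (- h) (R (W s y))) \<longlongrightarrow> R (W s y)) (at 0)"
        using filterlim_compose[OF cont neg] by simp
      with a show "((\<lambda>h. norm (?a h - R (W s y)) + norm (W (- h) (R (W s y)) - R (W s y))) \<longlongrightarrow> 0) (at 0)"
        by (intro tendsto_add_zero tendsto_norm_zero LIM_zero)
    qed
    then have 1: "((\<lambda>h. W (- h) (?a h)) \<longlongrightarrow> R (W s y)) (at 0)" by (rule LIM_zero_cancel)
    have "((\<lambda>h. - ((W (- h) (R (W s x)) - R (W s x)) /\<^sub>R (- h))) \<longlongrightarrow> - z) (at 0)"
      by (rule tendsto_minus, rule filterlim_compose[OF z(1)[unfolded generates_def] neg])
    then have 2: "((\<lambda>h. (W (- h) (R (W s x)) - R (W s x)) /\<^sub>R h) \<longlongrightarrow> - z) (at 0)" by simp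
    have "((\<lambda>h. W (- s) (W (- h) (?a h) + (W (- h) (R (W s x)) - R (W s x)) /\<^sub>R h)) \<longlongrightarrow> W (- s) (R (W s y) + - z)) (at 0)"
      by (rule bounded_linear.tendsto[OF bl tendsto_add[OF 1 2]])
    moreover have "W (- s) (W (- h) (?a h) + (W (- h) (R (W s x)) - R (W s x)) /\<^sub>R h) = (c (s + h) - c s) /\<^sub>R h" for h
    proof -
      have "W (- h) (?a h) + (W (- h) (R (W s x)) - R (W s x)) /\<^sub>R h
          = (W (- h) (R (W (s + h) x)) - R (W s x)) /\<^sub>R h"
        by (simp add: R.scaleR R.diff scale diff scaleR_diff_right)
      moreover have "W (- s) (W (- h) (R (W (s + h) x))) = c (s + h)"
        by (simp add: c_def Wadd[symmetric])
      ultimately show ?thesis by (simp add: scale diff c_def)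
    qed
    ultimately have "(c has_derivative (\<lambda>h. h *\<^sub>R W (- s) (R (W s y) + - z))) (at s)"
      by (simp add: has_derivative_iff_difference_quotient)
    moreover have "norm (W (- s) (R (W s y) + - z)) \<le> M * norm x"
      using z(2) by (simp add: iso norm_minus_commute)
    ultimately show ?thesis by blast
  qed
  then obtain v where v: "\<And>s. (c has_derivative (\<lambda>h. h *\<^sub>R v s)) (at s)" "\<And>s. norm (v s) \<le> M * norm x"
    by metis
  \<comment> \<open>Mean value inequality with the uniform velocity bound; applying the isometry
    \<open>W t\<close> afterwards turns the increment of \<open>c\<close> into the
    commutator.\<close>
  have "norm (c t - c 0) \<le> M * norm x * norm (t - 0)"
  proof (rule differentiable_bound[where S = UNIV and f' = "\<lambda>s h. h *\<^sub>R v s"])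
    show "onorm (\<lambda>h. h *\<^sub>R v s) \<le> M * norm x" for s
    proof (rule order_trans[OF onorm_le v(2)])
      show "norm (h *\<^sub>R v s) \<le> norm (v s) * norm h" for h by simp
    qed
  qed (auto intro: v(1))
  moreover have "norm (c t - c 0) = norm (W t (c t - c 0))" by (simp add: iso)
  moreover have "W t (c t - c 0) = R (W t x) - W t (R x)"
    by (simp add: diff c_def W0 Wadd[symmetric])
  ultimately show ?thesis by simp
qed

section \<open>Spectral resolutions\<close>

lemma L2_inner_eq_Re: "f \<in> L2 sphere_measure \<Longrightarrow> g \<in> L2 sphere_measure \<Longrightarrow> abs_hs f \<bullet> abs_hs g = Re (L2_inner sphere_measure f g)"
  by (simp add: inner_abs_hs L2_inner_def)

section \<open>Projection-valued measures on the quotient\<close>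

locale sphere_pvm =
  fixes E :: "real set \<Rightarrow> ('a::euclidean_space \<Rightarrow> complex) \<Rightarrow> ('a \<Rightarrow> complex)"
  assumes pvm: "projection_valued_measure sphere_measure E"
begin

lemmas pvm_unfolded = pvm[unfolded projection_valued_measure_def]
lemmas pvm_L2 = pvm_unfolded[THEN conjunct1, rule_format]
lemmas pvm_lincomb = pvm_unfolded[THEN conjunct2, THEN conjunct1, rule_format]
lemmas pvm_sym = pvm_unfolded[THEN conjunct2, THEN conjunct2, THEN conjunct1, rule_format]
lemmas pvm_Int = pvm_unfolded[THEN conjunct2, THEN conjunct2, THEN conjunct2, THEN conjunct1, rule_format]
lemmas pvm_UNIV = pvm_unfolded[THEN conjunct2, THEN conjunct2, THEN conjunct2, THEN conjunct2, THEN conjunct1, rule_format]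
lemmas pvm_UN = pvm_unfolded[THEN conjunct2, THEN conjunct2, THEN conjunct2, THEN conjunct2, THEN conjunct2, rule_format]

lemma E_L2: "B \<in> sets borel \<Longrightarrow> f \<in> L2 sphere_measure \<Longrightarrow> E B f \<in> L2 sphere_measure"
  by (rule pvm_L2)

text \<open>A symmetric idempotent is a contraction, by Cauchy-Schwarz. This bound is what lets
  \<open>E B\<close> descend to the quotient.\<close>

lemma E_norm_le:
  assumes B: "B \<in> sets borel" and f: "f \<in> L2 sphere_measure"
  shows "L2_norm sphere_measure (E B f) \<le> L2_norm sphere_measure f"
proof -
  let ?g = "E B f"
  have g: "?g \<in> L2 sphere_measure" and gg: "E B ?g \<in> L2 sphere_measure" by (intro E_L2 B f)+
  have "AE x in sphere_measure. E (B \<inter> B) f x = E B (E B f) x"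
    by (rule pvm_Int[OF B B f])
  then have idem: "abs_hs (E B ?g) = abs_hs ?g" using g gg by (subst abs_hs_eq_iff) (auto elim: eventually_mono)
  have "L2_inner sphere_measure ?g ?g = L2_inner sphere_measure f (E B ?g)"
    by (rule pvm_sym[OF B f g])
  then have "abs_hs ?g \<bullet> abs_hs ?g = abs_hs f \<bullet> abs_hs ?g"
    using L2_inner_eq_Re[OF g g] L2_inner_eq_Re[OF f gg] idem by simp
  also have "\<dots> \<le> norm (abs_hs f) * norm (abs_hs ?g)" by (rule norm_cauchy_schwarz)
  finally have "norm (abs_hs ?g) * norm (abs_hs ?g) \<le> norm (abs_hs f) * norm (abs_hs ?g)"
    by (simp add: power2_norm_eq_inner[symmetric] power2_eq_square)
  then have "norm (abs_hs ?g) \<le> norm (abs_hs f)" by (cases "norm (abs_hs ?g) = 0") (auto simp: mult_le_cancel_right)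
  then show ?thesis by (simp add: norm_abs_hs f g)
qed

lemma respects_E:
  assumes B: "B \<in> sets borel" shows "hs_respects (E B)"
proof (rule hs_respectsI_bounded)
  fix f g :: "'a \<Rightarrow> complex" and a b :: complex
  assume "f \<in> L2 sphere_measure" "g \<in> L2 sphere_measure"
  then show "AE x in sphere_measure. E B (\<lambda>y. a * f y + b * g y) x = a * E B f x + b * E B g x"
    by (rule pvm_lincomb[OF B])
qed (rule E_L2[OF B], assumption, rule E_norm_le[OF B])

definition Eh :: "real set \<Rightarrow> 'a hs \<Rightarrow> 'a hs" where "Eh B = hs_op (E B)"

lemma Eh_abs_hs: "B \<in> sets borel \<Longrightarrow> f \<in> L2 sphere_measure \<Longrightarrow> Eh B (abs_hs f) = abs_hs (E B f)"
  by (simp add: Eh_def hs_op_abs_hs respects_E)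

lemma Eh_lincomb:
  assumes B: "B \<in> sets borel"
  shows "Eh B (scaleC_hs a F + scaleC_hs b G) = scaleC_hs a (Eh B F) + scaleC_hs b (Eh B G)"
  unfolding Eh_def by (rule hs_op_lincomb[OF respects_E[OF B] pvm_lincomb[OF B]])

lemma Eh_add: "B \<in> sets borel \<Longrightarrow> Eh B (F + G) = Eh B F + Eh B G"
  using Eh_lincomb[of B 1 F 1 G] by (simp add: scaleC_1)

lemma Eh_scaleC: "B \<in> sets borel \<Longrightarrow> Eh B (scaleC_hs a F) = scaleC_hs a (Eh B F)"
  using Eh_lincomb[of B a F 0 F] by (simp add: scaleC_0)

lemma Eh_sym:
  assumes B: "B \<in> sets borel"
  shows "Eh B F \<bullet> G = F \<bullet> Eh B G"
proof (cases F rule: hs_cases; cases G rule: hs_cases)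
  fix f g assume f: "f \<in> L2 sphere_measure" "F = abs_hs f" and g: "g \<in> L2 sphere_measure" "G = abs_hs g"
  have "L2_inner sphere_measure (E B f) g = L2_inner sphere_measure f (E B g)"
    by (rule pvm_sym[OF B f(1) g(1)])
  then show ?thesis by (simp add: f g B Eh_abs_hs L2_inner_eq_Re E_L2)
qed

lemma Eh_Int:
  assumes A: "A \<in> sets borel" and B: "B \<in> sets borel"
  shows "Eh (A \<inter> B) F = Eh A (Eh B F)"
proof (cases F rule: hs_cases)
  fix f assume f: "f \<in> L2 sphere_measure" "F = abs_hs f"
  have "AE x in sphere_measure. E (A \<inter> B) f x = E A (E B f) x"
    by (rule pvm_Int[OF A B f(1)])
  then show ?thesis using A B by (simp add: f Eh_abs_hs E_L2 abs_hs_eq_iff)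
qed

lemma Eh_UNIV: "Eh UNIV F = F"
proof (cases F rule: hs_cases)
  fix f assume f: "f \<in> L2 sphere_measure" "F = abs_hs f"
  have "AE x in sphere_measure. E UNIV f x = f x"
    by (rule pvm_UNIV[OF f(1)])
  then show ?thesis by (simp add: f Eh_abs_hs E_L2 abs_hs_eq_iff)
qed

lemma Eh_LIMSEQ:
  fixes A :: "nat \<Rightarrow> real set"
  assumes A: "range A \<subseteq> sets borel" "disjoint_family A"
  shows "(\<lambda>n. \<Sum>i<n. Eh (A i) F) \<longlonglongrightarrow> Eh (\<Union>i. A i) F"
proof (cases F rule: hs_cases)
  fix f assume f: "f \<in> L2 sphere_measure" "F = abs_hs f"
  have Ai: "A i \<in> sets borel" for i using A by auto
  then have U: "(\<Union>i. A i) \<in> sets borel" by blast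
  have "(\<lambda>n. L2_norm sphere_measure (\<lambda>x. (\<Sum>i<n. E (A i) f x) - E (\<Union>i. A i) f x)) \<longlonglongrightarrow> 0"
    by (rule pvm_UN[OF A f(1)])
  moreover have "L2_norm sphere_measure (\<lambda>x. (\<Sum>i<n. E (A i) f x) - E (\<Union>i. A i) f x)
     = norm ((\<Sum>i<n. Eh (A i) F) - Eh (\<Union>i. A i) F)" for n
    using Ai U f by (simp add: norm_abs_hs_diff L2_sum E_L2 abs_hs_sum Eh_abs_hs)
  ultimately show ?thesis by (simp add: tendsto_norm_zero_iff LIM_zero_iff)
qed

text \<open>Additivity along a sequence of empty sets makes a constant series converge, so its term
  is zero. Finite additivity then follows by padding with empty sets.\<close>

lemma Eh_empty: "Eh {} F = 0"
proof -
  have "(\<lambda>n. \<Sum>i<n. Eh {} F) \<longlonglongrightarrow> Eh {} F"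
    using Eh_LIMSEQ[of "\<lambda>_. {}" F] by (simp add: disjoint_family_on_def)
  then have "summable (\<lambda>i::nat. Eh {} F)" by (auto simp: summable_def sums_def)
  then show ?thesis by (simp add: summable_const_iff)
qed

lemma Eh_Un:
  assumes A: "A \<in> sets borel" and B: "B \<in> sets borel" and d: "A \<inter> B = {}"
  shows "Eh (A \<union> B) F = Eh A F + Eh B F"
proof -
  define S where "S i = (if i = 0 then A else if i = Suc 0 then B else {})" for i :: nat
  have "(\<lambda>n. \<Sum>i<n. Eh (S i) F) \<longlonglongrightarrow> Eh (\<Union>i. S i) F"
    by (rule Eh_LIMSEQ) (use A B d in \<open>auto simp: S_def disjoint_family_on_def\<close>)
  moreover have "(\<Union>i. S i) = A \<union> B" by (auto simp: S_def split: if_splits intro: exI[of _ "Suc 0"])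
  ultimately have 1: "(\<lambda>n. \<Sum>i<n. Eh (S i) F) \<longlonglongrightarrow> Eh (A \<union> B) F" by simp
  have "(\<Sum>i<n + 2. Eh (S i) F) = Eh A F + Eh B F" for n
  proof -
    have "(\<Sum>i<n + 2. Eh (S i) F) = (\<Sum>i<2. Eh (S i) F)"
      by (rule sum.mono_neutral_right) (auto simp: S_def Eh_empty)
    then show ?thesis by (simp add: S_def numeral_2_eq_2)
  qed
  then have "(\<lambda>n. \<Sum>i<n + 2. Eh (S i) F) \<longlonglongrightarrow> Eh A F + Eh B F" by simp
  then have "(\<lambda>n. \<Sum>i<n. Eh (S i) F) \<longlonglongrightarrow> Eh A F + Eh B F" by (rule LIMSEQ_offset)
  with 1 show ?thesis by (rule LIMSEQ_unique)
qed

lemma Eh_UN: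
  "finite Z \<Longrightarrow> (\<And>z. z \<in> Z \<Longrightarrow> A z \<in> sets borel) \<Longrightarrow> disjoint_family_on A Z \<Longrightarrow>
   Eh (\<Union>z\<in>Z. A z) F = (\<Sum>z\<in>Z. Eh (A z) F)"
proof (induction Z rule: finite_induct)
  case empty
  then show ?case by (simp add: Eh_empty)
next
  case (insert z Z)
  have "A z \<inter> (\<Union>z\<in>Z. A z) = {}" using insert.hyps insert.prems(2) by (auto simp: disjoint_family_on_def)
  moreover have "(\<Union>z\<in>Z. A z) \<in> sets borel" using insert by (intro sets.finite_UN) auto
  moreover have "disjoint_family_on A Z" using insert.prems(2) by (auto simp: disjoint_family_on_def)
  ultimately show ?case using insert by (simp add: Eh_Un)
qed

abbreviation spectral_measure :: "('a \<Rightarrow> complex) \<Rightarrow> real measure" where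
  "spectral_measure \<equiv> scalar_spectral_measure sphere_measure E"

lemma Eh_orthogonal:
  assumes "A \<in> sets borel" "B \<in> sets borel" "A \<inter> B = {}"
  shows "Eh A F \<bullet> Eh B G = 0"
  using assms by (simp add: Eh_sym Eh_Int[symmetric] Eh_empty)

lemma norm_sum_Eh:
  assumes fin: "finite Z" and A: "\<And>z. z \<in> Z \<Longrightarrow> A z \<in> sets borel" and d: "disjoint_family_on A Z"
  shows "(norm (\<Sum>z\<in>Z. scaleC_hs (c z) (Eh (A z) F)))\<^sup>2 = (\<Sum>z\<in>Z. (cmod (c z))\<^sup>2 * (norm (Eh (A z) F))\<^sup>2)"
proof -
  have "pairwise (\<lambda>i j. orthogonal (scaleC_hs (c i) (Eh (A i) F)) (scaleC_hs (c j) (Eh (A j) F))) Z"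
  proof (rule pairwiseI)
    fix i j assume ij: "i \<in> Z" "j \<in> Z" "i \<noteq> j"
    then have "A i \<inter> A j = {}" using d by (auto simp: disjoint_family_on_def)
    then show "orthogonal (scaleC_hs (c i) (Eh (A i) F)) (scaleC_hs (c j) (Eh (A j) F))"
      unfolding orthogonal_def Eh_scaleC[OF A[OF ij(1)], symmetric] Eh_scaleC[OF A[OF ij(2)], symmetric]
      by (intro Eh_orthogonal A ij)
  qed
  then show ?thesis
    by (subst norm_sum_Pythagorean[OF fin]) (simp_all add: norm_scaleC_hs power_mult_distrib)
qed

text \<open>\<open>measure_of\<close> takes the prescribed values only once countable additivity is
  checked; it follows from the convergence of the projections and from Pythagoras, as projections of
  disjoint sets have orthogonal ranges.\<close>

lemma emeasure_scalar_spectral_measure: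
  assumes f: "f \<in> L2 sphere_measure" and B: "B \<in> sets borel"
  shows "emeasure (spectral_measure f) B = ennreal ((norm (Eh B (abs_hs f)))\<^sup>2)"
proof -
  let ?m = "\<lambda>B. ennreal ((L2_norm sphere_measure (E B f))\<^sup>2)"
  have m: "?m B = ennreal ((norm (Eh B (abs_hs f)))\<^sup>2)" if "B \<in> sets borel" for B
    using that f by (simp add: Eh_abs_hs norm_abs_hs E_L2)
  have "countably_additive (sets borel) ?m"
    unfolding countably_additive_def
  proof (intro allI impI)
    fix A :: "nat \<Rightarrow> real set"
    assume A: "range A \<subseteq> sets borel" "disjoint_family A" and U: "\<Union> (range A) \<in> sets borel"
    have Ai: "A i \<in> sets borel" for i using A by auto
    have "(\<lambda>n. (norm (\<Sum>i<n. Eh (A i) (abs_hs f)))\<^sup>2) \<longlonglongrightarrow> (norm (Eh (\<Union>i. A i) (abs_hs f)))\<^sup>2"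
      by (intro tendsto_intros Eh_LIMSEQ A)
    moreover have "(norm (\<Sum>i<n. Eh (A i) (abs_hs f)))\<^sup>2 = (\<Sum>i<n. (norm (Eh (A i) (abs_hs f)))\<^sup>2)" for n
      using norm_sum_Eh[of "{..<n}" A "\<lambda>_. 1" "abs_hs f"] A
      by (auto simp: scaleC_1 Ai disjoint_family_on_def)
    ultimately have "(\<lambda>i. (norm (Eh (A i) (abs_hs f)))\<^sup>2) sums (norm (Eh (\<Union>i. A i) (abs_hs f)))\<^sup>2"
      by (simp add: sums_def)
    then have "(\<Sum>i. ennreal ((norm (Eh (A i) (abs_hs f)))\<^sup>2)) = ennreal ((norm (Eh (\<Union>i. A i) (abs_hs f)))\<^sup>2)"
      by (intro suminf_ennreal_eq) auto
    then show "(\<Sum>i. ?m (A i)) = ?m (\<Union> (range A))" by (simp only: m Ai U)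
  qed
  moreover have "positive (sets borel) ?m" by (simp add: positive_def m Eh_empty)
  moreover have "sigma_algebra UNIV (sets (borel :: real measure))" using sets.sigma_algebra_axioms[of "borel :: real measure"] by simp
  ultimately show ?thesis unfolding scalar_spectral_measure_def m[OF B, symmetric]
    by (intro emeasure_measure_of_sigma B)
qed

lemma sets_scalar_spectral_measure [simp, measurable_cong]:
  "sets (spectral_measure f) = sets borel"
  using sets.sigma_sets_eq[of "borel :: real measure"]
  by (simp add: scalar_spectral_measure_def sets_measure_of_conv)

lemma space_scalar_spectral_measure [simp]: "space (spectral_measure f) = UNIV"
  by (simp add: scalar_spectral_measure_def space_measure_of_conv)

section \<open>Spectral integrals on eigenvectors and under rotations\<close>

lemma simple_function_vimage_borel:
  "simple_function borel (s :: real \<Rightarrow> complex) \<Longrightarrow> s -` {z} \<in> sets borel"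
  using simple_functionD(2)[of borel s "{z}"] by simp

lemma finite_range_simple_function: "simple_function borel (s :: real \<Rightarrow> complex) \<Longrightarrow> finite (range s)"
  using simple_functionD(1)[of borel s] by simp

lemma sum_Eh_simple:
  fixes s :: "real \<Rightarrow> complex"
  assumes "simple_function borel s"
  shows "(\<Sum>z\<in>range s. Eh (s -` {z}) F) = F"
proof -
  have "(\<Union>z\<in>range s. s -` {z}) = UNIV" by auto
  then show ?thesis
    using Eh_UN[OF finite_range_simple_function[OF assms], of "\<lambda>z. s -` {z}" F] assms
    by (simp add: simple_function_vimage_borel disjoint_family_on_def Eh_UNIV disjoint_iff)
qed

lemma L2_norm_simple_spectral_sum:
  fixes s :: "real \<Rightarrow> complex"
  assumes s: "simple_function borel s" and f: "f \<in> L2 sphere_measure" and g: "g \<in> L2 sphere_measure"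
  shows "L2_norm sphere_measure (\<lambda>x. (\<Sum>z\<in>range s. z * E (s -` {z}) f x) - g x)
    = norm ((\<Sum>z\<in>range s. scaleC_hs z (Eh (s -` {z}) (abs_hs f))) - abs_hs g)"
  using simple_function_vimage_borel[OF s] f g
  by (simp add: norm_abs_hs_diff L2_sum L2_cmult E_L2 abs_hs_sum scaleC_abs_hs Eh_abs_hs)

text \<open>The isometry behind the spectral integral, applied to the simple function
  \<open>s - c\<close>: the projections of the level sets of \<open>s\<close> sum to the identity,
  so \<open>c\<close> times \<open>f\<close> is absorbed into the sum.\<close>

lemma nn_integral_simple_diff:
  fixes s :: "real \<Rightarrow> complex"
  assumes s: "simple_function borel s" and f: "f \<in> L2 sphere_measure"
  shows "(\<integral>\<^sup>+ r. ennreal ((cmod (s r - c))\<^sup>2) \<partial>spectral_measure f)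
     = ennreal ((norm ((\<Sum>z\<in>range s. scaleC_hs z (Eh (s -` {z}) (abs_hs f))) - scaleC_hs c (abs_hs f)))\<^sup>2)"
proof -
  let ?F = "abs_hs f" and ?m = "spectral_measure f"
  note [measurable] = simple_function_vimage_borel[OF s]
  have fin: "finite (range s)" by (rule finite_range_simple_function[OF s])
  have "(\<Sum>z\<in>range s. scaleC_hs z (Eh (s -` {z}) ?F)) - scaleC_hs c ?F
     = (\<Sum>z\<in>range s. scaleC_hs z (Eh (s -` {z}) ?F)) - scaleC_hs c (\<Sum>z\<in>range s. Eh (s -` {z}) ?F)"
    by (simp add: sum_Eh_simple[OF s])
  also have "scaleC_hs c (\<Sum>z\<in>range s. Eh (s -` {z}) ?F) = (\<Sum>z\<in>range s. scaleC_hs c (Eh (s -` {z}) ?F))"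
    by (rule linear_sum[OF bounded_linear.linear[OF bounded_linear_mult_hs[OF bounded_mult_const]]])
  also have "(\<Sum>z\<in>range s. scaleC_hs z (Eh (s -` {z}) ?F)) - \<dots> = (\<Sum>z\<in>range s. scaleC_hs (z - c) (Eh (s -` {z}) ?F))"
    unfolding sum_subtractf[symmetric]
  proof (rule sum.cong)
    fix z
    show "scaleC_hs z (Eh (s -` {z}) ?F) - scaleC_hs c (Eh (s -` {z}) ?F) = scaleC_hs (z - c) (Eh (s -` {z}) ?F)"
      by (cases "Eh (s -` {z}) ?F" rule: hs_cases)
        (simp add: scaleC_abs_hs abs_hs_diff[symmetric] L2_cmult left_diff_distrib)
  qed simp
  finally have "ennreal ((norm ((\<Sum>z\<in>range s. scaleC_hs z (Eh (s -` {z}) ?F)) - scaleC_hs c ?F))\<^sup>2)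
     = ennreal (\<Sum>z\<in>range s. (cmod (z - c))\<^sup>2 * (norm (Eh (s -` {z}) ?F))\<^sup>2)"
    by (subst norm_sum_Eh[OF fin, symmetric]) (auto simp: simple_function_vimage_borel[OF s] disjoint_family_on_def)
  also have "\<dots> = (\<Sum>z\<in>range s. ennreal ((cmod (z - c))\<^sup>2) * emeasure ?m (s -` {z}))"
    by (subst sum_ennreal[symmetric])
      (auto simp: emeasure_scalar_spectral_measure[OF f simple_function_vimage_borel[OF s]] ennreal_mult)
  also have "\<dots> = (\<Sum>z\<in>range s. \<integral>\<^sup>+ r. ennreal ((cmod (z - c))\<^sup>2) * indicator (s -` {z}) r \<partial>?m)"
    by (intro sum.cong refl nn_integral_cmult_indicator[symmetric]) simp
  also have "\<dots> = (\<integral>\<^sup>+ r. (\<Sum>z\<in>range s. ennreal ((cmod (z - c))\<^sup>2) * indicator (s -` {z}) r) \<partial>?m)"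
    by (rule nn_integral_sum[symmetric]) simp
  also have "\<dots> = (\<integral>\<^sup>+ r. ennreal ((cmod (s r - c))\<^sup>2) \<partial>?m)"
  proof (rule nn_integral_cong)
    fix r
    have "(\<Sum>z\<in>range s. ennreal ((cmod (z - c))\<^sup>2) * indicator (s -` {z}) r)
      = (\<Sum>z\<in>{s r}. ennreal ((cmod (z - c))\<^sup>2) * indicator (s -` {z}) r)"
      by (rule sum.mono_neutral_right[OF fin]) auto
    then show "(\<Sum>z\<in>range s. ennreal ((cmod (z - c))\<^sup>2) * indicator (s -` {z}) r) = ennreal ((cmod (s r - c))\<^sup>2)"
      by simp
  qed
  finally show ?thesis ..
qed

text \<open>The eigenvalue equation forces the integral of (r - l)^2 against the spectral measure of
  \<open>f\<close> to be zero. That measure therefore lives on the point \<open>l\<close>, and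
  \<open>f\<close> is fixed by the projection of that point.\<close>

lemma Eh_eigenvector:
  assumes "(f, \<lambda>x. of_real l * f x) \<in> spectral_integral sphere_measure E complex_of_real"
    and B: "B \<in> sets borel"
  shows "Eh B (abs_hs f) = (if l \<in> B then abs_hs f else 0)"
proof -
  let ?F = "abs_hs f" and ?m = "spectral_measure f"
  from assms(1) obtain s where f: "f \<in> L2 sphere_measure" and s: "\<And>n. simple_function borel (s n)"
    and a: "(\<lambda>n. \<integral>\<^sup>+ r. ennreal ((cmod (s n r - of_real r))\<^sup>2) \<partial>?m) \<longlonglongrightarrow> 0"
    and b0: "(\<lambda>n. L2_norm sphere_measure (\<lambda>x. (\<Sum>z\<in>range (s n). z * E (s n -` {z}) f x) - of_real l * f x)) \<longlonglongrightarrow> 0"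
    by (auto simp: spectral_integral_def)
  have sm [measurable]: "s n \<in> borel_measurable borel" for n by (rule borel_measurable_simple_function[OF s])
  have "(\<lambda>n. norm ((\<Sum>z\<in>range (s n). scaleC_hs z (Eh (s n -` {z}) ?F)) - scaleC_hs (of_real l) ?F)) \<longlonglongrightarrow> 0"
    using b0 by (simp add: L2_norm_simple_spectral_sum[OF s f L2_cmult[OF f]] scaleC_abs_hs f)
  then have "(\<lambda>n. ennreal ((norm ((\<Sum>z\<in>range (s n). scaleC_hs z (Eh (s n -` {z}) ?F)) - scaleC_hs (of_real l) ?F))\<^sup>2)) \<longlonglongrightarrow> ennreal (0\<^sup>2)"
    by (intro tendsto_ennrealI tendsto_power)
  then have b: "(\<lambda>n. \<integral>\<^sup>+ r. ennreal ((cmod (s n r - of_real l))\<^sup>2) \<partial>?m) \<longlonglongrightarrow> 0"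
    by (simp add: nn_integral_simple_diff[OF s f])
  \<comment> \<open>The same simple functions are close to r by definition of the integral and close
    to \<open>l\<close> by the eigenvalue equation and the isometry; compare both through (x + y)^2
    \<le> 2 x^2 + 2 y^2.\<close>
  have le: "(\<integral>\<^sup>+ r. ennreal ((r - l)\<^sup>2) \<partial>?m) \<le>
     2 * (\<integral>\<^sup>+ r. ennreal ((cmod (s n r - of_real r))\<^sup>2) \<partial>?m) + 2 * (\<integral>\<^sup>+ r. ennreal ((cmod (s n r - of_real l))\<^sup>2) \<partial>?m)" for n
  proof -
    have "(\<integral>\<^sup>+ r. ennreal ((r - l)\<^sup>2) \<partial>?m) \<le>
       (\<integral>\<^sup>+ r. 2 * ennreal ((cmod (s n r - of_real r))\<^sup>2) + 2 * ennreal ((cmod (s n r - of_real l))\<^sup>2) \<partial>?m)"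
    proof (rule nn_integral_mono)
      fix r
      have "\<bar>r - l\<bar> = cmod ((s n r - of_real l) - (s n r - of_real r))"
        by (simp flip: of_real_diff)
      also have "\<dots> \<le> cmod (s n r - of_real l) + cmod (s n r - of_real r)" by (rule norm_triangle_ineq4)
      finally have "(r - l)\<^sup>2 \<le> (cmod (s n r - of_real l) + cmod (s n r - of_real r))\<^sup>2"
        by (metis abs_le_square_iff abs_of_nonneg add_nonneg_nonneg norm_ge_zero)
      also have "\<dots> \<le> 2 * (cmod (s n r - of_real r))\<^sup>2 + 2 * (cmod (s n r - of_real l))\<^sup>2"
        using sum_squares_bound[of "cmod (s n r - of_real l)" "cmod (s n r - of_real r)"] by (simp add: power2_sum)
      finally have "ennreal ((r - l)\<^sup>2) \<le> ennreal (2 * (cmod (s n r - of_real r))\<^sup>2 + 2 * (cmod (s n r - of_real l))\<^sup>2)"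
        by (rule ennreal_leI)
      then show "ennreal ((r - l)\<^sup>2) \<le> 2 * ennreal ((cmod (s n r - of_real r))\<^sup>2) + 2 * ennreal ((cmod (s n r - of_real l))\<^sup>2)"
        by (simp add: ennreal_mult)
    qed
    then show ?thesis by (simp add: nn_integral_add nn_integral_cmult)
  qed
  have "(\<lambda>n. 2 * (\<integral>\<^sup>+ r. ennreal ((cmod (s n r - of_real r))\<^sup>2) \<partial>?m) + 2 * (\<integral>\<^sup>+ r. ennreal ((cmod (s n r - of_real l))\<^sup>2) \<partial>?m)) \<longlonglongrightarrow> 2 * 0 + 2 * 0"
    by (intro tendsto_add ennreal_tendsto_cmult a b) auto
  then have "(\<integral>\<^sup>+ r. ennreal ((r - l)\<^sup>2) \<partial>?m) \<le> 2 * 0 + 2 * 0"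
    by (rule LIMSEQ_le_const) (use le in auto)
  then have "(\<integral>\<^sup>+ r. ennreal ((r - l)\<^sup>2) \<partial>?m) = 0" by simp
  then have "AE r in ?m. r = l"
    by (subst (asm) nn_integral_0_iff_AE) auto
  moreover have "{r \<in> space ?m. \<not> r = l} = - {l}" by auto
  ultimately have "emeasure ?m (- {l}) = 0"
    by (subst (asm) AE_iff_measurable[where N = "- {l}"]) auto
  then have "Eh (- {l}) ?F = 0" by (simp add: emeasure_scalar_spectral_measure[OF f])
  moreover have "Eh ({l} \<union> - {l}) ?F = Eh {l} ?F + Eh (- {l}) ?F" by (rule Eh_Un) auto
  ultimately have 1: "Eh {l} ?F = ?F" by (simp add: Eh_UNIV)
  then have "Eh B ?F = Eh (B \<inter> {l}) ?F" by (subst 1[symmetric]) (simp add: Eh_Int B)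
  then show ?thesis by (auto simp: 1 Eh_empty)
qed

text \<open>The spectral measure sits at \<open>l\<close>, so the constant simple function with
  value there approximates the integrand with zero error. For a power of the Laplacian this gives
  the eigenvalue of an eigenpolynomial.\<close>

lemma spectral_integral_eigenvector:
  assumes f: "f \<in> L2 sphere_measure"
    and eig: "\<And>B. B \<in> sets borel \<Longrightarrow> Eh B (abs_hs f) = (if l \<in> B then abs_hs f else 0)"
  shows "(f, \<lambda>x. \<Phi> l * f x) \<in> spectral_integral sphere_measure E \<Phi>"
proof -
  let ?m = "spectral_measure f" and ?s = "\<lambda>_::real. \<Phi> l"
  have "emeasure ?m (- {l}) = 0"
    by (simp add: emeasure_scalar_spectral_measure[OF f] eig)
  then have "AE r in ?m. r = l"
    by (subst AE_iff_measurable[where N = "- {l}"]) auto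
  then have "(\<integral>\<^sup>+ r. ennreal ((cmod (\<Phi> l - \<Phi> r))\<^sup>2) \<partial>?m) = (\<integral>\<^sup>+ r. 0 \<partial>?m)"
    by (intro nn_integral_cong_AE) auto
  moreover have "L2_norm sphere_measure (\<lambda>x. (\<Sum>z\<in>range ?s. z * E (?s -` {z}) f x) - \<Phi> l * f x) = 0"
    by (subst L2_norm_simple_spectral_sum[OF _ f L2_cmult[OF f]])
      (auto simp: Eh_UNIV scaleC_abs_hs f)
  ultimately show ?thesis unfolding spectral_integral_def
    by (auto intro!: f L2_cmult exI[of _ "\<lambda>n. ?s"])
qed

text \<open>A pullback that is isometric and commutes with every projection preserves the spectral
  measure, so one approximating sequence of simple functions serves both pairs.\<close>

lemma spectral_integral_compose:
  assumes T: "orthogonal_transformation (T :: 'a \<Rightarrow> 'a)"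
    and comm: "\<And>B F. B \<in> sets borel \<Longrightarrow> Eh B (compose_hs T F) = compose_hs T (Eh B F)"
    and fg: "(f, g) \<in> spectral_integral sphere_measure E \<Phi>"
  shows "(\<lambda>x. f (T x), \<lambda>x. g (T x)) \<in> spectral_integral sphere_measure E \<Phi>"
proof -
  from fg obtain s where f: "f \<in> L2 sphere_measure" and g: "g \<in> L2 sphere_measure"
    and s: "\<And>n. simple_function borel (s n)"
    and a: "(\<lambda>n. \<integral>\<^sup>+ r. ennreal ((cmod (s n r - \<Phi> r))\<^sup>2) \<partial>spectral_measure f) \<longlonglongrightarrow> 0"
    and b: "(\<lambda>n. L2_norm sphere_measure (\<lambda>x. (\<Sum>z\<in>range (s n). z * E (s n -` {z}) f x) - g x)) \<longlonglongrightarrow> 0"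
    by (auto simp: spectral_integral_def)
  have fT: "(\<lambda>x. f (T x)) \<in> L2 sphere_measure" and gT: "(\<lambda>x. g (T x)) \<in> L2 sphere_measure"
    by (intro L2_compose[OF T] f g)+
  have "spectral_measure (\<lambda>x. f (T x)) = spectral_measure f"
    by (rule measure_eqI)
      (auto simp: emeasure_scalar_spectral_measure f fT compose_abs_hs[OF T f, symmetric] comm norm_compose_hs[OF T])
  moreover have "L2_norm sphere_measure (\<lambda>x. (\<Sum>z\<in>range (s n). z * E (s n -` {z}) (\<lambda>x. f (T x)) x) - g (T x))
      = L2_norm sphere_measure (\<lambda>x. (\<Sum>z\<in>range (s n). z * E (s n -` {z}) f x) - g x)" for n
  proof -
    interpret c: bounded_linear "compose_hs T" by (rule bounded_linear_compose_hs[OF T])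
    have "(\<Sum>z\<in>range (s n). scaleC_hs z (Eh (s n -` {z}) (abs_hs (\<lambda>x. f (T x))))) - abs_hs (\<lambda>x. g (T x))
       = compose_hs T ((\<Sum>z\<in>range (s n). scaleC_hs z (Eh (s n -` {z}) (abs_hs f))) - abs_hs g)"
      unfolding compose_abs_hs[OF T f, symmetric] compose_abs_hs[OF T g, symmetric]
      by (simp add: c.diff c.sum compose_hs_scaleC[OF T] comm[OF simple_function_vimage_borel[OF s]])
    then show ?thesis
      by (simp only: L2_norm_simple_spectral_sum[OF s fT gT] L2_norm_simple_spectral_sum[OF s f g] norm_compose_hs[OF T])
  qed
  ultimately show ?thesis unfolding spectral_integral_def using fT gT s a b
    by (intro CollectI case_prodI conjI exI[of _ s] allI) simp_all
qed

end

section \<open>Rotations commute with the resolution of the Laplacian\<close>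

locale sphere_spectral_resolution =
  fixes E :: "real set \<Rightarrow> ('a::euclidean_space \<Rightarrow> complex) \<Rightarrow> ('a \<Rightarrow> complex)"
  assumes resolution: "spectral_resolution sphere_measure neg_laplacian E"
    and dim: "2 \<le> DIM('a)"

sublocale sphere_spectral_resolution \<subseteq> sphere_pvm
  using resolution by unfold_locales (simp add: spectral_resolution_def)

context sphere_spectral_resolution
begin

lemma Eh_eigenpoly:
  assumes f: "eigenpoly l f" and B: "B \<in> sets borel"
  shows "Eh B (abs_hs f) = (if l \<in> B then abs_hs f else 0)"
proof -
  have "(f, \<lambda>x. of_real l * f x) \<in> neg_laplacian" by (rule neg_laplacian_eigenpoly[OF f])
  then show ?thesis
    using resolution by (intro Eh_eigenvector[OF _ B]) (simp only: spectral_resolution_def)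
qed

lemma laplacian_power_eigenpoly:
  assumes "eigenpoly l f"
  shows "(f, \<lambda>x. of_real (l powr a) * f x) \<in> laplacian_power E a"
  unfolding laplacian_power_def
  by (rule spectral_integral_eigenvector)
    (use assms in \<open>auto simp: Eh_eigenpoly eigenpoly_def intro: L2_spoly\<close>)

text \<open>On an eigenpolynomial each projection is 0 or the identity, according to its eigenvalue
  alone, and rotating keeps the eigenvalue. The decomposition into eigenpolynomials gives the
  rest.\<close>

lemma Eh_compose_hpoly:
  assumes T: "orthogonal_transformation (T :: 'a \<Rightarrow> 'a)" and f: "hpoly k f" and B: "B \<in> sets borel"
  shows "Eh B (compose_hs T (abs_hs f)) = compose_hs T (Eh B (abs_hs f))"
proof -
  obtain \<phi> where \<phi>: "\<And>j. j \<le> k \<Longrightarrow> eigenpoly (sphere_eigenvalue DIM('a) j) (\<phi> j)"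
    and sum: "\<And>x. norm x = 1 \<Longrightarrow> f x = (\<Sum>j\<le>k. \<phi> j x)"
    using hpoly_eigenpoly_decomposition[OF dim f] by blast
  have L: "\<phi> j \<in> L2 sphere_measure" if "j \<le> k" for j using \<phi>[OF that] by (simp add: eigenpoly_def L2_spoly)
  have "abs_hs f = abs_hs (\<lambda>x. \<Sum>j\<le>k. \<phi> j x)"
    by (rule abs_hs_cong) (auto intro!: L2_sum L L2_spoly[OF spoly_hpoly[OF f]] simp: sum)
  also have "\<dots> = (\<Sum>j\<le>k. abs_hs (\<phi> j))" by (rule abs_hs_sum) (simp add: L)
  finally have fs: "abs_hs f = (\<Sum>j\<le>k. abs_hs (\<phi> j))" .
  interpret c: bounded_linear "compose_hs T" by (rule bounded_linear_compose_hs[OF T])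
  have Es: "Eh B (\<Sum>j\<in>I. F j) = (\<Sum>j\<in>I. Eh B (F j))" if "finite I" for I :: "nat set" and F
    using that
  proof induction
    case empty
    then show ?case using Eh_scaleC[OF B, of 0 0] by (simp add: scaleC_0)
  qed (simp add: Eh_add[OF B])
  have "Eh B (compose_hs T (abs_hs (\<phi> j))) = compose_hs T (Eh B (abs_hs (\<phi> j)))" if "j \<le> k" for j
    using Eh_eigenpoly[OF \<phi>[OF that] B] Eh_eigenpoly[OF eigenpoly_compose[OF T \<phi>[OF that]] B]
    by (simp add: compose_abs_hs[OF T L[OF that]] c.zero)
  then show ?thesis by (simp add: fs c.sum Es)
qed

lemma Eh_compose_spoly:
  assumes T: "orthogonal_transformation (T :: 'a \<Rightarrow> 'a)" and B: "B \<in> sets borel"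
  shows "spoly f \<Longrightarrow> Eh B (compose_hs T (abs_hs f)) = compose_hs T (Eh B (abs_hs f))"
proof (induction rule: spoly.induct)
  case (spoly_hpoly k f)
  then show ?case by (rule Eh_compose_hpoly[OF T _ B])
next
  case (spoly_add f g)
  then show ?case by (simp add: abs_hs_add L2_spoly compose_hs_add[OF T] Eh_add[OF B])
qed

text \<open>Tested against a polynomial, both the symmetric projection and the rotation move to the
  polynomial side, where commutation with the inverse rotation is known; polynomials determine a
  vector.\<close>

lemma Eh_compose:
  assumes T: "orthogonal_transformation (T :: 'a \<Rightarrow> 'a)" and B: "B \<in> sets borel"
  shows "Eh B (compose_hs T F) = compose_hs T (Eh B F)"
proof (rule hs_eqI_spoly)
  fix p :: "'a \<Rightarrow> complex" assume p: "spoly p"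
  define S where "S = inv T"
  have S: "orthogonal_transformation S" unfolding S_def by (rule orthogonal_transformation_inv[OF T])
  have ST: "S (T x) = x" for x by (simp add: S_def orthogonal_transformation_inj[OF T])
  have id: "compose_hs T (compose_hs S G) = G" for G
    by (cases G rule: hs_cases) (simp add: compose_abs_hs S T L2_compose ST)
  have adj: "G \<bullet> compose_hs T H = compose_hs S G \<bullet> H" for G H
    using inner_compose_hs[OF T, of "compose_hs S G" H] by (simp add: id)
  have "abs_hs p \<bullet> Eh B (compose_hs T F) = compose_hs S (Eh B (abs_hs p)) \<bullet> F"
    by (simp add: Eh_sym[OF B, symmetric] adj)
  also have "\<dots> = Eh B (compose_hs S (abs_hs p)) \<bullet> F" by (simp add: Eh_compose_spoly[OF S B p])
  also have "\<dots> = abs_hs p \<bullet> compose_hs T (Eh B F)" by (simp add: Eh_sym[OF B] adj)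
  finally show "abs_hs p \<bullet> Eh B (compose_hs T F) = abs_hs p \<bullet> compose_hs T (Eh B F)" .
qed

lemma laplacian_power_compose:
  "orthogonal_transformation (T :: 'a \<Rightarrow> 'a) \<Longrightarrow> (f, g) \<in> laplacian_power E a \<Longrightarrow>
   (\<lambda>x. f (T x), \<lambda>x. g (T x)) \<in> laplacian_power E a"
  unfolding laplacian_power_def by (rule spectral_integral_compose[OF _ Eh_compose])

end

section \<open>Rotation generators and equatorial harmonics\<close>

definition orthonormal :: "'a::euclidean_space \<Rightarrow> 'a \<Rightarrow> bool" where
  "orthonormal a b \<longleftrightarrow> norm a = 1 \<and> norm b = 1 \<and> a \<bullet> b = 0"

lemma orthonormalD:
  assumes "orthonormal a b"
  shows "a \<bullet> a = 1" "b \<bullet> b = 1" "a \<bullet> b = 0" "b \<bullet> a = 0"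
  using assms by (auto simp: orthonormal_def norm_eq_1 inner_commute)

lemma orthonormal_commute: "orthonormal a b \<longleftrightarrow> orthonormal b a"
  by (auto simp: orthonormal_def inner_commute)

text \<open>Written as the identity plus a correction in the plane, so that no basis of the
  orthogonal complement has to be chosen. Swapping \<open>a\<close> and \<open>b\<close> reverses
  the angle.\<close>

definition rotation :: "'a::euclidean_space \<Rightarrow> 'a \<Rightarrow> real \<Rightarrow> 'a \<Rightarrow> 'a" where
  "rotation a b s x = x + ((cos s - 1) * (x \<bullet> a) - sin s * (x \<bullet> b)) *\<^sub>R a
     + (sin s * (x \<bullet> a) + (cos s - 1) * (x \<bullet> b)) *\<^sub>R b"

lemma rotation_inner:
  assumes "orthonormal a b"
  shows "rotation a b s x \<bullet> a = cos s * (x \<bullet> a) - sin s * (x \<bullet> b)"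
    and "rotation a b s x \<bullet> b = sin s * (x \<bullet> a) + cos s * (x \<bullet> b)"
  by (simp_all add: rotation_def inner_add_left orthonormalD[OF assms] algebra_simps)

lemma orthogonal_transformation_rotation:
  assumes "orthonormal a b"
  shows "orthogonal_transformation (rotation a b s)"
  unfolding orthogonal_transformation
proof (intro conjI allI)
  show "linear (rotation a b s)"
    by (rule linearI) (simp_all add: rotation_def inner_add_left algebra_simps)
  fix x
  define u v where "u = x \<bullet> a" and "v = x \<bullet> b"
  define \<alpha> \<beta> where "\<alpha> = (cos s - 1) * u - sin s * v" and "\<beta> = sin s * u + (cos s - 1) * v"
  have "rotation a b s x \<bullet> rotation a b s x = x \<bullet> x + 2 * \<alpha> * u + 2 * \<beta> * v + \<alpha>\<^sup>2 + \<beta>\<^sup>2"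
    unfolding rotation_def u_def[symmetric] v_def[symmetric] \<alpha>_def[symmetric] \<beta>_def[symmetric]
    by (simp add: inner_add_left inner_add_right orthonormalD[OF assms] power2_eq_square
        u_def v_def inner_commute[of a x] inner_commute[of b x] algebra_simps)
  also have "\<dots> = x \<bullet> x"
    using sin_cos_squared_add[of s] unfolding \<alpha>_def \<beta>_def by algebra
  finally show "norm (rotation a b s x) = norm x" by (simp add: norm_eq_sqrt_inner)
qed

lemma norm_rotation: "orthonormal a b \<Longrightarrow> norm (rotation a b s x) = norm x"
  by (rule orthogonal_transformation_norm[OF orthogonal_transformation_rotation])

lemma rotation_0: "rotation a b 0 x = x"
  by (simp add: rotation_def)

lemma rotation_inverse:
  assumes "orthonormal a b"
  shows "rotation a b s (rotation b a s x) = x"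
proof -
  have ba: "orthonormal b a" using assms by (simp add: orthonormal_commute)
  have "rotation a b s (rotation b a s x) = rotation b a s x
     + ((cos s - 1) * (sin s * (x \<bullet> b) + cos s * (x \<bullet> a)) - sin s * (cos s * (x \<bullet> b) - sin s * (x \<bullet> a))) *\<^sub>R a
     + (sin s * (sin s * (x \<bullet> b) + cos s * (x \<bullet> a)) + (cos s - 1) * (cos s * (x \<bullet> b) - sin s * (x \<bullet> a))) *\<^sub>R b"
    unfolding rotation_def[of a b] rotation_inner[OF ba] ..
  also have "(cos s - 1) * (sin s * (x \<bullet> b) + cos s * (x \<bullet> a)) - sin s * (cos s * (x \<bullet> b) - sin s * (x \<bullet> a))
     = x \<bullet> a - sin s * (x \<bullet> b) - cos s * (x \<bullet> a)"
    using sin_cos_squared_add[of s] by algebra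
  also have "sin s * (sin s * (x \<bullet> b) + cos s * (x \<bullet> a)) + (cos s - 1) * (cos s * (x \<bullet> b) - sin s * (x \<bullet> a))
     = x \<bullet> b + sin s * (x \<bullet> a) - cos s * (x \<bullet> b)"
    using sin_cos_squared_add[of s] by algebra
  finally show ?thesis by (simp add: rotation_def algebra_simps)
qed

lemma rotation_has_vector_derivative:
  assumes "orthonormal a b"
  shows "((\<lambda>s. rotation a b s x) has_vector_derivative
     (rotation a b s x \<bullet> a) *\<^sub>R b - (rotation a b s x \<bullet> b) *\<^sub>R a) (at s)"
  unfolding rotation_inner[OF assms] unfolding rotation_def
  by (auto intro!: derivative_eq_intros simp: algebra_simps has_vector_derivative_def)

text \<open>Mean value inequality along the orbit of the rotation, which stays on the compact sphere
  where the first derivatives of the radial extension are bounded. The constant does not depend on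
  the plane, so one \<open>M\<close> later serves all three planes.\<close>

lemma sphere_smooth_rotation_lipschitz:
  fixes f :: "'a::euclidean_space \<Rightarrow> 'b::real_normed_vector"
  assumes f: "sphere_smooth f"
  obtains M where "0 \<le> M"
    and "\<And>a b s x. orthonormal a b \<Longrightarrow> norm x = 1 \<Longrightarrow> norm (f (rotation a b s x) - f x) \<le> M * \<bar>s\<bar>"
proof -
  define g where "g y = f (sgn y)" for y
  let ?D = "\<lambda>x. frechet_derivative g (at x)"
  have "Ck_on (Suc 0) (- {0}) g" using f by (auto simp: sphere_smooth_def g_def[abs_def])
  then have gd: "g differentiable_on - {0}" and cont: "\<And>e. e \<in> Basis \<Longrightarrow> continuous_on (- {0}) (\<lambda>x. ?D x e)"
    by auto
  have D: "(g has_derivative ?D x) (at x)" if "x \<noteq> 0" for x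
    using gd that by (simp add: differentiable_on_eq_differentiable_at open_Compl frechet_derivative_works)
  have "\<exists>K. \<forall>x. norm x = 1 \<longrightarrow> norm (?D x e) \<le> K" if "e \<in> Basis" for e
  proof -
    have "continuous_on (sphere 0 1) (\<lambda>x. ?D x e)" by (rule continuous_on_subset[OF cont[OF that]]) auto
    then have "bounded ((\<lambda>x. ?D x e) ` sphere 0 1)"
      by (intro compact_imp_bounded compact_continuous_image) auto
    then show ?thesis by (force simp: bounded_iff)
  qed
  then obtain K where K: "\<And>e x. e \<in> Basis \<Longrightarrow> norm x = 1 \<Longrightarrow> norm (?D x e) \<le> K e" by metis
  have K0: "0 \<le> K e" if "e \<in> Basis" for e
    by (rule order_trans[OF norm_ge_zero K[OF that norm_Basis[OF that]]])
  \<comment> \<open>The orbit has speed at most 2 (a crude triangle inequality), hence each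
    coordinate of its velocity does too.\<close>
  define M where "M = (\<Sum>e\<in>Basis. 2 * K e)"
  show thesis
  proof (rule that)
    show "0 \<le> M" unfolding M_def using K0 by (intro sum_nonneg) auto
  next
    fix a b x :: 'a and s :: real assume ab: "orthonormal a b" and x: "norm x = 1"
    let ?r = "\<lambda>s. rotation a b s x" and ?v = "\<lambda>s. (rotation a b s x \<bullet> a) *\<^sub>R b - (rotation a b s x \<bullet> b) *\<^sub>R a"
    have r1: "norm (?r s) = 1" for s using x by (simp add: norm_rotation[OF ab])
    have v2: "norm (?v s) \<le> 2" for s
    proof -
      have "norm (?v s) \<le> \<bar>?r s \<bullet> a\<bar> * norm b + \<bar>?r s \<bullet> b\<bar> * norm a"
        using norm_triangle_ineq4[of "(?r s \<bullet> a) *\<^sub>R b" "(?r s \<bullet> b) *\<^sub>R a"] by simp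
      also have "\<dots> \<le> 2"
        using Cauchy_Schwarz_ineq2[of "?r s" a] Cauchy_Schwarz_ineq2[of "?r s" b] ab r1[of s]
        by (simp add: orthonormal_def)
      finally show ?thesis .
    qed
    have der: "((\<lambda>s. g (?r s)) has_derivative (\<lambda>h. h *\<^sub>R ?D (?r s) (?v s))) (at s)" for s
    proof -
      have r0: "?r s \<noteq> 0" using r1[of s] by auto
      have "((\<lambda>s. g (?r s)) has_derivative (\<lambda>h. ?D (?r s) (h *\<^sub>R ?v s))) (at s)"
        using rotation_has_vector_derivative[OF ab, of x s, unfolded has_vector_derivative_def] D[OF r0]
        by (rule has_derivative_compose)
      then show ?thesis by (simp add: linear_cmul[OF has_derivative_linear[OF D[OF r0]]])
    qed
    have bd: "norm (?D (?r s) (?v s)) \<le> M" for s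
    proof -
      have r0: "?r s \<noteq> 0" using r1[of s] by auto
      have lin: "linear (?D (?r s))" by (rule has_derivative_linear[OF D[OF r0]])
      have exp: "v = (\<Sum>e\<in>Basis. (v \<bullet> e) *\<^sub>R e)" for v :: 'a by (simp add: euclidean_representation)
      have le: "norm (?D y v) \<le> (\<Sum>e\<in>Basis. \<bar>v \<bullet> e\<bar> * norm (?D y e))" if "linear (?D y)" for y v
      proof -
        have "?D y v = (\<Sum>e\<in>Basis. (v \<bullet> e) *\<^sub>R ?D y e)"
          by (subst exp) (simp only: linear_sum[OF that] linear_cmul[OF that])
        then show ?thesis by (auto intro: order_trans[OF norm_sum])
      qed
      have "norm (?D (?r s) (?v s)) \<le> (\<Sum>e\<in>Basis. \<bar>?v s \<bullet> e\<bar> * norm (?D (?r s) e))"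
        by (rule le[OF lin])
      also have "\<dots> \<le> M" unfolding M_def
      proof (rule sum_mono)
        fix e :: 'a assume e: "e \<in> Basis"
        have 1: "\<bar>?v s \<bullet> e\<bar> \<le> 2" using Basis_le_norm[OF e, of "?v s"] v2[of s] by (rule order_trans)
        have 2: "norm (?D (?r s) e) \<le> K e" by (rule K[OF e r1[of s]])
        show "\<bar>?v s \<bullet> e\<bar> * norm (?D (?r s) e) \<le> 2 * K e" by (rule mult_mono[OF 1 2]) simp_all
      qed
      finally show ?thesis .
    qed
    have "norm (g (?r s) - g (?r 0)) \<le> M * norm (s - 0)"
    proof (rule differentiable_bound[where S = UNIV and f' = "\<lambda>s h. h *\<^sub>R ?D (?r s) (?v s)"])
      show "onorm (\<lambda>h. h *\<^sub>R ?D (?r s) (?v s)) \<le> M" for s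
      proof (rule order_trans[OF _ bd[of s]], rule onorm_le)
        show "norm (h *\<^sub>R ?D (?r s) (?v s)) \<le> norm (?D (?r s) (?v s)) * norm h" for h by simp
      qed
    qed (auto intro: der)
    moreover have "g y = f y" if "norm y = 1" for y using that by (simp add: g_def sgn_div_norm)
    ultimately show "norm (f (rotation a b s x) - f x) \<le> M * \<bar>s\<bar>"
      using r1[of s] x by (simp add: rotation_0)
  qed
qed

section \<open>Infinitesimal rotations and weak commutators\<close>

definition Lrot :: "'a::euclidean_space \<Rightarrow> 'a \<Rightarrow> ('a \<Rightarrow> complex) \<Rightarrow> 'a \<Rightarrow> complex" where
  "Lrot a b h x = of_real (x \<bullet> a) * ddir b h x - of_real (x \<bullet> b) * ddir a h x"

lemma spoly_Lrot: "spoly h \<Longrightarrow> spoly (Lrot a b h)"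
  unfolding Lrot_def by (intro spoly_diff spoly_mult spoly_inner spoly_ddir)

text \<open>The difference quotient at angle 1 / (k + 1). Unlike \<open>Lrot\<close> it is defined
  on all of the Hilbert space, in particular on evolved states.\<close>

definition rot_quotient :: "'a::euclidean_space \<Rightarrow> 'a \<Rightarrow> nat \<Rightarrow> 'a hs \<Rightarrow> 'a hs" where
  "rot_quotient a b k F = real (Suc k) *\<^sub>R (compose_hs (rotation a b (1 / real (Suc k))) F - F)"

lemma rotation_derivative_0:
  assumes ab: "orthonormal a b" and h: "spoly h"
  shows "((\<lambda>s. h (rotation a b s x)) has_vector_derivative Lrot a b h x) (at 0)"
proof -
  let ?v = "(x \<bullet> a) *\<^sub>R b - (x \<bullet> b) *\<^sub>R a"
  have "((\<lambda>s. rotation a b s x) has_derivative (\<lambda>s. s *\<^sub>R ?v)) (at 0)"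
    using rotation_has_vector_derivative[OF ab, of x 0] by (simp add: has_vector_derivative_def rotation_0)
  moreover have "(h has_derivative (\<lambda>v. ddir v h x)) (at (rotation a b 0 x))"
    using spoly_has_derivative[OF h, of x] by (simp add: rotation_0)
  ultimately have "((\<lambda>s. h (rotation a b s x)) has_derivative (\<lambda>s. ddir (s *\<^sub>R ?v) h x)) (at 0)"
    by (rule has_derivative_compose)
  moreover have "ddir (s *\<^sub>R ?v) h x = s *\<^sub>R Lrot a b h x" for s
    by (simp add: linear_cmul[OF linear_ddir[OF h]] linear_diff[OF linear_ddir[OF h]] Lrot_def scaleR_conv_of_real)
  ultimately show ?thesis by (simp add: has_vector_derivative_def)
qed

text \<open>Pointwise convergence, dominated by means of the Lipschitz constant of \<open>h\<close>
  along rotations, which also bounds the limit \<open>Lrot a b h\<close>.\<close>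

lemma rot_quotient_limit:
  fixes h :: "'a::euclidean_space \<Rightarrow> complex"
  assumes ab: "orthonormal a b" and h: "spoly h"
  shows "(\<lambda>k. rot_quotient a b k (abs_hs h)) \<longlonglongrightarrow> abs_hs (Lrot a b h)"
proof -
  define q where "q k x = of_real (real (Suc k)) * (h (rotation a b (1 / real (Suc k)) x) - h x)" for k x
  note T = orthogonal_transformation_rotation[OF ab]
  have hL: "h \<in> L2 sphere_measure" and hTL: "(\<lambda>x. h (rotation a b s x)) \<in> L2 sphere_measure" for s
    by (intro L2_spoly h spoly_compose[OF T])+
  have qL: "q k \<in> L2 sphere_measure" for k unfolding q_def by (intro L2_cmult L2_diff hL hTL)
  have LL: "Lrot a b h \<in> L2 sphere_measure" by (intro L2_spoly spoly_Lrot h)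
  have qeq: "rot_quotient a b k (abs_hs h) = abs_hs (q k)" for k
    unfolding rot_quotient_def q_def compose_abs_hs[OF T hL] abs_hs_diff[OF hTL hL, symmetric]
    by (rule abs_hs_scaleR[symmetric]) (intro L2_diff hL hTL)
  obtain M where M: "0 \<le> M" "\<And>s x. norm x = 1 \<Longrightarrow> cmod (h (rotation a b s x) - h x) \<le> M * \<bar>s\<bar>"
    using sphere_smooth_rotation_lipschitz[OF sphere_smooth_spoly[OF h]] ab by metis
  have lim: "(\<lambda>k. q k x) \<longlonglongrightarrow> Lrot a b h x" for x
  proof -
    have "((\<lambda>s. (h (rotation a b s x) - h x) /\<^sub>R s) \<longlongrightarrow> Lrot a b h x) (at 0)"
      using rotation_derivative_0[OF ab h, of x]
      by (simp add: has_vector_derivative_def has_derivative_iff_difference_quotient rotation_0)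
    moreover have "filterlim (\<lambda>k. 1 / real (Suc k)) (at 0) sequentially"
      by (rule filterlim_atI) (use LIMSEQ_Suc[OF lim_1_over_n] in auto)
    ultimately have "(\<lambda>k. (h (rotation a b (1 / real (Suc k)) x) - h x) /\<^sub>R (1 / real (Suc k))) \<longlonglongrightarrow> Lrot a b h x"
      by (rule filterlim_compose)
    then show ?thesis by (simp add: q_def scaleR_conv_of_real)
  qed
  have qM: "cmod (q k x) \<le> M" if "norm x = 1" for k x
  proof -
    have "cmod (q k x) = real (Suc k) * cmod (h (rotation a b (1 / real (Suc k)) x) - h x)"
      unfolding q_def by (simp add: norm_mult del: of_nat_Suc)
    also have "\<dots> \<le> real (Suc k) * (M * \<bar>1 / real (Suc k)\<bar>)" by (intro mult_left_mono M that) auto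
    finally show ?thesis by simp
  qed
  have LM: "cmod (Lrot a b h x) \<le> M" if "norm x = 1" for x
    by (rule LIMSEQ_le_const2[OF tendsto_norm[OF lim]]) (use qM[OF that] in auto)
  show ?thesis
    unfolding qeq
  proof (rule abs_hs_tendsto_dominated[OF LL qL _ lim])
    show "integrable sphere_measure (\<lambda>x::'a. (2 * M)\<^sup>2)" by simp
    fix k and x :: 'a assume "norm x = 1"
    then have "cmod (q k x - Lrot a b h x) \<le> 2 * M"
      using qM[of x k] LM[of x] norm_triangle_ineq4[of "q k x" "Lrot a b h x"] by simp
    then show "(cmod (q k x - Lrot a b h x))\<^sup>2 \<le> (2 * M)\<^sup>2" by (intro power_mono) auto
  qed
qed

lemma compose_rotation_adjoint:
  assumes ab: "orthonormal a b"
  shows "compose_hs (rotation a b s) F \<bullet> G = F \<bullet> compose_hs (rotation b a s) G"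
proof -
  have ba: "orthonormal b a" using ab by (simp add: orthonormal_commute)
  note T = orthogonal_transformation_rotation[OF ab] and S = orthogonal_transformation_rotation[OF ba]
  have "compose_hs (rotation a b s) (compose_hs (rotation b a s) G) = G"
    by (cases G rule: hs_cases) (simp add: compose_abs_hs T S L2_compose rotation_inverse[OF ba])
  then show ?thesis using inner_compose_hs[OF T, of s F "compose_hs (rotation b a s) G"] by simp
qed

text \<open>The adjoint of a rotation is its inverse, that is the rotation with \<open>a\<close> and
  \<open>b\<close> swapped. The minus sign of skew symmetry is thus carried by the order of the
  pair.\<close>

lemma rot_quotient_adjoint:
  "orthonormal a b \<Longrightarrow> rot_quotient a b k F \<bullet> G = F \<bullet> rot_quotient b a k G"
  by (simp add: rot_quotient_def compose_rotation_adjoint inner_diff_left inner_diff_right)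

text \<open>Dividing a commutator of size O(s) with the rotation of angle s by s gives a bounded
  one. Before the limit, the quotient acting on \<open>W (abs_hs u)\<close> is moved to the
  polynomial \<open>h\<close>, where it converges to \<open>Lrot b a h\<close>.\<close>

lemma weak_commutator_bound:
  assumes ab: "orthonormal a b" and u: "spoly u" and h: "spoly h" and W: "bounded_linear W"
    and key: "\<And>s. norm (compose_hs (rotation a b s) (W (abs_hs u)) - W (compose_hs (rotation a b s) (abs_hs u)))
        \<le> M * \<bar>s\<bar> * norm (abs_hs u)"
  shows "\<bar>W (abs_hs u) \<bullet> abs_hs (Lrot b a h) - W (abs_hs (Lrot a b u)) \<bullet> abs_hs h\<bar> \<le> M * norm (abs_hs u) * norm (abs_hs h)"
proof -
  interpret W: bounded_linear W by (rule W)
  have ba: "orthonormal b a" using ab by (simp add: orthonormal_commute)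
  have bd: "\<bar>W (abs_hs u) \<bullet> rot_quotient b a k (abs_hs h) - W (rot_quotient a b k (abs_hs u)) \<bullet> abs_hs h\<bar>
      \<le> M * norm (abs_hs u) * norm (abs_hs h)" for k
  proof -
    let ?T = "rotation a b (1 / real (Suc k))"
    have "W (abs_hs u) \<bullet> rot_quotient b a k (abs_hs h) - W (rot_quotient a b k (abs_hs u)) \<bullet> abs_hs h
       = (rot_quotient a b k (W (abs_hs u)) - W (rot_quotient a b k (abs_hs u))) \<bullet> abs_hs h"
      by (simp add: rot_quotient_adjoint[OF ab] inner_diff_left)
    also have "rot_quotient a b k (W (abs_hs u)) - W (rot_quotient a b k (abs_hs u))
       = real (Suc k) *\<^sub>R (compose_hs ?T (W (abs_hs u)) - W (compose_hs ?T (abs_hs u)))"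
      unfolding rot_quotient_def W.scaleR W.diff by (simp add: scaleR_diff_right[symmetric] del: of_nat_Suc)
    also have "\<bar>\<dots> \<bullet> abs_hs h\<bar> \<le> norm \<dots> * norm (abs_hs h)" by (rule Cauchy_Schwarz_ineq2)
    also have "\<dots> \<le> M * norm (abs_hs u) * norm (abs_hs h)"
    proof (rule mult_right_mono)
      let ?X = "compose_hs ?T (W (abs_hs u)) - W (compose_hs ?T (abs_hs u))"
      have "norm (real (Suc k) *\<^sub>R ?X) = real (Suc k) * norm ?X" by (simp del: of_nat_Suc)
      also have "\<dots> \<le> real (Suc k) * (M * \<bar>1 / real (Suc k)\<bar> * norm (abs_hs u))"
        by (rule mult_left_mono[OF key]) simp
      also have "\<dots> = M * norm (abs_hs u)" by (simp del: of_nat_Suc)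
      finally show "norm (real (Suc k) *\<^sub>R ?X) \<le> M * norm (abs_hs u)" .
    qed simp
    finally show ?thesis .
  qed
  have "(\<lambda>k. \<bar>W (abs_hs u) \<bullet> rot_quotient b a k (abs_hs h) - W (rot_quotient a b k (abs_hs u)) \<bullet> abs_hs h\<bar>)
     \<longlonglongrightarrow> \<bar>W (abs_hs u) \<bullet> abs_hs (Lrot b a h) - W (abs_hs (Lrot a b u)) \<bullet> abs_hs h\<bar>"
    by (intro tendsto_intros W.tendsto rot_quotient_limit ab ba u h)
  then show ?thesis by (rule LIMSEQ_le_const2) (use bd in auto)
qed

text \<open>The previous bound for \<open>W\<close> the identity, which commutes with rotations, so
  that \<open>M = 0\<close>.\<close>

lemma Lrot_skew:
  assumes ab: "orthonormal a b" and u: "spoly u" and h: "spoly h"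
  shows "abs_hs (Lrot a b u) \<bullet> abs_hs h = abs_hs u \<bullet> abs_hs (Lrot b a h)"
  using weak_commutator_bound[OF ab u h bounded_linear_ident, of 0] by simp

lemma lform_eq: "lform p q x = of_real (x \<bullet> p) + \<i> * of_real (x \<bullet> q)"
  by (simp add: lform_expand inner_commute)

lemma bounded_mult_inner: "norm w \<le> 1 \<Longrightarrow> bounded_mult (\<lambda>x. of_real (x \<bullet> w)) (norm w)"
proof -
  assume "norm w \<le> 1"
  have "(\<lambda>x. of_real (x \<bullet> w) :: complex) \<in> borel_measurable sphere_measure"
    using L2_measurable[OF L2_spoly[OF spoly_inner]] .
  moreover have "cmod (of_real (x \<bullet> w)) \<le> norm w" if "norm x = 1" for x :: 'a
    using Cauchy_Schwarz_ineq2[of x w] that by simp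
  ultimately show ?thesis by (simp add: bounded_mult_def)
qed

section \<open>Equatorial harmonics and the transversal coordinate\<close>

locale equatorial =
  fixes p q w :: "'a::euclidean_space" and n :: nat
  assumes pq: "orthonormal p q" and pw: "orthonormal p w" and qw: "orthonormal q w"
begin

abbreviation "l \<equiv> lform p q"
abbreviation "u \<equiv> (\<lambda>x. l x ^ n)"

lemma l_pqw: "l p = 1" "l q = \<i>" "l w = 0"
  using orthonormalD[OF pq] orthonormalD[OF pw] orthonormalD[OF qw]
  by (simp_all add: lform_eq inner_commute)

text \<open>The factor \<open>n\<close> makes the truncated exponent harmless at
  \<open>n = 0\<close>.\<close>

lemma power_pred: "of_nat n * (l x * l x ^ (n - 1)) = of_nat n * l x ^ n"
  by (cases n) auto

lemma Lrot_pq: "Lrot p q u x = \<i> * of_nat n * u x"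
proof -
  have "Lrot p q u x = (of_real (x \<bullet> p) * \<i> - of_real (x \<bullet> q)) * (of_nat n * l x ^ (n - 1))"
    by (simp add: Lrot_def ddir_lform_power l_pqw algebra_simps)
  also have "of_real (x \<bullet> p) * \<i> - of_real (x \<bullet> q) = \<i> * l x" by (simp add: lform_eq algebra_simps)
  finally have "Lrot p q u x = \<i> * (of_nat n * (l x * l x ^ (n - 1)))" by simp
  then show ?thesis by (simp only: power_pred mult.assoc)
qed

lemma Lrot_pw: "Lrot p w u = (\<lambda>x. - of_nat n * (of_real (x \<bullet> w) * l x ^ (n - 1)))"
  and Lrot_qw: "Lrot q w u = (\<lambda>x. - \<i> * of_nat n * (of_real (x \<bullet> w) * l x ^ (n - 1)))"
  by (auto simp: Lrot_def ddir_lform_power l_pqw fun_eq_iff)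

lemma ddir_inner_power:
  "ddir v (\<lambda>x. c * (of_real (x \<bullet> w) * l x ^ (n - 1))) x =
    c * (of_real (x \<bullet> w) * (of_nat (n - 1) * l v * l x ^ (n - 1 - 1)) + of_real (v \<bullet> w) * l x ^ (n - 1))"
  by (simp add: ddir_cmult ddir_mult spoly_mult spoly_inner spoly_lform_power ddir_inner ddir_lform_power)

text \<open>The terms with the square of \<open>x \<bullet> w\<close>, of size n^2, carry the factor
  1 + i^2 and cancel; what remains is n times x . p + i (x . q) times the power of degree n -
  1.\<close>

lemma Lrot_Lrot:
  "Lrot w p (Lrot p w u) x + Lrot w q (Lrot q w u) x = of_nat n * u x"
proof -
  have "Lrot w p (Lrot p w u) x + Lrot w q (Lrot q w u) x = of_nat n * (l x * l x ^ (n - 1))"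
    unfolding Lrot_pw Lrot_qw unfolding Lrot_def ddir_inner_power
    using orthonormalD[OF pw] orthonormalD[OF qw]
    by (simp add: l_pqw lform_eq[of p q x] algebra_simps)
  then show ?thesis by (simp only: power_pred)
qed

lemma spoly_u: "spoly u" by (rule spoly_lform_power)

lemma norm_Lrot: "(norm (abs_hs (Lrot p w u)))\<^sup>2 + (norm (abs_hs (Lrot q w u)))\<^sup>2 = real n * (norm (abs_hs u))\<^sup>2"
proof -
  note s = spoly_Lrot[OF spoly_u]
  have "(norm (abs_hs (Lrot p w u)))\<^sup>2 + (norm (abs_hs (Lrot q w u)))\<^sup>2
     = abs_hs u \<bullet> abs_hs (Lrot w p (Lrot p w u)) + abs_hs u \<bullet> abs_hs (Lrot w q (Lrot q w u))"
    by (simp add: power2_norm_eq_inner Lrot_skew pw qw spoly_u s)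
  also have "\<dots> = abs_hs u \<bullet> abs_hs (\<lambda>x. Lrot w p (Lrot p w u) x + Lrot w q (Lrot q w u) x)"
    by (simp add: abs_hs_add L2_spoly spoly_Lrot spoly_u inner_add_right)
  also have "abs_hs (\<lambda>x. Lrot w p (Lrot p w u) x + Lrot w q (Lrot q w u) x) = real n *\<^sub>R abs_hs u"
    unfolding Lrot_Lrot using abs_hs_scaleR[OF L2_spoly[OF spoly_u], of "real n"] by simp
  finally show ?thesis by (simp add: power2_norm_eq_inner)
qed

text \<open>The identity between the three generators in the form needed for test functions. Each
  coordinate that multiplies \<open>h\<close> is annihilated by the generator in front of it, so it
  passes through.\<close>

lemma Lrot_mult: 
  assumes h: "spoly h"
  shows "Lrot q p (\<lambda>x. of_real (x \<bullet> w) * h x) x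
     = Lrot w p (\<lambda>x. of_real (x \<bullet> q) * h x) x - Lrot w q (\<lambda>x. of_real (x \<bullet> p) * h x) x"
  using orthonormalD[OF pq] orthonormalD[OF pw] orthonormalD[OF qw]
  by (simp add: Lrot_def ddir_mult spoly_inner h ddir_inner algebra_simps)

text \<open>Write n i times the state as \<open>W\<close> applied to \<open>Lrot p q u\<close>, pair
  it with (x . w) h, and move the generator to the test function at the cost of one commutator.
  Split it there by \<open>Lrot_mult\<close> and move the two transversal generators back to
  \<open>u\<close>, at the cost of two more.\<close>

lemma norm_mult_equatorial_le:
  assumes n: "0 < n" and W: "bounded_linear W" and iso: "\<And>X. norm (W X) = norm X"
    and scal: "\<And>c X. W (scaleC_hs c X) = scaleC_hs c (W X)" and M: "0 \<le> M"
    and key: "\<And>a b s. orthonormal a b \<Longrightarrow>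
       norm (compose_hs (rotation a b s) (W (abs_hs u)) - W (compose_hs (rotation a b s) (abs_hs u)))
        \<le> M * \<bar>s\<bar> * norm (abs_hs u)"
  shows "norm (mult_hs (\<lambda>x. of_real (x \<bullet> w)) (W (abs_hs u))) \<le> (2 + 3 * M) / sqrt n * norm (abs_hs u)"
proof -
  let ?U = "abs_hs u" and ?F = "W (abs_hs u)" and ?m = "\<lambda>x::'a. of_real (x \<bullet> w) :: complex"
  have nw: "norm w \<le> 1" "norm p \<le> 1" "norm q \<le> 1" "norm w = 1" "norm p = 1" "norm q = 1"
    using pw qw by (auto simp: orthonormal_def)
  define \<kappa> where "\<kappa> = sqrt n * norm ?U"
  have \<kappa>: "norm (abs_hs (Lrot p w u)) \<le> \<kappa>" "norm (abs_hs (Lrot q w u)) \<le> \<kappa>"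
  proof -
    have "(norm (abs_hs (Lrot p w u)))\<^sup>2 \<le> \<kappa>\<^sup>2" "(norm (abs_hs (Lrot q w u)))\<^sup>2 \<le> \<kappa>\<^sup>2"
      using norm_Lrot zero_le_power2[of "norm (abs_hs (Lrot p w u))"] zero_le_power2[of "norm (abs_hs (Lrot q w u))"]
      unfolding \<kappa>_def power_mult_distrib real_sqrt_pow2[OF of_nat_0_le_iff] by linarith+
    moreover have "0 \<le> \<kappa>" by (simp add: \<kappa>_def)
    ultimately show "norm (abs_hs (Lrot p w u)) \<le> \<kappa>" "norm (abs_hs (Lrot q w u)) \<le> \<kappa>"
      by (auto intro: power2_le_imp_le)
  qed
  \<comment> \<open>A transversal term: the commutator contributes \<open>M\<close> and the
    generator on \<open>u\<close> contributes at most \<open>\<kappa>\<close>; multiplication by a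
    coordinate does not increase the norm of \<open>h\<close>.\<close>
  have side: "\<bar>?F \<bullet> abs_hs (Lrot w a (\<lambda>x. of_real (x \<bullet> b) * h x))\<bar> \<le> (\<kappa> + M * norm ?U) * norm (abs_hs h)"
    if aw: "orthonormal a w" and b: "norm b = 1" and h: "spoly h" and k: "norm (abs_hs (Lrot a w u)) \<le> \<kappa>" for a b h
  proof -
    let ?h = "\<lambda>x. of_real (x \<bullet> b) * h x"
    have sh: "spoly ?h" by (intro spoly_mult spoly_inner h)
    have "abs_hs ?h = mult_hs (\<lambda>x. of_real (x \<bullet> b)) (abs_hs h)"
      by (rule mult_hs_abs_hs[OF bounded_mult_inner L2_spoly[OF h], symmetric]) (simp add: b)
    then have hn: "norm (abs_hs ?h) \<le> norm (abs_hs h)"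
      using norm_mult_hs_le[OF bounded_mult_inner[of b], of "abs_hs h"] b by simp
    have "\<bar>?F \<bullet> abs_hs (Lrot w a ?h)\<bar> \<le> M * norm ?U * norm (abs_hs ?h) + \<bar>W (abs_hs (Lrot a w u)) \<bullet> abs_hs ?h\<bar>"
      using weak_commutator_bound[OF aw spoly_u sh W key[OF aw]] by linarith
    also have "\<bar>W (abs_hs (Lrot a w u)) \<bullet> abs_hs ?h\<bar> \<le> norm (abs_hs (Lrot a w u)) * norm (abs_hs ?h)"
      using Cauchy_Schwarz_ineq2[of "W (abs_hs (Lrot a w u))" "abs_hs ?h"] by (simp add: iso)
    also have "\<dots> \<le> \<kappa> * norm (abs_hs ?h)" by (rule mult_right_mono[OF k]) simp
    also have "M * norm ?U * norm (abs_hs ?h) + \<kappa> * norm (abs_hs ?h) = (\<kappa> + M * norm ?U) * norm (abs_hs ?h)"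
      by (simp add: algebra_simps)
    also have "\<dots> \<le> (\<kappa> + M * norm ?U) * norm (abs_hs h)"
      using hn M by (intro mult_left_mono) (auto simp: \<kappa>_def)
    finally show ?thesis by simp
  qed
  have bm: "bounded_mult ?m 1" using bounded_mult_inner[of w] nw by simp
  have "real n * norm (mult_hs ?m ?F) \<le> 2 * \<kappa> + 3 * M * norm ?U"
  proof -
    have "norm (real n *\<^sub>R mult_hs ?m (scaleC_hs \<i> ?F)) \<le> 2 * \<kappa> + 3 * M * norm ?U"
    proof (rule norm_le_spoly)
      fix h :: "'a \<Rightarrow> complex" assume h: "spoly h"
      let ?h = "\<lambda>x. ?m x * h x"
      have sh: "spoly ?h" by (intro spoly_mult spoly_inner h)
      have hm: "abs_hs ?h = mult_hs ?m (abs_hs h)"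
        by (rule mult_hs_abs_hs[OF bm L2_spoly[OF h], symmetric])
      have hn: "norm (abs_hs ?h) \<le> norm (abs_hs h)" unfolding hm using norm_mult_hs_le[OF bm, of "abs_hs h"] by simp
      have "abs_hs (Lrot p q u) = scaleC_hs (\<i> * of_nat n) ?U"
      proof -
        have "Lrot p q u = (\<lambda>x. \<i> * of_nat n * u x)" by (rule ext) (rule Lrot_pq)
        then show ?thesis by (simp only: scaleC_abs_hs[OF L2_spoly[OF spoly_u]])
      qed
      then have "W (abs_hs (Lrot p q u)) = scaleC_hs (of_real (real n) * \<i>) ?F"
        by (simp add: scal mult.commute)
      then have Wn: "W (abs_hs (Lrot p q u)) = real n *\<^sub>R scaleC_hs \<i> ?F"
        by (simp only: scaleC_scaleC_hs[symmetric] scaleC_of_real)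
      \<comment> \<open>Multiplication by the real function \<open>x \<bullet> w\<close> is
        symmetric, also for the real part of the Hermitian product.\<close>
      have "real n *\<^sub>R mult_hs ?m (scaleC_hs \<i> ?F) \<bullet> abs_hs h = W (abs_hs (Lrot p q u)) \<bullet> abs_hs ?h"
        unfolding Wn hm using inner_mult_hs[OF bm, of 1 "scaleC_hs \<i> ?F" "abs_hs h"] bm by simp
      also have "\<dots> \<le> \<bar>?F \<bullet> abs_hs (Lrot q p ?h)\<bar> + M * norm ?U * norm (abs_hs ?h)"
        using weak_commutator_bound[OF pq spoly_u sh W key[OF pq]] by linarith
      also have "M * norm ?U * norm (abs_hs ?h) \<le> M * norm ?U * norm (abs_hs h)"
        using hn M by (intro mult_left_mono) auto
      also have "abs_hs (Lrot q p ?h) = abs_hs (Lrot w p (\<lambda>x. of_real (x \<bullet> q) * h x)) - abs_hs (Lrot w q (\<lambda>x. of_real (x \<bullet> p) * h x))"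
      proof -
        have "Lrot q p ?h = (\<lambda>x. Lrot w p (\<lambda>x. of_real (x \<bullet> q) * h x) x - Lrot w q (\<lambda>x. of_real (x \<bullet> p) * h x) x)"
          by (rule ext) (rule Lrot_mult[OF h])
        then show ?thesis
          by (simp only: abs_hs_diff[OF L2_spoly[OF spoly_Lrot] L2_spoly[OF spoly_Lrot]] spoly_mult[OF spoly_inner h])
      qed
      also have "\<bar>?F \<bullet> (abs_hs (Lrot w p (\<lambda>x. of_real (x \<bullet> q) * h x)) - abs_hs (Lrot w q (\<lambda>x. of_real (x \<bullet> p) * h x)))\<bar>
         \<le> (\<kappa> + M * norm ?U) * norm (abs_hs h) + (\<kappa> + M * norm ?U) * norm (abs_hs h)"
        unfolding inner_diff_right using side[OF pw nw(6) h \<kappa>(1)] side[OF qw nw(5) h \<kappa>(2)] by linarith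
      finally show "real n *\<^sub>R mult_hs ?m (scaleC_hs \<i> ?F) \<bullet> abs_hs h \<le> (2 * \<kappa> + 3 * M * norm ?U) * norm (abs_hs h)"
        by (simp add: algebra_simps)
    qed
    moreover have "mult_hs ?m (scaleC_hs \<i> ?F) = scaleC_hs \<i> (mult_hs ?m ?F)"
      by (cases ?F rule: hs_cases)
        (simp add: mult_hs_abs_hs[OF bm] scaleC_abs_hs L2_cmult L2_bounded_mult[OF bm] mult.left_commute)
    ultimately show ?thesis by (simp add: norm_scaleC_hs)
  qed
  also have "\<dots> \<le> (2 + 3 * M) * sqrt n * norm ?U"
  proof -
    \<comment> \<open>Since \<open>n\<close> is positive, the commutator terms of size
      \<open>M\<close> are absorbed into the sqrt n term.\<close>
    have "1 \<le> sqrt (real n)" using n by simp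
    then have "M * norm ?U * 1 \<le> M * norm ?U * sqrt (real n)" using M by (intro mult_left_mono) auto
    then show ?thesis by (simp add: \<kappa>_def algebra_simps)
  qed
  finally have "real n * norm (mult_hs ?m ?F) \<le> (2 + 3 * M) * sqrt n * norm ?U" .
  moreover have "real n * norm (mult_hs ?m ?F) = sqrt n * (sqrt n * norm (mult_hs ?m ?F))"
    by (simp only: mult.assoc[symmetric] real_sqrt_mult_self abs_of_nat)
  ultimately have "sqrt n * (sqrt n * norm (mult_hs ?m ?F)) \<le> sqrt n * ((2 + 3 * M) * norm ?U)"
    by (simp add: mult.left_commute mult.assoc)
  then have "sqrt n * norm (mult_hs ?m ?F) \<le> (2 + 3 * M) * norm ?U"
    using n by (simp add: mult_le_cancel_left)
  then show ?thesis using n by (simp add: pos_le_divide_eq mult.commute)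
qed

end

section \<open>Concentration along the great circle\<close>

locale sphere_unitary_group =
  fixes A :: "(('a::euclidean_space \<Rightarrow> complex) \<times> ('a \<Rightarrow> complex)) set"
    and U :: "real \<Rightarrow> ('a \<Rightarrow> complex) \<Rightarrow> ('a \<Rightarrow> complex)"
  assumes gen: "generates_unitary_group sphere_measure A U"
begin

lemmas group_unfolded =
  gen[unfolded generates_unitary_group_def, THEN conjunct1, unfolded strongly_continuous_unitary_group_def]
lemmas U_L2 = group_unfolded[THEN conjunct1, rule_format]
lemmas U_lincomb = group_unfolded[THEN conjunct2, THEN conjunct1, rule_format]
lemmas U_norm = group_unfolded[THEN conjunct2, THEN conjunct2, THEN conjunct1, rule_format]
lemmas U_0 = group_unfolded[THEN conjunct2, THEN conjunct2, THEN conjunct2, THEN conjunct1, rule_format]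
lemmas U_plus = group_unfolded[THEN conjunct2, THEN conjunct2, THEN conjunct2, THEN conjunct2, THEN conjunct1, rule_format]
lemmas U_cont = group_unfolded[THEN conjunct2, THEN conjunct2, THEN conjunct2, THEN conjunct2, THEN conjunct2, rule_format]
lemmas A_eq = gen[unfolded generates_unitary_group_def, THEN conjunct2]

lemma respects_U: "hs_respects (U t)"
proof (rule hs_respectsI_bounded)
  show "f \<in> L2 sphere_measure \<Longrightarrow> U t f \<in> L2 sphere_measure" for f by (rule U_L2)
  show "AE x in sphere_measure. U t (\<lambda>y. a * f y + b * g y) x = a * U t f x + b * U t g x"
    if "f \<in> L2 sphere_measure" "g \<in> L2 sphere_measure" for f g a b by (rule U_lincomb[OF that])
  show "L2_norm sphere_measure (U t f) \<le> L2_norm sphere_measure f" if "f \<in> L2 sphere_measure" for f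
    using U_norm[OF that, of t] by simp
qed

definition Uh :: "real \<Rightarrow> 'a hs \<Rightarrow> 'a hs" where "Uh t = hs_op (U t)"

lemma Uh_abs_hs: "f \<in> L2 sphere_measure \<Longrightarrow> Uh t (abs_hs f) = abs_hs (U t f)"
  by (simp add: Uh_def hs_op_abs_hs respects_U)

lemma Uh_lincomb: "Uh t (scaleC_hs a F + scaleC_hs b G) = scaleC_hs a (Uh t F) + scaleC_hs b (Uh t G)"
  unfolding Uh_def by (rule hs_op_lincomb[OF respects_U U_lincomb])

lemma Uh_scaleC: "Uh t (scaleC_hs a F) = scaleC_hs a (Uh t F)"
  using Uh_lincomb[of t a F 0 F] by (simp add: scaleC_0)

lemma norm_Uh: "norm (Uh t F) = norm F"
  by (cases F rule: hs_cases) (simp add: Uh_abs_hs norm_abs_hs U_L2 U_norm)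

lemma linear_Uh: "linear (Uh t)"
proof (rule linearI)
  show "Uh t (F + G) = Uh t F + Uh t G" for F G
    using Uh_lincomb[of t 1 F 1 G] by (simp add: scaleC_1)
  show "Uh t (r *\<^sub>R F) = r *\<^sub>R Uh t F" for r F
    by (simp add: scaleC_of_real[symmetric] Uh_scaleC)
qed

lemma bounded_linear_Uh: "bounded_linear (Uh t)"
  by (rule bounded_linear_intro[of _ 1])
    (simp_all add: linear_add[OF linear_Uh] linear_cmul[OF linear_Uh] norm_Uh)

lemma Uh_0: "Uh 0 F = F"
proof (cases F rule: hs_cases)
  fix f assume f: "f \<in> L2 sphere_measure" "F = abs_hs f"
  show ?thesis using U_0[OF f(1)] by (simp add: f Uh_abs_hs abs_hs_eq_iff U_L2)
qed

lemma Uh_plus: "Uh (s + t) F = Uh s (Uh t F)"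
proof (cases F rule: hs_cases)
  fix f assume f: "f \<in> L2 sphere_measure" "F = abs_hs f"
  show ?thesis using U_plus[OF f(1), of s t] by (simp add: f Uh_abs_hs abs_hs_eq_iff U_L2)
qed

lemma Uh_cont: "((\<lambda>t. Uh t F) \<longlongrightarrow> F) (at 0)"
proof (cases F rule: hs_cases)
  fix f assume f: "f \<in> L2 sphere_measure" "F = abs_hs f"
  have "((\<lambda>t. norm (Uh t F - F)) \<longlongrightarrow> 0) (at 0)"
    using U_cont[OF f(1)] by (simp add: f Uh_abs_hs U_L2 norm_abs_hs_diff)
  then show ?thesis by (simp add: tendsto_norm_zero_iff LIM_zero_iff)
qed

text \<open>Stone's convention has derivative -i A f at time zero, while \<open>generates\<close>
  records the derivative itself; hence the factor.\<close>

lemma generates_Uh_iff: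
  assumes f: "f \<in> L2 sphere_measure" and g: "g \<in> L2 sphere_measure"
  shows "generates Uh (abs_hs f) (scaleC_hs (- \<i>) (abs_hs g)) \<longleftrightarrow> (f, g) \<in> A"
proof -
  have "L2_norm sphere_measure (\<lambda>x. (U t f x - f x) / of_real t + \<i> * g x)
      = norm ((Uh t (abs_hs f) - abs_hs f) /\<^sub>R t - scaleC_hs (- \<i>) (abs_hs g))" for t
  proof -
    have 1: "(\<lambda>x. U t f x - f x) \<in> L2 sphere_measure" by (intro L2_diff U_L2 f)
    have "(Uh t (abs_hs f) - abs_hs f) /\<^sub>R t - scaleC_hs (- \<i>) (abs_hs g)
       = abs_hs (\<lambda>x. of_real (inverse t) * (U t f x - f x) - - \<i> * g x)"
      by (simp only: Uh_abs_hs[OF f] abs_hs_diff[OF U_L2[OF f] f] abs_hs_scaleR[OF 1]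
          scaleC_abs_hs[OF g] abs_hs_diff[OF L2_cmult[OF 1] L2_cmult[OF g]] flip: abs_hs_scaleR)
    moreover have "(\<lambda>x. of_real (inverse t) * (U t f x - f x) - - \<i> * g x) = (\<lambda>x. (U t f x - f x) / of_real t + \<i> * g x)"
      by (auto simp: divide_inverse mult.commute)
    moreover have "(\<lambda>x. of_real (inverse t) * (U t f x - f x) - - \<i> * g x) \<in> L2 sphere_measure"
      by (intro L2_diff L2_cmult 1 g U_L2 f)
    ultimately show ?thesis by (simp add: norm_abs_hs)
  qed
  then show ?thesis
    by (simp add: A_eq f g generates_def tendsto_norm_zero_iff LIM_zero_iff)
qed

end

lemma sphere_smooth_continuous:
  assumes "sphere_smooth V" shows "continuous_on (sphere 0 1) V"
proof -
  have "Ck_on 0 (- {0}) (\<lambda>y. V (sgn y))" using assms unfolding sphere_smooth_def by blast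
  then have "continuous_on (sphere 0 1) (\<lambda>y. V (sgn y))"
    unfolding Ck_on.simps by (rule continuous_on_subset) auto
  then show ?thesis by (rule continuous_on_eq) (simp add: sgn_div_norm)
qed

lemma bounded_mult_continuous:
  fixes V :: "'a::euclidean_space \<Rightarrow> real"
  assumes V: "continuous_on (sphere 0 1) V" and K: "\<And>x. norm x = 1 \<Longrightarrow> \<bar>V x\<bar> \<le> K"
  shows "bounded_mult (\<lambda>x. of_real (V x)) K"
proof -
  have "(\<lambda>x. of_real (V x) :: complex) \<in> L2 sphere_measure"
    by (intro L2_continuous continuous_intros V)
  then show ?thesis using K by (simp add: bounded_mult_def L2_measurable)
qed

section \<open>Rotations against the perturbed group\<close>

locale sphere_schroedinger_group =
  res: sphere_spectral_resolution E + grp: sphere_unitary_group "add_potential (laplacian_power E a) V" U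
  for E :: "real set \<Rightarrow> ('a::euclidean_space \<Rightarrow> complex) \<Rightarrow> ('a \<Rightarrow> complex)" and a :: real
    and V :: "'a \<Rightarrow> real" and U :: "real \<Rightarrow> ('a \<Rightarrow> complex) \<Rightarrow> ('a \<Rightarrow> complex)" +
  assumes V: "sphere_smooth V"
begin

abbreviation "A \<equiv> add_potential (laplacian_power E a) V"

lemma V_bounded: obtains K where "bounded_mult (\<lambda>x. of_real (V x)) K"
proof -
  have c: "continuous_on (sphere 0 1) V" by (rule sphere_smooth_continuous[OF V])
  have "bounded (V ` sphere 0 1)" by (intro compact_imp_bounded compact_continuous_image c) simp
  then obtain K where "\<And>x. norm x = 1 \<Longrightarrow> \<bar>V x\<bar> \<le> K" by (force simp: bounded_iff)
  then show thesis by (intro that bounded_mult_continuous c)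
qed

lemma V_mult_L2: "f \<in> L2 sphere_measure \<Longrightarrow> (\<lambda>x. of_real (V x) * f x) \<in> L2 sphere_measure"
proof -
  obtain K where K: "bounded_mult (\<lambda>x. of_real (V x)) K" by (rule V_bounded)
  show "f \<in> L2 sphere_measure \<Longrightarrow> (\<lambda>x. of_real (V x) * f x) \<in> L2 sphere_measure" by (rule L2_bounded_mult[OF K])
qed

text \<open>Rotations preserve the domain of the fractional Laplacian and commute with it, so the
  commutator with the generator reduces to multiplication by \<open>V\<close> minus its rotated
  copy, up to the factor -i.\<close>

lemma generates_compose:
  assumes ab: "orthonormal b c" and M: "\<And>x. norm x = 1 \<Longrightarrow> \<bar>V (rotation b c s x) - V x\<bar> \<le> M"
    and xy: "generates grp.Uh X Y"
  shows "\<exists>Z. generates grp.Uh (compose_hs (rotation b c s) X) Z \<and> norm (Z - compose_hs (rotation b c s) Y) \<le> M * norm X"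
proof -
  note T = orthogonal_transformation_rotation[OF ab]
  let ?T = "rotation b c s"
  obtain f where f: "f \<in> L2 sphere_measure" "X = abs_hs f" by (rule hs_cases)
  \<comment> \<open>The derivative \<open>Y\<close> is -i A f, so i times \<open>Y\<close>
    represents A f.\<close>
  obtain g where g: "g \<in> L2 sphere_measure" "scaleC_hs \<i> Y = abs_hs g" by (rule hs_cases)
  have Y: "Y = scaleC_hs (- \<i>) (abs_hs g)"
    unfolding g(2)[symmetric] by (simp add: scaleC_scaleC_hs scaleC_1)
  then have "(f, g) \<in> A" using xy f g by (simp add: grp.generates_Uh_iff)
  then obtain g' where fg': "(f, g') \<in> laplacian_power E a" and gg': "g = (\<lambda>x. g' x + of_real (V x) * f x)"
    by (auto simp: add_potential_def)
  have g': "g' \<in> L2 sphere_measure" using fg' by (simp add: laplacian_power_def spectral_integral_def)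
  let ?gT = "\<lambda>x. g' (?T x) + of_real (V x) * f (?T x)"
  have fT: "(\<lambda>x. f (?T x)) \<in> L2 sphere_measure" by (rule L2_compose[OF T f(1)])
  have gT: "?gT \<in> L2 sphere_measure" by (intro L2_add L2_compose[OF T g'] V_mult_L2 fT)
  have "(\<lambda>x. f (?T x), \<lambda>x. g' (?T x)) \<in> laplacian_power E a" by (rule res.laplacian_power_compose[OF T fg'])
  then have "(\<lambda>x. f (?T x), ?gT) \<in> A" by (auto simp: add_potential_def)
  then have "generates grp.Uh (compose_hs ?T X) (scaleC_hs (- \<i>) (abs_hs ?gT))"
    using grp.generates_Uh_iff[OF fT gT] by (simp add: f compose_abs_hs[OF T])
  moreover have "norm (scaleC_hs (- \<i>) (abs_hs ?gT) - compose_hs ?T Y) \<le> M * norm X"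
  proof -
    have bm: "bounded_mult (\<lambda>x. of_real (V x - V (?T x))) M"
    proof (rule bounded_mult_continuous)
      have c: "continuous_on (sphere 0 1) V" by (rule sphere_smooth_continuous[OF V])
      have "continuous_on (sphere 0 1) (\<lambda>x. V (?T x))"
        by (rule continuous_on_compose2[OF c linear_continuous_on])
          (auto simp: norm_rotation[OF ab] linear_linear orthogonal_transformation_linear[OF T])
      then show "continuous_on (sphere 0 1) (\<lambda>x. V x - V (?T x))" by (intro continuous_on_diff c)
      show "\<bar>V x - V (?T x)\<bar> \<le> M" if "norm x = 1" for x using M[OF that] by (simp add: abs_minus_commute)
    qed
    have gc: "(\<lambda>x. g (?T x)) \<in> L2 sphere_measure" by (rule L2_compose[OF T g(1)])
    have "scaleC_hs (- \<i>) (abs_hs ?gT) - compose_hs ?T Y = scaleC_hs (- \<i>) (abs_hs ?gT - compose_hs ?T (abs_hs g))"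
      by (simp add: Y compose_hs_scaleC[OF T] linear_diff bounded_linear.linear bounded_linear_mult_hs[OF bounded_mult_const])
    also have "abs_hs ?gT - compose_hs ?T (abs_hs g) = abs_hs (\<lambda>x. ?gT x - g (?T x))"
      by (simp add: compose_abs_hs[OF T g(1)] abs_hs_diff[OF gT gc])
    also have "(\<lambda>x. ?gT x - g (?T x)) = (\<lambda>x. of_real (V x - V (?T x)) * f (?T x))"
      by (auto simp: gg' algebra_simps)
    also have "abs_hs \<dots> = mult_hs (\<lambda>x. of_real (V x - V (?T x))) (compose_hs ?T X)"
      unfolding f(2) compose_abs_hs[OF T f(1)] by (rule mult_hs_abs_hs[OF bm fT, symmetric])
    finally have "norm (scaleC_hs (- \<i>) (abs_hs ?gT) - compose_hs ?T Y)
       = norm (mult_hs (\<lambda>x. of_real (V x - V (?T x))) (compose_hs ?T X))"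
      by (simp add: norm_scaleC_hs)
    also have "\<dots> \<le> M * norm (compose_hs ?T X)" by (rule norm_mult_hs_le[OF bm])
    finally show ?thesis by (simp add: norm_compose_hs[OF T])
  qed
  ultimately show ?thesis by blast
qed

text \<open>An eigenpolynomial lies in the domain, so the curve argument applies with commutator
  bound \<open>M * \<bar>s\<bar>\<close> at a fixed angle \<open>s\<close>.\<close>

lemma rotation_commutator_bound:
  assumes M: "\<And>x s. norm x = 1 \<Longrightarrow> \<bar>V (rotation b c s x) - V x\<bar> \<le> M * \<bar>s\<bar>"
    and bc: "orthonormal b c" and f: "eigenpoly l f"
  shows "norm (compose_hs (rotation b c s) (grp.Uh t (abs_hs f)) - grp.Uh t (compose_hs (rotation b c s) (abs_hs f)))
     \<le> M * \<bar>t\<bar> * \<bar>s\<bar> * norm (abs_hs f)"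
proof -
  note T = orthogonal_transformation_rotation[OF bc]
  have fL: "f \<in> L2 sphere_measure" using f by (simp add: eigenpoly_def L2_spoly)
  let ?g = "\<lambda>x. of_real (l powr a) * f x + of_real (V x) * f x"
  have gL: "?g \<in> L2 sphere_measure" by (intro L2_add L2_cmult V_mult_L2 fL)
  have "(f, ?g) \<in> A" using res.laplacian_power_eigenpoly[OF f, of a] by (auto simp: add_potential_def)
  then have g: "generates grp.Uh (abs_hs f) (scaleC_hs (- \<i>) (abs_hs ?g))"
    using grp.generates_Uh_iff[OF fL gL] by simp
  have "norm (compose_hs (rotation b c s) (grp.Uh t (abs_hs f)) - grp.Uh t (compose_hs (rotation b c s) (abs_hs f)))
    \<le> (M * \<bar>s\<bar>) * norm (abs_hs f) * \<bar>t\<bar>"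
    by (rule isometric_group_commutator_bound[OF grp.linear_Uh grp.norm_Uh grp.Uh_0 grp.Uh_plus grp.Uh_cont
          bounded_linear_compose_hs[OF T] generates_compose[OF bc M] g])
  then show ?thesis by (simp add: mult_ac)
qed

end

text \<open>The form is nonzero at \<open>p\<close>, hence on an open set, and open sets meeting the
  sphere have positive measure.\<close>

lemma norm_equatorial_pos:
  assumes pq: "orthonormal p q"
  shows "0 < norm (abs_hs (\<lambda>x. lform p q x ^ n))"
proof -
  let ?u = "\<lambda>x. lform p q x ^ n"
  have uL: "?u \<in> L2 sphere_measure" by (rule L2_spoly[OF spoly_lform_power])
  have "\<not> (AE x in sphere_measure. ?u x = 0)"
  proof
    assume ae: "AE x in sphere_measure. ?u x = 0"
    let ?S = "{x. lform p q x \<noteq> 0}"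
    have op: "open ?S"
    proof -
      have "continuous_on UNIV (lform p q)" by (rule linear_continuous_on[OF bounded_linear_lform])
      then show ?thesis by (intro open_Collect_neq) (auto intro: continuous_intros)
    qed
    have "p \<in> ?S" using orthonormalD[OF pq] by (simp add: lform_def complex_eq_iff)
    moreover have "norm p = 1" using pq by (simp add: orthonormal_def)
    ultimately have "emeasure sphere_measure (?S \<inter> sphere 0 1) > 0"
      by (rule emeasure_sphere_measure_open_pos[OF op])
    moreover have "emeasure sphere_measure (?S \<inter> sphere 0 1) = 0"
    proof -
      have m: "?S \<inter> sphere 0 1 \<in> sets sphere_measure"
        using op by (auto simp: sets_sphere_measure sets_restrict_space_iff)
      have ae': "AE x in sphere_measure. x \<notin> ?S \<inter> sphere 0 1" using ae by eventually_elim auto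
      have eq: "{x \<in> space sphere_measure. \<not> x \<notin> ?S \<inter> sphere 0 1} = ?S \<inter> sphere 0 1" by auto
      show ?thesis by (rule AE_iff_measurable[OF m eq, THEN iffD1, OF ae'])
    qed
    ultimately show False by simp
  qed
  then have "abs_hs ?u \<noteq> 0" using abs_hs_eq_iff[OF uL L2_0] by (simp add: abs_hs_zero)
  then show ?thesis by simp
qed

section \<open>Mass in a region that avoids a great circle\<close>

locale avoided_geodesic =
  fixes \<omega> :: "'a::euclidean_space set" and p q :: 'a
  assumes \<omega>: "openin (top_of_set (sphere 0 1)) \<omega>" and pq: "orthonormal p q"
    and avoid: "range (\<lambda>t. cos t *\<^sub>R p + sin t *\<^sub>R q) \<subseteq> sphere 0 1 - closure \<omega>"
begin

text \<open>Orthogonal projection off the plane of the circle. On the sphere it vanishes exactly on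
  the great circle, so its norm measures the separation.\<close>

definition proj :: "'a \<Rightarrow> 'a" where "proj x = x - (x \<bullet> p) *\<^sub>R p - (x \<bullet> q) *\<^sub>R q"

lemma proj_orthogonal: "proj x \<bullet> p = 0" "proj x \<bullet> q = 0" "p \<bullet> proj x = 0" "q \<bullet> proj x = 0"
  by (simp_all add: proj_def inner_diff_left inner_diff_right orthonormalD[OF pq] inner_commute)

lemma proj_inner: "x \<bullet> proj y = proj x \<bullet> y"
  by (simp add: proj_def inner_diff_left inner_diff_right inner_commute)

lemma norm_proj: "(norm (proj x))\<^sup>2 = (norm x)\<^sup>2 - (x \<bullet> p)\<^sup>2 - (x \<bullet> q)\<^sup>2"
  unfolding power2_norm_eq_inner
  by (simp add: proj_def inner_diff_left inner_diff_right orthonormalD[OF pq] inner_commute power2_eq_square algebra_simps)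

lemma norm_proj_le: "norm (proj x) \<le> norm x"
proof (rule power2_le_imp_le)
  show "(norm (proj x))\<^sup>2 \<le> (norm x)\<^sup>2"
    unfolding norm_proj using zero_le_power2[of "x \<bullet> p"] zero_le_power2[of "x \<bullet> q"] by linarith
qed simp

text \<open>Projecting the standard basis replaces an orthonormal basis of the complement of the
  plane: the projection is symmetric, so the sum is Parseval for \<open>proj x\<close>.\<close>

lemma sum_inner_proj: "(\<Sum>b\<in>Basis. (x \<bullet> proj b)\<^sup>2) = (norm (proj x))\<^sup>2"
proof -
  have "(x \<bullet> proj b)\<^sup>2 = (proj x \<bullet> b) * (proj x \<bullet> b)" for b by (simp only: proj_inner power2_eq_square)
  then show ?thesis unfolding power2_norm_eq_inner euclidean_inner[of "proj x" "proj x"] by simp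
qed

lemma \<omega>_sets: "\<omega> \<in> sets sphere_measure"
  using \<omega> by (auto simp: openin_open sets_sphere_measure sets_restrict_space_iff)

lemma \<omega>_subset: "\<omega> \<subseteq> sphere 0 1"
  using \<omega> by (auto simp: openin_open)

text \<open>A continuous function that is positive on the compact closure of \<open>\<omega>\<close>
  attains a positive minimum. A zero of \<open>proj\<close> on the sphere would have its two plane
  coordinates on the unit circle, hence lie on the avoided great circle.\<close>

lemma separation: "\<exists>\<delta>>0. \<forall>x\<in>\<omega>. \<delta> \<le> (norm (proj x))\<^sup>2"
proof -
  have cl: "closure \<omega> \<subseteq> sphere 0 1" by (rule closure_minimal[OF \<omega>_subset]) simp
  have pos: "0 < (norm (proj x))\<^sup>2" if x: "x \<in> closure \<omega>" for x
  proof (rule ccontr)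
    assume "\<not> 0 < (norm (proj x))\<^sup>2"
    then have p0: "proj x = 0" by simp
    have nx: "norm x = 1" using x cl by auto
    then have "(x \<bullet> p)\<^sup>2 + (x \<bullet> q)\<^sup>2 = 1" using norm_proj[of x] p0 by simp
    then obtain t where t: "x \<bullet> p = cos t" "x \<bullet> q = sin t" using sincos_total_2pi by metis
    have "x = cos t *\<^sub>R p + sin t *\<^sub>R q" using p0 t by (simp add: proj_def algebra_simps)
    then show False using avoid x by blast
  qed
  show ?thesis
  proof (cases "closure \<omega> = {}")
    case True
    then show ?thesis using closure_subset[of \<omega>] by (intro exI[of _ 1]) auto
  next
    case False
    have "compact (closure \<omega>)" using cl by (meson closed_closure compact_sphere compact_Int_closed inf.absorb_iff2 compact_eq_bounded_closed bounded_subset)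
    moreover have "continuous_on (closure \<omega>) (\<lambda>x. (norm (proj x))\<^sup>2)"
      unfolding proj_def by (intro continuous_intros)
    ultimately obtain y where y: "y \<in> closure \<omega>" "\<And>x. x \<in> closure \<omega> \<Longrightarrow> (norm (proj y))\<^sup>2 \<le> (norm (proj x))\<^sup>2"
      using continuous_attains_inf[OF _ False] by metis
    show ?thesis using pos[OF y(1)] y(2) closure_subset[of \<omega>] by blast
  qed
qed

text \<open>A Chebyshev estimate: on \<open>\<omega>\<close> the weight
  \<open>(norm (proj x))\<^sup>2 / \<delta>\<close> is at least 1, and it splits into one
  transversal coordinate for each basis vector.\<close>

lemma set_integral_le:
  assumes f: "f \<in> L2 sphere_measure" and \<delta>: "0 < \<delta>" "\<And>x. x \<in> \<omega> \<Longrightarrow> \<delta> \<le> (norm (proj x))\<^sup>2"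
    and K: "\<And>b. b \<in> Basis \<Longrightarrow> norm (mult_hs (\<lambda>x. of_real (x \<bullet> proj b)) (abs_hs f)) \<le> K"
  shows "(LINT x:\<omega>|sphere_measure. (cmod (f x))\<^sup>2) \<le> real DIM('a) * K\<^sup>2 / \<delta>"
proof -
  have bm: "bounded_mult (\<lambda>x. of_real (x \<bullet> proj b)) (norm (proj b))" if "b \<in> Basis" for b
    by (rule bounded_mult_inner) (use norm_proj_le[of b] that in simp)
  have mL: "(\<lambda>x. of_real (x \<bullet> proj b) * f x) \<in> L2 sphere_measure" if "b \<in> Basis" for b
    by (rule L2_bounded_mult[OF bm[OF that] f])
  have int: "integrable sphere_measure (\<lambda>x. (cmod (of_real (x \<bullet> proj b) * f x))\<^sup>2)" if "b \<in> Basis" for b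
    by (rule L2_integrable[OF mL[OF that]])
  have "(LINT x:\<omega>|sphere_measure. (cmod (f x))\<^sup>2)
     \<le> (LINT x|sphere_measure. (\<Sum>b\<in>Basis. (cmod (of_real (x \<bullet> proj b) * f x))\<^sup>2) / \<delta>)"
    unfolding set_lebesgue_integral_def
  proof (rule integral_mono)
    show "integrable sphere_measure (\<lambda>x. indicator \<omega> x *\<^sub>R (cmod (f x))\<^sup>2)"
      by (rule integrable_mult_indicator[OF \<omega>_sets L2_integrable[OF f]])
    show "integrable sphere_measure (\<lambda>x. (\<Sum>b\<in>Basis. (cmod (of_real (x \<bullet> proj b) * f x))\<^sup>2) / \<delta>)"
      by (intro integrable_divide Bochner_Integration.integrable_sum int)
    fix x
    have "(\<Sum>b\<in>Basis. (cmod (of_real (x \<bullet> proj b) * f x))\<^sup>2) = (norm (proj x))\<^sup>2 * (cmod (f x))\<^sup>2"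
      by (simp add: norm_mult power_mult_distrib sum_inner_proj flip: sum_distrib_right)
    moreover have "indicator \<omega> x *\<^sub>R (cmod (f x))\<^sup>2 \<le> (norm (proj x))\<^sup>2 * (cmod (f x))\<^sup>2 / \<delta>"
    proof (cases "x \<in> \<omega>")
      case True
      have "\<delta> * (cmod (f x))\<^sup>2 \<le> (norm (proj x))\<^sup>2 * (cmod (f x))\<^sup>2"
        by (rule mult_right_mono[OF \<delta>(2)[OF True]]) simp
      then show ?thesis using True \<delta>(1) by (simp add: pos_le_divide_eq mult.commute)
    next
      case False
      then show ?thesis using \<delta>(1) by simp
    qed
    ultimately show "indicator \<omega> x *\<^sub>R (cmod (f x))\<^sup>2 \<le> (\<Sum>b\<in>Basis. (cmod (of_real (x \<bullet> proj b) * f x))\<^sup>2) / \<delta>"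
      by simp
  qed
  also have "\<dots> = (\<Sum>b\<in>Basis. (LINT x|sphere_measure. (cmod (of_real (x \<bullet> proj b) * f x))\<^sup>2)) / \<delta>"
    by (simp only: integral_divide_zero Bochner_Integration.integral_sum[OF int])
  also have "\<dots> \<le> (\<Sum>b\<in>(Basis :: 'a set). K\<^sup>2) / \<delta>"
  proof (intro divide_right_mono sum_mono)
    fix b :: 'a assume b: "b \<in> Basis"
    have "(LINT x|sphere_measure. (cmod (of_real (x \<bullet> proj b) * f x))\<^sup>2) = (norm (abs_hs (\<lambda>x. of_real (x \<bullet> proj b) * f x)))\<^sup>2"
      unfolding norm_abs_hs[OF mL[OF b]] L2_norm_def by simp
    also have "\<dots> = (norm (mult_hs (\<lambda>x. of_real (x \<bullet> proj b)) (abs_hs f)))\<^sup>2"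
      by (simp add: mult_hs_abs_hs[OF bm[OF b] f])
    also have "\<dots> \<le> K\<^sup>2" by (rule power_mono[OF K[OF b]]) simp
    finally show "(LINT x|sphere_measure. (cmod (of_real (x \<bullet> proj b) * f x))\<^sup>2) \<le> K\<^sup>2" .
  qed (use \<delta> in simp)
  finally show ?thesis by simp
qed

text \<open>The transversal bound applies to the unit vector along each nonzero
  \<open>proj b\<close>, whose length is at most 1; a zero projection contributes nothing. Summing
  over the basis gives the factor \<open>DIM('a)\<close>.\<close>

lemma concentration:
  assumes f: "f \<in> L2 sphere_measure" and fW: "abs_hs f = W (abs_hs (\<lambda>x. lform p q x ^ n))"
    and \<delta>: "0 < \<delta>" "\<And>x. x \<in> \<omega> \<Longrightarrow> \<delta> \<le> (norm (proj x))\<^sup>2"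
    and n: "0 < n" and W: "bounded_linear W" and iso: "\<And>X. norm (W X) = norm X"
    and scal: "\<And>c X. W (scaleC_hs c X) = scaleC_hs c (W X)" and M: "0 \<le> M"
    and key: "\<And>a b s. orthonormal a b \<Longrightarrow>
       norm (compose_hs (rotation a b s) (W (abs_hs (\<lambda>x. lform p q x ^ n)))
          - W (compose_hs (rotation a b s) (abs_hs (\<lambda>x. lform p q x ^ n))))
        \<le> M * \<bar>s\<bar> * norm (abs_hs (\<lambda>x. lform p q x ^ n))"
  shows "(LINT x:\<omega>|sphere_measure. (cmod (f x))\<^sup>2)
     \<le> real DIM('a) * (2 + 3 * M)\<^sup>2 / \<delta> * (norm (abs_hs (\<lambda>x. lform p q x ^ n)))\<^sup>2 / n"
proof -
  let ?U = "abs_hs (\<lambda>x. lform p q x ^ n)"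
  let ?K = "(2 + 3 * M) / sqrt n * norm ?U"
  have K0: "0 \<le> ?K" using M by simp
  have "norm (mult_hs (\<lambda>x. of_real (x \<bullet> proj b)) (abs_hs f)) \<le> ?K" if b: "b \<in> Basis" for b
  proof (cases "proj b = 0")
    case True
    then show ?thesis using K0 by (simp add: scaleC_0)
  next
    case False
    define w where "w = sgn (proj b)"
    have w: "orthonormal p w" "orthonormal q w"
      using pq False by (auto simp: orthonormal_def w_def norm_sgn sgn_div_norm proj_orthogonal)
    interpret equatorial p q w n by unfold_locales (fact pq w)+
    have bw: "x \<bullet> proj b = norm (proj b) * (x \<bullet> w)" for x using False by (simp add: w_def sgn_div_norm)
    have bmw: "bounded_mult (\<lambda>x. of_real (x \<bullet> w)) (norm w)"
      by (rule bounded_mult_inner) (simp add: w_def norm_sgn)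
    have "mult_hs (\<lambda>x. of_real (x \<bullet> proj b)) (abs_hs f) = norm (proj b) *\<^sub>R mult_hs (\<lambda>x. of_real (x \<bullet> w)) (abs_hs f)"
    proof -
      have "bounded_mult (\<lambda>x. of_real (x \<bullet> proj b)) (norm (proj b))"
        by (rule bounded_mult_inner) (use norm_proj_le[of b] b in simp)
      then show ?thesis
        by (simp add: mult_hs_abs_hs f mult_hs_abs_hs[OF bmw] abs_hs_scaleR[symmetric] L2_bounded_mult[OF bmw] bw mult.assoc)
    qed
    then have "norm (mult_hs (\<lambda>x. of_real (x \<bullet> proj b)) (abs_hs f)) = norm (proj b) * norm (mult_hs (\<lambda>x. of_real (x \<bullet> w)) (W ?U))"
      by (simp add: fW)
    also have "\<dots> \<le> 1 * ?K"
      by (rule mult_mono[OF _ norm_mult_equatorial_le[OF n W iso scal M key]]) (use norm_proj_le[of b] b in simp_all)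
    finally show ?thesis by simp
  qed
  from set_integral_le[OF f \<delta> this] have "(LINT x:\<omega>|sphere_measure. (cmod (f x))\<^sup>2) \<le> real DIM('a) * ?K\<^sup>2 / \<delta>" .
  also have "\<dots> = real DIM('a) * (2 + 3 * M)\<^sup>2 / \<delta> * (norm ?U)\<^sup>2 / n"
    by (simp add: power_mult_distrib power_divide mult_ac)
  finally show ?thesis .
qed

end

theorem theorem2:
  fixes V :: "'a::euclidean_space \<Rightarrow> real"
    and \<omega> :: "'a set"
    and E :: "real set \<Rightarrow> ('a \<Rightarrow> complex) \<Rightarrow> ('a \<Rightarrow> complex)"
    and \<alpha> :: real
  assumes dim: "2 \<le> DIM('a)"
    and V: "sphere_smooth V"
    and \<omega>: "openin (top_of_set (sphere 0 1)) \<omega>"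
    and geodesic: "\<exists>\<gamma>. great_circle \<gamma> \<and> \<gamma> \<subseteq> sphere 0 1 - closure \<omega>"
    and E: "spectral_resolution sphere_measure neg_laplacian E"
    and \<alpha>: "0 < \<alpha>"
  shows "(\<forall>U. generates_unitary_group sphere_measure (add_potential (laplacian_power E (\<alpha> / 2)) V) U \<longrightarrow>
            (\<forall>T>0. \<not> (\<exists>C>0. \<forall>u\<in>L2 sphere_measure.
               (L2_norm sphere_measure u)\<^sup>2
                 \<le> C * (LINT t:{0..T}|lborel. (LINT x:\<omega>|sphere_measure. (cmod (U t u x))\<^sup>2))))) \<and>
         ((\<forall>x\<in>sphere 0 1. V x = 0) \<longrightarrow>
            \<not> (\<exists>C>0. \<forall>\<phi>. eigenfunction sphere_measure (laplacian_power E (\<alpha> / 2)) \<phi> \<longrightarrow>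
               L2_norm sphere_measure \<phi> \<le> C * L2_norm (restrict_space sphere_measure \<omega>) \<phi>))"
proof -
  obtain p q where pq: "orthonormal p q"
    and avoid: "range (\<lambda>t. cos t *\<^sub>R p + sin t *\<^sub>R q) \<subseteq> sphere 0 1 - closure \<omega>"
    using geodesic by (auto simp: great_circle_def orthonormal_def)
  interpret avoided_geodesic \<omega> p q by unfold_locales (fact \<omega> pq avoid)+
  interpret res: sphere_spectral_resolution E by unfold_locales (fact E dim)+
  obtain \<delta> where \<delta>: "0 < \<delta>" "\<And>x. x \<in> \<omega> \<Longrightarrow> \<delta> \<le> (norm (proj x))\<^sup>2" using separation by blast
  let ?u = "\<lambda>n x. lform p q x ^ n"
  let ?N = "\<lambda>n. (norm (abs_hs (?u n)))\<^sup>2"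
  have uL: "?u n \<in> L2 sphere_measure" for n by (rule L2_spoly[OF spoly_lform_power])
  have Npos: "0 < ?N n" for n using norm_equatorial_pos[OF pq, of n] by simp
  have Neq: "(L2_norm sphere_measure (?u n))\<^sup>2 = ?N n" for n by (simp add: norm_abs_hs uL)
  have eig: "eigenpoly (sphere_eigenvalue DIM('a) n) (?u n)" for n
    using pq by (intro eigenpoly_lform_power) (auto simp: orthonormal_def)
  \<comment> \<open>Any upper bound for the mass of relative size O(1/n) is violated once
    \<open>n\<close> exceeds its constant, as the norms are positive.\<close>
  have contradiction: False if "\<And>n. 0 < n \<Longrightarrow> ?N n \<le> D * ?N n / real n" for D
  proof -
    obtain n where n: "D < real n" by (metis reals_Archimedean2)
    define m where "m = max 1 n"
    have m: "0 < m" "D < real m" using n by (auto simp: m_def)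
    have "D * ?N m < real m * ?N m" using m Npos by (intro mult_strict_right_mono) auto
    moreover have "real m * ?N m \<le> D * ?N m" using that[OF m(1)] m(1) by (simp add: pos_le_divide_eq mult.commute)
    ultimately show False by simp
  qed
  show ?thesis
  proof (intro conjI allI impI notI)
    fix U and T :: real
    assume gen: "generates_unitary_group sphere_measure (add_potential (laplacian_power E (\<alpha> / 2)) V) U" and T: "0 < T"
    assume "\<exists>C>0. \<forall>u\<in>L2 sphere_measure. (L2_norm sphere_measure u)\<^sup>2
                 \<le> C * (LINT t:{0..T}|lborel. (LINT x:\<omega>|sphere_measure. (cmod (U t u x))\<^sup>2))"
    then obtain C where C: "0 < C" "\<And>u. u \<in> L2 sphere_measure \<Longrightarrow> (L2_norm sphere_measure u)\<^sup>2
                 \<le> C * (LINT t:{0..T}|lborel. (LINT x:\<omega>|sphere_measure. (cmod (U t u x))\<^sup>2))" by blast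
    interpret sphere_schroedinger_group E "\<alpha> / 2" V U by unfold_locales (fact gen V)+
    obtain M where M: "0 \<le> M" "\<And>a b s x. orthonormal a b \<Longrightarrow> norm x = 1 \<Longrightarrow> \<bar>V (rotation a b s x) - V x\<bar> \<le> M * \<bar>s\<bar>"
      using sphere_smooth_rotation_lipschitz[OF V] by (metis real_norm_def)
    \<comment> \<open>For times in the interval the commutator constant
      \<open>M * \<bar>t\<bar>\<close> is at most \<open>M * T\<close>, which makes the
      concentration uniform in \<open>t\<close>.\<close>
    define D where "D = real DIM('a) * (2 + 3 * (M * T))\<^sup>2 / \<delta>"
    have D0: "0 \<le> D" using \<delta> by (simp add: D_def)
    have conc: "(LINT x:\<omega>|sphere_measure. (cmod (U t (?u n) x))\<^sup>2) \<le> D * ?N n / real n"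
      if n: "0 < n" and t: "t \<in> {0..T}" for n t
    proof -
      have "(LINT x:\<omega>|sphere_measure. (cmod (U t (?u n) x))\<^sup>2) \<le> real DIM('a) * (2 + 3 * (M * T))\<^sup>2 / \<delta> * ?N n / real n"
      proof (rule concentration[where W = "grp.Uh t"])
        show "U t (?u n) \<in> L2 sphere_measure" by (rule grp.U_L2[OF uL])
        show "abs_hs (U t (?u n)) = grp.Uh t (abs_hs (?u n))" by (simp add: grp.Uh_abs_hs uL)
        show "0 \<le> M * T" using M T by simp
        fix a b :: 'a and s :: real assume ab: "orthonormal a b"
        have "norm (compose_hs (rotation a b s) (grp.Uh t (abs_hs (?u n))) - grp.Uh t (compose_hs (rotation a b s) (abs_hs (?u n))))
           \<le> M * \<bar>t\<bar> * \<bar>s\<bar> * norm (abs_hs (?u n))"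
          by (rule rotation_commutator_bound[OF M(2)[OF ab] ab eig])
        also have "\<dots> \<le> M * T * \<bar>s\<bar> * norm (abs_hs (?u n))"
          using M(1) t by (intro mult_right_mono mult_left_mono) auto
        finally show "norm (compose_hs (rotation a b s) (grp.Uh t (abs_hs (?u n))) - grp.Uh t (compose_hs (rotation a b s) (abs_hs (?u n))))
           \<le> M * T * \<bar>s\<bar> * norm (abs_hs (?u n))" .
      qed (fact \<delta> n grp.bounded_linear_Uh grp.norm_Uh grp.Uh_scaleC)+
      then show ?thesis by (simp add: D_def)
    qed
    show False
    proof (rule contradiction[of "C * T * D"])
      fix n :: nat assume n: "0 < n"
      let ?I = "\<lambda>t. LINT x:\<omega>|sphere_measure. (cmod (U t (?u n) x))\<^sup>2"
      have B0: "0 \<le> D * ?N n / real n" using D0 by simp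
      have "(LINT t:{0..T}|lborel. ?I t) \<le> T * (D * ?N n / real n)"
      \<comment> \<open>No measurability in time is established here. If the integrand is not
        integrable, the integral has the default value 0, and the bound holds because its right-hand
        side is nonnegative.\<close>
      proof (cases "set_integrable lborel {0..T} ?I")
        case True
        have "set_integrable lborel {0..T} (\<lambda>_. D * ?N n / real n)"
          unfolding set_integrable_def
          by (intro integrable_scaleR_left integrable_real_indicator) (use T in simp_all)
        then have "(LINT t:{0..T}|lborel. ?I t) \<le> (LINT t:{0..T}|lborel. D * ?N n / real n)"
          by (rule set_integral_mono[OF True]) (rule conc[OF n])
        also have "\<dots> = (LINT t|lborel. indicator {0..T} t * (D * ?N n / real n))"
          by (simp only: set_lebesgue_integral_def real_scaleR_def)
        also have "\<dots> = T * (D * ?N n / real n)"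
          using T by (subst integral_mult_left_zero) simp
        finally show ?thesis .
      next
        case False
        then have "(LINT t:{0..T}|lborel. ?I t) = 0"
          unfolding set_lebesgue_integral_def set_integrable_def by (rule not_integrable_integral_eq)
        then show ?thesis using mult_nonneg_nonneg[OF less_imp_le[OF T] B0] by (simp only:)
      qed
      then have "C * (LINT t:{0..T}|lborel. ?I t) \<le> C * (T * (D * ?N n / real n))"
        using C(1) by (intro mult_left_mono) auto
      with C(2)[OF uL, of n] show "?N n \<le> C * T * D * ?N n / real n"
        unfolding Neq by (simp add: mult_ac)
    qed
  next
    assume "\<exists>C>0. \<forall>\<phi>. eigenfunction sphere_measure (laplacian_power E (\<alpha> / 2)) \<phi> \<longrightarrow>
               L2_norm sphere_measure \<phi> \<le> C * L2_norm (restrict_space sphere_measure \<omega>) \<phi>"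
    then obtain C where C: "0 < C" "\<And>\<phi>. eigenfunction sphere_measure (laplacian_power E (\<alpha> / 2)) \<phi> \<Longrightarrow>
               L2_norm sphere_measure \<phi> \<le> C * L2_norm (restrict_space sphere_measure \<omega>) \<phi>" by blast
    show False
    \<comment> \<open>For eigenfunctions the evolution is replaced by the identity, which commutes
      with rotations: \<open>M = 0\<close>, and 4 is the square of the remaining 2.\<close>
    proof (rule contradiction[of "C\<^sup>2 * (real DIM('a) * 4 / \<delta>)"])
      fix n :: nat assume n: "0 < n"
      have "\<not> (AE x in sphere_measure. ?u n x = 0)"
        using Npos[of n] abs_hs_eq_iff[OF uL[of n] L2_0] by (auto simp: abs_hs_zero)
      then have "eigenfunction sphere_measure (laplacian_power E (\<alpha> / 2)) (?u n)"
        using res.laplacian_power_eigenpoly[OF eig[of n], of "\<alpha> / 2"] uL[of n] unfolding eigenfunction_def by blast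
      then have "L2_norm sphere_measure (?u n) \<le> C * L2_norm (restrict_space sphere_measure \<omega>) (?u n)" by (rule C(2))
      then have "(L2_norm sphere_measure (?u n))\<^sup>2 \<le> (C * L2_norm (restrict_space sphere_measure \<omega>) (?u n))\<^sup>2"
        by (rule power_mono) (simp add: L2_norm_def)
      also have "\<dots> = C\<^sup>2 * (L2_norm (restrict_space sphere_measure \<omega>) (?u n))\<^sup>2" by (rule power_mult_distrib)
      also have "(L2_norm (restrict_space sphere_measure \<omega>) (?u n))\<^sup>2 = (LINT x:\<omega>|sphere_measure. (cmod (?u n x))\<^sup>2)"
        unfolding L2_norm_def set_lebesgue_integral_def using \<omega>_subset \<omega>_sets
        by (subst integral_restrict_space) (simp_all add: Int_absorb2)
      also have "C\<^sup>2 * \<dots> \<le> C\<^sup>2 * (real DIM('a) * (2 + 3 * 0)\<^sup>2 / \<delta> * ?N n / real n)"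
        by (intro mult_left_mono concentration[where W = "\<lambda>X. X" and M = 0, OF uL _ \<delta> n])
          (auto intro: bounded_linear_ident)
      finally show "?N n \<le> C\<^sup>2 * (real DIM('a) * 4 / \<delta>) * ?N n / real n"
        unfolding Neq by (simp add: mult_ac)
    qed
  qed
qed

end
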